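(* Let $(R(m,d))_{m,d\in\mathbb{N}}$ be a family of ordered graphs with the properties described in the context. Then for every ordered graph $F$, \[ \rho_{<}(F) = \lim_{d \to \infty} \lim_{m \to \infty} \rho_{<}(F, R(m, d)). \]
   Context: An ordered graph is a graph whose vertex set carries a total order. An ordered graph $G$ contains (an ordered copy of) an ordered graph $F$ if there is an injective order-preserving map $V(F)\to V(G)$ sending edges of $F$ to edges of $G$; otherwise $G$ is $F$-free. For ordered graphs $F$ and $G$ (with $e(G)>0$), $\rho_{<}(F,G)=\max\{e(G')/e(G) : G'\subseteq G,\ G' \text{ is } F\text{-free}\}$, and the relative Turán density is $\rho_{<}(F)=\inf_G \rho_{<}(F,G)$ over all ordered graphs $G$. For distinct $x,y\in\{0,1\}^d$ let $\delta(x,y)=\min\{i : x_i\neq y_i\}$; $\{0,1\}^d$ is ordered lexicographically ($x<y$ iff $x_{\delta(x,y)}=0$). The set $\{0,1\}^d\times[m]$ is ordered lexicographically: $(x,i)<(y,j)$ iff $x<y$, or $x=y$ and $i<j$. Blocks are $B_x=\{x\}\times[m]$. An edge between $B_x$ and $B_y$ with $\delta(x,y)=\ell$ is a level-$\ell$ edge, and $e_\ell(G)$ is the number of level-$\ell$ edges of $G$. The family $R(m,d)$ (ordered graph on $\{0,1\}^d\times[m]$) satisfies: for every $d\in\mathbb{N}$ and $\varepsilon>0$, for all sufficiently large $m$, (i) for every $\ell\in[d]$, $(1-\varepsilon)2^{d-1}m^2\le e_\ell(R(m,d))\le(1+\varepsilon)2^{d-1}m^2$, and $(1-\varepsilon)d2^{d-1}m^2\le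 e(R(m,d))\le(1+\varepsilon)d2^{d-1}m^2$; (ii) for all distinct $x,y\in\{0,1\}^d$ and all $P\subseteq B_x$, $Q\subseteq B_y$ with $|P|,|Q|\ge m^{2/3}$, the number of edges of $R(m,d)$ between $P$ and $Q$ is at most $(1+\varepsilon)2^{-d+\delta(x,y)}|P||Q|$. (Such a family exists, e.g. from a suitable sample of the random graph in which $(x,i)(y,j)$ is an edge independently with probability $2^{-d+\delta(x,y)}$.) *)

theory Defs
  imports Complex_Main "HOL-Library.List_Lexorder" "HOL-Library.Product_Lexorder"
begin

type_synonym 'a ograph = "'a set \<times> 'a set set"

definition verts :: "'a ograph \<Rightarrow> 'a set" where "verts G = fst G"
definition edges :: "'a ograph \<Rightarrow> 'a set set" where "edges G = snd G"

definition ordered_graph :: "('a::linorder) ograph \<Rightarrow> bool" where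
  "ordered_graph G \<longleftrightarrow> finite (verts G) \<and> (\<forall>e\<in>edges G. e \<subseteq> verts G \<and> card e = 2)"

definition contains :: "('a::linorder) ograph \<Rightarrow> ('b::linorder) ograph \<Rightarrow> bool" where
  "contains G F \<longleftrightarrow> (\<exists>\<phi>. inj_on \<phi> (verts F) \<and> \<phi> ` verts F \<subseteq> verts G
     \<and> (\<forall>u\<in>verts F. \<forall>v\<in>verts F. u < v \<longrightarrow> \<phi> u < \<phi> v)
     \<and> (\<forall>e\<in>edges F. \<phi> ` e \<in> edges G))"

definition subgraph :: "('a::linorder) ograph \<Rightarrow> 'a ograph \<Rightarrow> bool" where
  "subgraph H G \<longleftrightarrow> verts H \<subseteq> verts G \<and> edges H \<subseteq> edges G \<and> (\<forall>e\<in>edges H. e \<subseteq> verts H)"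

definition rho :: "('b::linorder) ograph \<Rightarrow> ('a::linorder) ograph \<Rightarrow> real" where
  "rho F G = Max {real (card (edges H)) / real (card (edges G)) | H. subgraph H G \<and> \<not> contains H F}"

text \<open>rho_<(F): infimum over all (finite) ordered graphs with at least one edge;
  every finite ordered graph is isomorphic to one on a subset of nat.\<close>
definition rho_lt :: "('b::linorder) ograph \<Rightarrow> real" where
  "rho_lt F = Inf {rho F G | G :: nat ograph. ordered_graph G \<and> edges G \<noteq> {}}"

text \<open>{0,1}^d as 0/1 lists of length d (lexicographic order from List_Lexorder),
  {0,1}^d \<times> [m] ordered lexicographically via Product_Lexorder.\<close>
definition cube :: "nat \<Rightarrow> nat list set" where
  "cube d = {x. length x = d \<and> set x \<subseteq> {0,1}}"

definition delta :: "nat list \<Rightarrow> nat list \<Rightarrow> nat" where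
  "delta x y = Suc (LEAST i. x ! i \<noteq> y ! i)"

definition block :: "nat \<Rightarrow> nat list \<Rightarrow> (nat list \<times> nat) set" where
  "block m x = {x} \<times> {1..m}"

definition level_edges :: "(nat list \<times> nat) ograph \<Rightarrow> nat \<Rightarrow> (nat list \<times> nat) set set" where
  "level_edges G l = {e \<in> edges G. \<exists>x i y j. e = {(x,i),(y,j)} \<and> x \<noteq> y \<and> delta x y = l}"

definition edges_between :: "'a ograph \<Rightarrow> 'a set \<Rightarrow> 'a set \<Rightarrow> 'a set set" where
  "edges_between G P Q = {e \<in> edges G. \<exists>p\<in>P. \<exists>q\<in>Q. e = {p,q}}"

end

theory Submission
  imports Defs "HOL-Library.FuncSet"
begin

text \<open>
  Let G' be an F-free subgraph of R(m,d). If a graph G is placed at random inside R(m,d) by an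
  order-preserving embedding, the part of G landing in G' is F-free, so on average at most a
  rho(F,G)-fraction of the edges of G lands in G'. Whenever the random placement hits all edges of R(m,d)
  almost uniformly, this bounds the relative density of G' by rho(F,G) + o(1).

  Conditions (i) and (ii) make every pair of blocks of R(m,d) regular with density
  2^(delta(x,y) - d), so by the counting lemma it suffices to place the vertices of G into large
  subsets of blocks.

  The inner limit exists because R(m,d) can be placed almost uniformly into R(m',d) for m' much
  larger than m: cut each block of R(m',d) into m + s cells and put vertex i of block x
  into cell i + c(x) for independent random shifts c(x) < s. As R(m,d) is regular on windows of length
  s, this smooths out the choice of its edges.

  An arbitrary G on n vertices is placed into R(m,d) for large d along a random caterpillar in
  the binary tree of depth d: from a random node on a random level, repeatedly walk down a random
  number r < S of random bits, split off the next vertex to the left and continue to the right. The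
  forced bits bias the resulting distribution only by O(1 / sqrt S), because a bounded martingale along
  the tree has bounded energy.
\<close>

section \<open>Averages and the counting lemma\<close>

text \<open>Condition on all edges of G landing in R(m,d): an edge sent to the blocks of x and y
  lies in G' with probability about the density of G' there divided by that of R(m,d). The densities
  2^(delta - d) give every level the same total weight, so a placement is good if its block pairs
  have a uniform level and are uniform within that level. This is the law of two leaves on the two
  sides of a uniform node of uniform depth.

  A caterpillar follows this law for the vertices u < v up to two biases. The node t where u splits
  off is biased by the right turns before it, and the leaf of v, ideally uniform to the right of t,
  by the turns after it. The second bias concerns a martingale and is small from any t. The first
  concerns an arbitrary function of t, which is close to a martingale only after averaging over a
  random walk length, and it is small only on average over the start. Hence the random lengths, and
  a range of starting levels much longer than S.

  The bound rho_<(F) \<le> rho(F,R(m,d)) is immediate, since R(m,d) competes in the infimum.\<close>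

definition avg :: "'a set \<Rightarrow> ('a \<Rightarrow> real) \<Rightarrow> real" where
  "avg A f = (\<Sum>a\<in>A. f a) / real (card A)"

lemma avg_const: "finite A \<Longrightarrow> A \<noteq> {} \<Longrightarrow> avg A (\<lambda>_. c) = c"
  by (simp add: avg_def)

lemma avg_cong: "(\<And>a. a \<in> A \<Longrightarrow> f a = g a) \<Longrightarrow> avg A f = avg A g"
  unfolding avg_def by (metis (mono_tags, lifting) sum.cong)

lemma avg_mono: "(\<And>a. a \<in> A \<Longrightarrow> f a \<le> g a) \<Longrightarrow> avg A f \<le> avg A g"
  unfolding avg_def by (intro divide_right_mono sum_mono) auto

lemma avg_add: "avg A (\<lambda>a. f a + g a) = avg A f + avg A g"
  by (simp add: avg_def sum.distrib add_divide_distrib)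

lemma avg_diff: "avg A (\<lambda>a. f a - g a) = avg A f - avg A g"
  by (simp add: avg_def sum_subtractf diff_divide_distrib)

lemma avg_cmult: "avg A (\<lambda>a. c * f a) = c * avg A f"
  by (simp add: avg_def sum_distrib_left)

lemma avg_sum: "avg A (\<lambda>a. \<Sum>i\<in>I. f i a) = (\<Sum>i\<in>I. avg A (f i))"
  unfolding avg_def by (subst sum.swap) (simp add: sum_divide_distrib)

lemma avg_avg: "avg A (\<lambda>a. avg B (f a)) = (\<Sum>a\<in>A. \<Sum>b\<in>B. f a b) / (real (card A) * real (card B))"
  unfolding avg_def sum_divide_distrib[symmetric] by (simp add: mult.commute)

lemma avg_swap: "avg A (\<lambda>a. avg B (f a)) = avg B (\<lambda>b. avg A (\<lambda>a. f a b))"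
  unfolding avg_avg by (subst sum.swap) (simp add: mult.commute)

lemma avg_bounds:
  assumes "finite A" "A \<noteq> {}" "\<And>a. a \<in> A \<Longrightarrow> l \<le> f a" "\<And>a. a \<in> A \<Longrightarrow> f a \<le> h"
  shows "l \<le> avg A f" "avg A f \<le> h"
  using avg_mono[of A "\<lambda>_. l" f] avg_mono[of A f "\<lambda>_. h"] assms by (auto simp: avg_const)

lemma avg_abs_diff_le:
  assumes "finite A" "A \<noteq> {}" "\<And>a. a \<in> A \<Longrightarrow> \<bar>f a - g a\<bar> \<le> c"
  shows "\<bar>avg A f - avg A g\<bar> \<le> c"
proof -
  have *: "- c \<le> f a - g a" "f a - g a \<le> c" if "a \<in> A" for a
    using assms(3)[OF that] by (simp_all add: abs_le_iff)
  show ?thesis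
    using avg_bounds[OF assms(1,2), of "- c" "\<lambda>a. f a - g a" c] * by (simp add: avg_diff abs_le_iff)
qed

lemma avg_abs_le: "\<bar>avg A f\<bar> \<le> avg A (\<lambda>a. \<bar>f a\<bar>)"
  unfolding avg_def by (simp add: abs_divide divide_right_mono sum_abs)

lemma exists_ge_avg:
  assumes "finite A" "A \<noteq> {}" "c \<le> avg A f"
  shows "\<exists>a\<in>A. c \<le> f a"
proof (rule ccontr)
  assume "\<not> ?thesis"
  then have "(\<Sum>a\<in>A. f a) < (\<Sum>a\<in>A. c)" using assms by (intro sum_strict_mono) auto
  moreover have "card A > 0" using assms by (simp add: card_gt_0_iff)
  ultimately have "avg A f < c" by (simp add: avg_def field_simps)
  then show False using assms by simp
qed

lemma avg_reindex: "inj_on h A \<Longrightarrow> avg (h ` A) f = avg A (\<lambda>a. f (h a))"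
  by (simp add: avg_def sum.reindex card_image)

lemma avg_times: "avg (A \<times> B) f = avg A (\<lambda>a. avg B (\<lambda>b. f (a, b)))"
  by (simp add: avg_avg) (simp add: avg_def card_cartesian_product sum.cartesian_product)

lemma avg_PiE_insert:
  assumes "u \<notin> V"
  shows "avg (PiE (insert u V) S) f = avg (PiE V S) (\<lambda>\<psi>. avg (S u) (\<lambda>a. f (\<psi>(u := a))))"
proof -
  have "avg (PiE (insert u V) S) f = avg (S u \<times> PiE V S) (\<lambda>z. f ((\<lambda>(y, g). g(u := y)) z))"
    unfolding PiE_insert_eq by (rule avg_reindex) (rule inj_combinator[OF assms])
  also have "\<dots> = avg (PiE V S) (\<lambda>\<psi>. avg (S u) (\<lambda>a. f (\<psi>(u := a))))"
    by (simp add: avg_times) (rule avg_swap)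
  finally show ?thesis .
qed

lemma avg_PiE_two:
  assumes "u \<in> V" "v \<in> V" "u \<noteq> v"
  shows "avg (PiE V S) f = avg (PiE (V - {u, v}) S)
    (\<lambda>\<psi>. avg (S u) (\<lambda>a. avg (S v) (\<lambda>b. f (\<psi>(u := a, v := b)))))"
proof -
  define V' where "V' = V - {u, v}"
  have V: "V = insert v (insert u V')" "v \<notin> insert u V'" "u \<notin> V'"
    using assms by (auto simp: V'_def)
  show ?thesis
    unfolding V'_def[symmetric] unfolding V(1)
    by (simp add: avg_PiE_insert[OF V(2)] avg_PiE_insert[OF V(3)])
qed

lemma finite_PiE_nonempty:
  assumes "finite V" "\<And>v. v \<in> V \<Longrightarrow> finite (S v) \<and> S v \<noteq> {}"
  shows "finite (PiE V S)" "PiE V S \<noteq> {}"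
  using assms by (auto intro: finite_PiE simp: PiE_eq_empty_iff)

lemma avg_PiE_pair:
  assumes "finite V" "\<And>v. v \<in> V \<Longrightarrow> finite (S v) \<and> S v \<noteq> {}" "u \<in> V" "v \<in> V" "u \<noteq> v"
  shows "avg (PiE V S) (\<lambda>\<phi>. f (\<phi> u) (\<phi> v)) = avg (S u) (\<lambda>a. avg (S v) (\<lambda>b. f a b))"
  using assms finite_PiE_nonempty[of "V - {u, v}" S]
  by (subst avg_PiE_two[of u V v]) (simp_all add: avg_const)

section \<open>Regular pairs and the counting lemma\<close>

definition pcount :: "('b \<Rightarrow> 'b \<Rightarrow> bool) \<Rightarrow> 'b set \<Rightarrow> 'b set \<Rightarrow> real" where
  "pcount h P Q = (\<Sum>a\<in>P. \<Sum>b\<in>Q. of_bool (h a b))"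

text \<open>The error is measured against the full pair \<open>A\<close>, \<open>B\<close> (a
  cut-norm bound), so small \<open>P\<close> and \<open>Q\<close> need no separate
  treatment.\<close>

definition regular_pair :: "('b \<Rightarrow> 'b \<Rightarrow> bool) \<Rightarrow> real \<Rightarrow> real \<Rightarrow> 'b set \<Rightarrow> 'b set \<Rightarrow> bool" where
  "regular_pair h p \<eta> A B \<longleftrightarrow> (\<forall>P Q. P \<subseteq> A \<longrightarrow> Q \<subseteq> B \<longrightarrow>
     \<bar>pcount h P Q - p * real (card P) * real (card Q)\<bar> \<le> \<eta> * real (card A) * real (card B))"

lemma avg_avg_pcount: "avg A (\<lambda>a. avg B (\<lambda>b. of_bool (h a b))) = pcount h A B / (real (card A) * real (card B))"
  by (simp add: avg_avg pcount_def)

lemma avg_rectangle: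
  assumes "finite A" "finite B"
  shows "avg A (\<lambda>a. avg B (\<lambda>b. of_bool (h a b \<and> a \<in> P \<and> b \<in> Q)))
    = pcount h (A \<inter> P) (B \<inter> Q) / (real (card A) * real (card B))"
proof -
  have "pcount (\<lambda>a b. h a b \<and> a \<in> P \<and> b \<in> Q) A B = pcount h (A \<inter> P) (B \<inter> Q)"
    unfolding pcount_def sum.inter_restrict[OF assms(1)] sum.inter_restrict[OF assms(2)]
    by (intro sum.cong refl) (auto intro!: sum.cong)
  then show ?thesis by (simp add: avg_avg_pcount)
qed

lemma pcount_True: "pcount (\<lambda>_ _. True) A B = real (card A) * real (card B)"
  by (simp add: pcount_def)

lemma regular_pair_replace:
  assumes fin: "finite V" "\<And>v. v \<in> V \<Longrightarrow> finite (S v) \<and> S v \<noteq> {}"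
    and uv: "u \<in> V" "v \<in> V" "u \<noteq> v"
    and reg: "regular_pair h p \<eta> (S u) (S v)"
    and C: "\<And>\<psi>. \<exists>P Q. \<forall>a b. C (\<psi>(u := a, v := b)) \<longleftrightarrow> a \<in> P \<and> b \<in> Q"
  shows "\<bar>avg (PiE V S) (\<lambda>\<phi>. of_bool (h (\<phi> u) (\<phi> v) \<and> C \<phi>))
    - p * avg (PiE V S) (\<lambda>\<phi>. of_bool (C \<phi>))\<bar> \<le> \<eta>"
proof -
  have "\<bar>avg (S u) (\<lambda>a. avg (S v) (\<lambda>b. of_bool (h a b \<and> C (\<psi>(u := a, v := b)))))
     - p * avg (S u) (\<lambda>a. avg (S v) (\<lambda>b. of_bool (C (\<psi>(u := a, v := b)))))\<bar> \<le> \<eta>" for \<psi>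
  proof -
    obtain P Q where PQ: "\<And>a b. C (\<psi>(u := a, v := b)) \<longleftrightarrow> a \<in> P \<and> b \<in> Q" using C[of \<psi>] by metis
    have pos: "real (card (S u)) * real (card (S v)) > 0" using fin uv by (simp add: card_gt_0_iff)
    have "\<bar>pcount h (S u \<inter> P) (S v \<inter> Q) - p * (real (card (S u \<inter> P)) * real (card (S v \<inter> Q)))\<bar>
      \<le> \<eta> * (real (card (S u)) * real (card (S v)))"
      using reg unfolding regular_pair_def by (auto simp: mult.assoc)
    then have "\<bar>pcount h (S u \<inter> P) (S v \<inter> Q) / (real (card (S u)) * real (card (S v)))
      - p * (real (card (S u \<inter> P)) * real (card (S v \<inter> Q)) / (real (card (S u)) * real (card (S v))))\<bar> \<le> \<eta>"
      using pos by (simp only: times_divide_eq_right diff_divide_distrib[symmetric] abs_divide abs_of_pos pos_divide_le_eq)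
    then show ?thesis
      unfolding PQ using avg_rectangle[of "S u" "S v" h P Q] avg_rectangle[of "S u" "S v" "\<lambda>_ _. True" P Q]
        fin uv by (simp only: pcount_True simp_thms)
  qed
  then have "\<bar>avg (PiE (V - {u, v}) S) (\<lambda>\<psi>. avg (S u) (\<lambda>a. avg (S v) (\<lambda>b. of_bool (h a b \<and> C (\<psi>(u := a, v := b))))))
     - avg (PiE (V - {u, v}) S) (\<lambda>\<psi>. p * avg (S u) (\<lambda>a. avg (S v) (\<lambda>b. of_bool (C (\<psi>(u := a, v := b))))))\<bar> \<le> \<eta>"
    using fin by (intro avg_abs_diff_le finite_PiE_nonempty) auto
  then show ?thesis
    using uv by (simp add: avg_PiE_two[of u V v] avg_cmult)
qed

text \<open>Edges of \<open>D\<close> are replaced by their densities one at a time; since each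
  \<open>p e\<close> is at most 1, the errors only add up. Edges of \<open>E\<close> stay untouched
  and the relation may depend on the edge, so that a single edge can be tested against an irregular
  subgraph.\<close>

lemma counting_lemma:
  fixes A :: "'a::linorder \<times> 'a \<Rightarrow> 'b \<Rightarrow> 'b \<Rightarrow> bool"
  assumes fin: "finite V" "\<And>v. v \<in> V \<Longrightarrow> finite (S v) \<and> S v \<noteq> {}"
    and "finite D" and E: "\<And>e. e \<in> D \<union> E \<Longrightarrow> fst e \<in> V \<and> snd e \<in> V \<and> fst e < snd e"
    and disj: "D \<inter> E = {}"
    and reg: "\<And>e. e \<in> D \<Longrightarrow> 0 \<le> p e \<and> p e \<le> 1 \<and> regular_pair (A e) (p e) \<eta> (S (fst e)) (S (snd e))"
  shows "\<bar>avg (PiE V S) (\<lambda>\<phi>. of_bool (\<forall>e\<in>D \<union> E. A e (\<phi> (fst e)) (\<phi> (snd e))))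
    - (\<Prod>e\<in>D. p e) * avg (PiE V S) (\<lambda>\<phi>. of_bool (\<forall>e\<in>E. A e (\<phi> (fst e)) (\<phi> (snd e))))\<bar>
    \<le> real (card D) * \<eta>"
  using \<open>finite D\<close> E disj reg
proof (induction D rule: finite_induct)
  case empty
  then show ?case by simp
next
  case (insert d D)
  obtain u v where d: "d = (u, v)" by (cases d)
  have uv: "u \<in> V" "v \<in> V" "u < v" using insert.prems(1)[of d] by (auto simp: d)
  define C where "C = (\<lambda>\<phi>. \<forall>e\<in>D \<union> E. A e (\<phi> (fst e)) (\<phi> (snd e)))"
  define X where "X = avg (PiE V S) (\<lambda>\<phi>. of_bool (A d (\<phi> u) (\<phi> v) \<and> C \<phi>))"
  define Y where "Y = avg (PiE V S) (\<lambda>\<phi>. of_bool (C \<phi>))"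
  define Z where "Z = avg (PiE V S) (\<lambda>\<phi>. of_bool (\<forall>e\<in>E. A e (\<phi> (fst e)) (\<phi> (snd e))))"
  \<comment> \<open>Edges are increasing pairs and \<open>d\<close> itself has been taken out, so no
    remaining condition involves both \<open>u\<close> and \<open>v\<close>. The conditions split
    into those that ignore \<open>v\<close> and those that ignore \<open>u\<close>, which gives the
    rectangle.\<close>
  have not_both: "\<not> ((fst e = u \<or> snd e = u) \<and> (fst e = v \<or> snd e = v))" if "e \<in> D \<union> E" for e
    using that insert.prems(1)[of e] insert.prems(2) insert.hyps uv d by (cases e) auto
  have "\<exists>P Q. \<forall>a b. C (\<psi>(u := a, v := b)) \<longleftrightarrow> a \<in> P \<and> b \<in> Q" for \<psi>
  proof (intro exI allI)
    fix a b
    let ?t = "\<lambda>\<phi> e. A e (\<phi> (fst e)) (\<phi> (snd e))"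
    let ?U = "{e \<in> D \<union> E. fst e \<noteq> v \<and> snd e \<noteq> v}" and ?W = "{e \<in> D \<union> E. fst e = v \<or> snd e = v}"
    have "(\<forall>e\<in>D \<union> E. ?t (\<psi>(u := a, v := b)) e)
      \<longleftrightarrow> (\<forall>e\<in>?U. ?t (\<psi>(u := a, v := b)) e) \<and> (\<forall>e\<in>?W. ?t (\<psi>(u := a, v := b)) e)"
      by blast
    also have "(\<forall>e\<in>?U. ?t (\<psi>(u := a, v := b)) e) \<longleftrightarrow> (\<forall>e\<in>?U. ?t (\<psi>(u := a)) e)"
      by (intro ball_cong) auto
    also have "(\<forall>e\<in>?W. ?t (\<psi>(u := a, v := b)) e) \<longleftrightarrow> (\<forall>e\<in>?W. ?t (\<psi>(v := b)) e)"
      using not_both by (intro ball_cong) (auto simp: fun_upd_def)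
    finally show "C (\<psi>(u := a, v := b)) \<longleftrightarrow> a \<in> {a. \<forall>e\<in>?U. ?t (\<psi>(u := a)) e} \<and> b \<in> {b. \<forall>e\<in>?W. ?t (\<psi>(v := b)) e}"
      unfolding C_def mem_Collect_eq .
  qed
  then have "\<bar>X - p d * Y\<bar> \<le> \<eta>"
    unfolding X_def Y_def using uv insert.prems(3)[of d] d fin
    by (intro regular_pair_replace) auto
  moreover have "\<bar>Y - (\<Prod>e\<in>D. p e) * Z\<bar> \<le> real (card D) * \<eta>"
    unfolding Y_def Z_def C_def using insert.prems by (intro insert.IH) auto
  then have "\<bar>p d\<bar> * \<bar>Y - (\<Prod>e\<in>D. p e) * Z\<bar> \<le> 1 * (real (card D) * \<eta>)"
    using insert.prems(3)[of d] by (intro mult_mono) auto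
  then have "\<bar>p d * Y - (\<Prod>e\<in>insert d D. p e) * Z\<bar> \<le> real (card D) * \<eta>"
    using insert.hyps by (simp add: abs_mult[symmetric] algebra_simps)
  ultimately have "\<bar>X - (\<Prod>e\<in>insert d D. p e) * Z\<bar> \<le> \<eta> + real (card D) * \<eta>"
    by linarith
  moreover have "X = avg (PiE V S) (\<lambda>\<phi>. of_bool (\<forall>e\<in>insert d D \<union> E. A e (\<phi> (fst e)) (\<phi> (snd e))))"
    unfolding X_def C_def by (intro avg_cong) (simp add: d)
  ultimately show ?case
    using insert.hyps by (simp add: Z_def algebra_simps)
qed

section \<open>Relative densities and random placements\<close>

lemma ordered_graph_finite_edges:
  assumes "ordered_graph G" shows "finite (edges G)"
proof -
  have "edges G \<subseteq> Pow (verts G)" using assms by (auto simp: ordered_graph_def)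
  then show ?thesis using assms by (auto simp: ordered_graph_def intro: finite_subset)
qed

lemma finite_rho_set:
  assumes "finite (edges G)"
  shows "finite {real (card (edges H)) / real (card (edges G)) | H. subgraph H G \<and> \<not> contains H F}"
proof (rule finite_subset)
  show "{real (card (edges H)) / real (card (edges G)) | H. subgraph H G \<and> \<not> contains H F}
    \<subseteq> (\<lambda>k. real k / real (card (edges G))) ` {..card (edges G)}"
    using assms by (auto simp: subgraph_def intro!: card_mono)
qed simp

lemma rho_ge:
  assumes "finite (edges G)" "subgraph H G" "\<not> contains H F"
  shows "real (card (edges H)) / real (card (edges G)) \<le> rho F G"
  unfolding rho_def using assms by (intro Max_ge finite_rho_set) blast+

lemma card_edges_le_rho:
  assumes "finite (edges G)" "subgraph H G" "\<not> contains H F"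
  shows "real (card (edges H)) \<le> rho F G * real (card (edges G))"
proof (cases "edges G = {}")
  case True
  then show ?thesis using assms by (simp add: subgraph_def)
next
  case False
  then have "real (card (edges G)) > 0" using assms by (simp add: card_gt_0_iff)
  then show ?thesis using rho_ge[OF assms] by (simp add: field_simps)
qed

text \<open>\<open>Max\<close> is meaningful only on a nonempty set: as \<open>F\<close> has a
  vertex, the empty graph is an \<open>F\<close>-free subgraph.\<close>

lemma rho_attained:
  assumes "finite (edges G)" "verts F \<noteq> {}"
  obtains H where "subgraph H G" "\<not> contains H F" "rho F G = real (card (edges H)) / real (card (edges G))"
proof -
  let ?A = "{real (card (edges H)) / real (card (edges G)) | H. subgraph H G \<and> \<not> contains H F}"
  have "subgraph ({}, {}) G" "\<not> contains ({}, {}) F"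
    using assms(2) by (auto simp: subgraph_def contains_def verts_def edges_def)
  then have "?A \<noteq> {}" by blast
  then have "rho F G \<in> ?A" unfolding rho_def by (intro Max_in finite_rho_set assms)
  then show ?thesis using that by blast
qed

lemma rho_bounds:
  assumes "finite (edges G)" "verts F \<noteq> {}"
  shows "0 \<le> rho F G" "rho F G \<le> 1"
proof -
  obtain H where H: "subgraph H G" "rho F G = real (card (edges H)) / real (card (edges G))"
    using rho_attained[OF assms] by metis
  show "0 \<le> rho F G" using H by simp
  have "card (edges H) \<le> card (edges G)" using H assms by (auto simp: subgraph_def intro!: card_mono)
  then show "rho F G \<le> 1" using H by (auto simp: divide_le_eq_1)
qed

section \<open>Pulling back along order-preserving placements\<close>

definition edge_pairs :: "'a::linorder set set \<Rightarrow> ('a \<times> 'a) set" where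
  "edge_pairs T = {(u, v). u < v \<and> {u, v} \<in> T}"

lemma bij_betw_edge_pairs:
  assumes "\<And>e. e \<in> T \<Longrightarrow> card e = 2"
  shows "bij_betw (\<lambda>e. {fst e, snd e}) (edge_pairs T) T"
proof (rule bij_betwI')
  show "({fst x, snd x} = {fst y, snd y}) = (x = y)" if "x \<in> edge_pairs T" "y \<in> edge_pairs T" for x y
    using that by (cases x; cases y) (auto simp: edge_pairs_def doubleton_eq_iff)
  show "{fst x, snd x} \<in> T" if "x \<in> edge_pairs T" for x
    using that by (auto simp: edge_pairs_def)
  show "\<exists>x\<in>edge_pairs T. e = {fst x, snd x}" if e: "e \<in> T" for e
  proof -
    obtain a b where ab: "e = {a, b}" "a \<noteq> b" using assms[OF e] by (auto simp: card_2_iff)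
    show ?thesis
    proof (cases "a < b")
      case True
      then have "(a, b) \<in> edge_pairs T" using ab e by (simp add: edge_pairs_def)
      then show ?thesis using ab by force
    next
      case False
      then have "(b, a) \<in> edge_pairs T" using ab e by (simp add: edge_pairs_def insert_commute)
      then show ?thesis using ab by force
    qed
  qed
qed

lemma finite_edge_pairs:
  assumes "finite T" "\<And>e. e \<in> T \<Longrightarrow> card e = 2"
  shows "finite (edge_pairs T)" "card (edge_pairs T) = card T"
  using bij_betw_edge_pairs[of T] assms by (auto dest: bij_betw_finite bij_betw_same_card)

lemma pullback_card_le:
  fixes G :: "'a::linorder ograph" and H :: "'b::linorder ograph"
  assumes G: "ordered_graph G" and H: "\<And>e. e \<in> edges H \<Longrightarrow> e \<subseteq> verts H" "\<not> contains H F"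
    and mono: "\<And>u v. u \<in> verts G \<Longrightarrow> v \<in> verts G \<Longrightarrow> u < v \<Longrightarrow> \<phi> u < \<phi> v"
  shows "real (card {e \<in> edge_pairs (edges G). {\<phi> (fst e), \<phi> (snd e)} \<in> edges H}) \<le> rho F G * real (card (edges G))"
proof -
  \<comment> \<open>\<open>\<phi>\<close> may leave \<open>verts H\<close>, so only the vertices and
    edges that land in \<open>H\<close> are kept.\<close>
  define H' where "H' = ({v \<in> verts G. \<phi> v \<in> verts H}, {e \<in> edges G. \<phi> ` e \<in> edges H})"
  have inj: "inj_on \<phi> (verts G)"
    by (rule linorder_inj_onI) (use mono in \<open>auto dest: less_imp_neq\<close>)
  have sub: "subgraph H' G"
    using G H by (fastforce simp: subgraph_def H'_def verts_def edges_def ordered_graph_def)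
  have free: "\<not> contains H' F"
  proof
    assume "contains H' F"
    then obtain \<psi> where \<psi>: "inj_on \<psi> (verts F)" "\<psi> ` verts F \<subseteq> verts H'"
      "\<forall>u\<in>verts F. \<forall>v\<in>verts F. u < v \<longrightarrow> \<psi> u < \<psi> v" "\<forall>e\<in>edges F. \<psi> ` e \<in> edges H'"
      by (auto simp: contains_def)
    have "contains H F"
      unfolding contains_def
    proof (intro exI[of _ "\<phi> \<circ> \<psi>"] conjI ballI impI)
      show "inj_on (\<phi> \<circ> \<psi>) (verts F)"
        using \<psi>(1,2) inj by (auto intro!: comp_inj_on simp: H'_def verts_def intro: inj_on_subset)
      show "(\<phi> \<circ> \<psi>) ` verts F \<subseteq> verts H" using \<psi>(2) by (auto simp: H'_def verts_def)
      show "(\<phi> \<circ> \<psi>) u < (\<phi> \<circ> \<psi>) v" if "u \<in> verts F" "v \<in> verts F" "u < v" for u v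
        using that \<psi> by (auto intro!: mono simp: H'_def verts_def)
      show "(\<phi> \<circ> \<psi>) ` e \<in> edges H" if "e \<in> edges F" for e
        using that \<psi>(4) by (auto simp: H'_def edges_def image_comp)
    qed
    then show False using H by simp
  qed
  have card2: "\<And>e. e \<in> edges G \<Longrightarrow> card e = 2" using G by (simp add: ordered_graph_def)
  have "inj_on (\<lambda>e. {fst e, snd e}) (edge_pairs (edges G))"
    using bij_betw_edge_pairs[OF card2] by (auto simp: bij_betw_def)
  then have "card {e \<in> edge_pairs (edges G). {\<phi> (fst e), \<phi> (snd e)} \<in> edges H} \<le> card (edges H')"
    using ordered_graph_finite_edges[OF G]
    by (intro card_inj_on_le[of "\<lambda>e. {fst e, snd e}"])
       (auto simp: H'_def edges_def edge_pairs_def inj_on_def)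
  also have "real (card (edges H')) \<le> rho F G * real (card (edges G))"
    by (intro card_edges_le_rho ordered_graph_finite_edges G sub free)
  finally show ?thesis by simp
qed

text \<open>For random images, all edges of \<open>G\<close> land in \<open>T\<close> with
  probability close to \<open>P\<close>, the product of the \<open>p e\<close>. That moreover
  \<open>e\<close> lands in \<open>H\<close> has probability close to \<open>P\<close> times the
  summand of \<open>e\<close>, because only the factor \<open>p e\<close> is exchanged for the
  density of \<open>H\<close>. Every single placement puts at most
  \<open>rho F G * card (edges G)\<close> edges into \<open>H\<close>; dividing by \<open>P\<close>
  gives the bound.\<close>

lemma placement_bound:
  fixes G :: "'a::linorder ograph" and H :: "'b::linorder ograph" and F :: "'c::linorder ograph"
  assumes G: "ordered_graph G" and F: "verts F \<noteq> {}"
    and H: "\<And>e. e \<in> edges H \<Longrightarrow> e \<subseteq> verts H" "\<not> contains H F" "edges H \<subseteq> T"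
    and S: "\<And>v. v \<in> verts G \<Longrightarrow> finite (S v) \<and> S v \<noteq> {}"
    and mono: "\<And>u v a b. u \<in> verts G \<Longrightarrow> v \<in> verts G \<Longrightarrow> u < v \<Longrightarrow> a \<in> S u \<Longrightarrow> b \<in> S v \<Longrightarrow> a < b"
    and r: "r > 0" and \<eta>: "0 \<le> \<eta>" "2 * real (card (edges G)) ^ 2 * \<eta> \<le> \<epsilon> * r ^ card (edges G)"
    and reg: "\<And>e. e \<in> edge_pairs (edges G) \<Longrightarrow> r \<le> p e \<and> p e \<le> 1
      \<and> regular_pair (\<lambda>a b. {a, b} \<in> T) (p e) \<eta> (S (fst e)) (S (snd e))"
  shows "(\<Sum>e\<in>edge_pairs (edges G). pcount (\<lambda>a b. {a, b} \<in> edges H) (S (fst e)) (S (snd e))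
      / (p e * (real (card (S (fst e))) * real (card (S (snd e)))))) \<le> rho F G * real (card (edges G)) + \<epsilon>"
proof -
  define E where "E = edge_pairs (edges G)"
  define n where "n = real (card (edges G))"
  define \<Phi> where "\<Phi> = PiE (verts G) S"
  define t where "t = (\<lambda>\<phi> (e::'a\<times>'a). {\<phi> (fst e), \<phi> (snd e)} \<in> T)"
  define h where "h = (\<lambda>\<phi> (e::'a\<times>'a). {\<phi> (fst e), \<phi> (snd e)} \<in> edges H)"
  define N where "N = avg \<Phi> (\<lambda>\<phi>. of_bool (\<forall>e\<in>E. t \<phi> e))"
  define M where "M e = avg \<Phi> (\<lambda>\<phi>. of_bool (h \<phi> e \<and> (\<forall>e'\<in>E. t \<phi> e')))" for e
  define w where "w e = pcount (\<lambda>a b. {a, b} \<in> edges H) (S (fst e)) (S (snd e))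
      / (p e * (real (card (S (fst e))) * real (card (S (snd e)))))" for e
  define P where "P = (\<Prod>e\<in>E. p e)"
  have card2: "\<And>e. e \<in> edges G \<Longrightarrow> card e = 2" and finV: "finite (verts G)"
    using G by (auto simp: ordered_graph_def)
  have finE: "finite E" and cardE: "card E = card (edges G)"
    unfolding E_def using finite_edge_pairs[OF ordered_graph_finite_edges[OF G] card2] by auto
  have EV: "fst e \<in> verts G \<and> snd e \<in> verts G \<and> fst e < snd e" if "e \<in> E" for e
    using that G by (auto simp: E_def edge_pairs_def ordered_graph_def)
  have fin\<Phi>: "finite \<Phi>" "\<Phi> \<noteq> {}" unfolding \<Phi>_def using finite_PiE_nonempty[OF finV S] by auto
  have rho: "0 \<le> rho F G" "rho F G \<le> 1"
    using rho_bounds[OF ordered_graph_finite_edges[OF G] F] by auto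
  have P0: "r ^ card (edges G) \<le> P"
    using reg r unfolding P_def cardE[symmetric] prod_constant[symmetric] by (intro prod_mono) (auto simp: E_def)
  have Ppos: "P > 0" using P0 r by (meson less_le_trans zero_less_power)
  have "\<bar>avg \<Phi> (\<lambda>\<phi>. of_bool (\<forall>e\<in>E \<union> {}. (\<lambda>a b. {a, b} \<in> T) (\<phi> (fst e)) (\<phi> (snd e))))
    - P * avg \<Phi> (\<lambda>\<phi>. of_bool (\<forall>e\<in>{}. (\<lambda>a b. {a, b} \<in> T) (\<phi> (fst e)) (\<phi> (snd e))))\<bar> \<le> real (card E) * \<eta>"
    unfolding P_def \<Phi>_def
  proof (rule counting_lemma[OF finV S finE])
    show "0 \<le> p e \<and> p e \<le> 1 \<and> regular_pair (\<lambda>a b. {a, b} \<in> T) (p e) \<eta> (S (fst e)) (S (snd e))" if "e \<in> E" for e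
      using that reg[of e] r by (auto simp: E_def)
  qed (use EV in auto)
  then have "\<bar>N - P * avg \<Phi> (\<lambda>\<phi>. 1)\<bar> \<le> real (card E) * \<eta>"
    by (simp add: N_def t_def)
  then have N: "N \<le> P + n * \<eta>" by (simp add: avg_const fin\<Phi> cardE n_def)
  have M: "P * w e - n * \<eta> \<le> M e" if e: "e \<in> E" for e
  proof -
    \<comment> \<open>All edges but \<open>e\<close> are counted through the regularity of
      \<open>T\<close>; \<open>e\<close> is tested against \<open>H\<close>, about which nothing is
      known, and so it stays in the untouched part.\<close>
    have "\<bar>avg \<Phi> (\<lambda>\<phi>. of_bool (\<forall>e'\<in>(E - {e}) \<union> {e}. (\<lambda>a b. if e' = e then {a, b} \<in> edges H else {a, b} \<in> T) (\<phi> (fst e')) (\<phi> (snd e'))))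
      - (\<Prod>e'\<in>E - {e}. p e') * avg \<Phi> (\<lambda>\<phi>. of_bool (\<forall>e'\<in>{e}. (\<lambda>a b. if e' = e then {a, b} \<in> edges H else {a, b} \<in> T) (\<phi> (fst e')) (\<phi> (snd e'))))\<bar>
      \<le> real (card (E - {e})) * \<eta>"
      unfolding \<Phi>_def
    proof (rule counting_lemma[OF finV S])
      show "0 \<le> p e' \<and> p e' \<le> 1 \<and> regular_pair (\<lambda>a b. if e' = e then {a, b} \<in> edges H else {a, b} \<in> T) (p e') \<eta> (S (fst e')) (S (snd e'))"
        if "e' \<in> E - {e}" for e'
        using that reg[of e'] r by (auto simp: E_def)
    qed (use EV e finE in auto)
    moreover have "avg \<Phi> (\<lambda>\<phi>. of_bool (\<forall>e'\<in>(E - {e}) \<union> {e}. (\<lambda>a b. if e' = e then {a, b} \<in> edges H else {a, b} \<in> T) (\<phi> (fst e')) (\<phi> (snd e')))) = M e"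
      unfolding M_def
    proof (intro avg_cong arg_cong[where f = of_bool])
      fix \<phi>
      have "h \<phi> e \<Longrightarrow> t \<phi> e" using H(3) by (auto simp: h_def t_def)
      then show "(\<forall>e'\<in>E - {e} \<union> {e}. if e' = e then {\<phi> (fst e'), \<phi> (snd e')} \<in> edges H else {\<phi> (fst e'), \<phi> (snd e')} \<in> T)
         = (h \<phi> e \<and> (\<forall>e'\<in>E. t \<phi> e'))"
        by (auto simp: h_def t_def)
    qed
    moreover have "avg \<Phi> (\<lambda>\<phi>. of_bool (\<forall>e'\<in>{e}. (\<lambda>a b. if e' = e then {a, b} \<in> edges H else {a, b} \<in> T) (\<phi> (fst e')) (\<phi> (snd e'))))
      = pcount (\<lambda>a b. {a, b} \<in> edges H) (S (fst e)) (S (snd e)) / (real (card (S (fst e))) * real (card (S (snd e))))"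
      using avg_PiE_pair[of "verts G" S "fst e" "snd e" "\<lambda>a b. of_bool ({a, b} \<in> edges H)"] finV S EV[OF e]
        less_imp_neq[of "fst e" "snd e"]
      by (simp add: \<Phi>_def avg_avg_pcount)
    moreover have "P = p e * (\<Prod>e'\<in>E - {e}. p e')"
      unfolding P_def using finE e by (rule prod.remove)
    moreover have "p e > 0" using reg[of e] e r by (simp add: E_def)
    ultimately have "\<bar>M e - P * w e\<bar> \<le> real (card (E - {e})) * \<eta>"
      by (simp add: w_def field_simps)
    also have "\<dots> \<le> n * \<eta>"
      using \<eta>(1) cardE finE by (intro mult_right_mono) (auto simp: n_def card_Diff_subset_Int intro: card_mono)
    finally show ?thesis by linarith
  qed
  have "(\<Sum>e\<in>E. M e) = avg \<Phi> (\<lambda>\<phi>. \<Sum>e\<in>E. of_bool (h \<phi> e \<and> (\<forall>e'\<in>E. t \<phi> e')))"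
    unfolding M_def by (rule avg_sum[symmetric])
  also have "\<dots> \<le> avg \<Phi> (\<lambda>\<phi>. rho F G * n * of_bool (\<forall>e'\<in>E. t \<phi> e'))"
  proof (rule avg_mono)
    fix \<phi> assume \<phi>: "\<phi> \<in> \<Phi>"
    have "real (card {e \<in> E. h \<phi> e}) \<le> rho F G * n"
      unfolding E_def h_def n_def
      by (rule pullback_card_le[OF G H(1,2)]) (use \<phi> mono in \<open>auto simp: \<Phi>_def PiE_iff\<close>)
    then have "(\<Sum>e\<in>E. of_bool (h \<phi> e)) \<le> rho F G * n"
      using finE by (simp add: sum.If_cases of_bool_def Int_def)
    then have "(\<Sum>e\<in>E. of_bool (h \<phi> e \<and> Q)) \<le> rho F G * n * of_bool Q" for Q
      by (cases Q) simp_all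
    then show "(\<Sum>e\<in>E. of_bool (h \<phi> e \<and> (\<forall>e'\<in>E. t \<phi> e'))) \<le> rho F G * n * of_bool (\<forall>e'\<in>E. t \<phi> e')" .
  qed
  also have "\<dots> = rho F G * n * N" by (simp add: N_def avg_cmult)
  also have "\<dots> \<le> rho F G * n * (P + n * \<eta>)"
    using N rho by (intro mult_left_mono) (auto simp: n_def)
  finally have "(\<Sum>e\<in>E. M e) \<le> rho F G * n * P + rho F G * (n * n * \<eta>)" by (simp add: algebra_simps)
  moreover have "rho F G * (n * n * \<eta>) \<le> 1 * (n * n * \<eta>)"
    using rho \<eta>(1) by (intro mult_right_mono) (auto simp: n_def)
  moreover have "(\<Sum>e\<in>E. P * w e - n * \<eta>) \<le> (\<Sum>e\<in>E. M e)" by (intro sum_mono M)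
  moreover have "(\<Sum>e\<in>E. P * w e - n * \<eta>) = P * (\<Sum>e\<in>E. w e) - n * n * \<eta>"
    by (simp add: sum_subtractf sum_distrib_left cardE n_def)
  \<comment> \<open>One \<open>n * n * \<eta>\<close> comes from summing the errors of the
    \<open>M e\<close>, the other from the error of \<open>N\<close> multiplied by
    \<open>rho F G * n\<close>.\<close>
  ultimately have "P * (\<Sum>e\<in>E. w e) \<le> rho F G * n * P + 2 * (n * n * \<eta>)" by linarith
  also have "2 * (n * n * \<eta>) \<le> \<epsilon> * r ^ card (edges G)"
    using \<eta>(2) by (simp add: n_def power2_eq_square)
  also have "\<dots> \<le> \<epsilon> * P"
  proof (intro mult_left_mono P0)
    have "0 \<le> \<epsilon> * r ^ card (edges G)" using \<eta> by (meson mult_nonneg_nonneg order_trans zero_le_numeral zero_le_power2)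
    then show "0 \<le> \<epsilon>" using zero_less_power[OF r, of "card (edges G)"] by (simp add: zero_le_mult_iff)
  qed
  finally have "P * (\<Sum>e\<in>E. w e) \<le> P * (rho F G * n + \<epsilon>)" by (simp add: algebra_simps)
  then show ?thesis using Ppos by (simp add: w_def E_def n_def)
qed

section \<open>Regularity of the host graphs\<close>

lemma cube_0: "cube 0 = {[]}"
  by (auto simp: cube_def)

lemma bij_betw_cube_append: "bij_betw (\<lambda>(a, b). a @ b) (cube j \<times> cube k) (cube (j + k))"
proof (rule bij_betwI')
  show "\<exists>z\<in>cube j \<times> cube k. x = (\<lambda>(a, b). a @ b) z" if "x \<in> cube (j + k)" for x
    using that set_take_subset[of j x] set_drop_subset[of j x]
    by (intro bexI[of _ "(take j x, drop j x)"]) (auto simp: cube_def)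
next
  show "((case z of (a, b) \<Rightarrow> a @ b) = (case w of (a, b) \<Rightarrow> a @ b)) = (z = w)"
    if "z \<in> cube j \<times> cube k" "w \<in> cube j \<times> cube k" for z w
    using that by (cases z; cases w) (simp add: cube_def)
  show "(case z of (a, b) \<Rightarrow> a @ b) \<in> cube (j + k)" if "z \<in> cube j \<times> cube k" for z
    using that by (cases z) (simp add: cube_def)
qed

lemma cube_1: "cube (Suc 0) = {[0], [1]}"
  by (auto simp: cube_def length_Suc_conv)

lemma finite_cube: "finite (cube d)" and card_cube: "card (cube d) = 2 ^ d"
proof (induction d)
  case (Suc d)
  { case 1 show ?case using Suc bij_betw_finite[OF bij_betw_cube_append[of 1 d]] by (simp add: cube_1) }
  { case 2 show ?case using Suc bij_betw_same_card[OF bij_betw_cube_append[of 1 d]]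
      by (simp add: cube_1 card_cartesian_product) }
qed (simp_all add: cube_0)

lemma cube_nonempty: "cube d \<noteq> {}"
  using card_cube[of d] by auto

lemma append_less_iff: "s @ x < s @ y \<longleftrightarrow> x < (y :: nat list)"
  by (induction s) auto

lemma delta_append: "c \<noteq> c' \<Longrightarrow> delta (s @ c # a) (s @ c' # b) = Suc (length s)"
  unfolding delta_def
  by (intro arg_cong[where f = Suc] Least_equality) (auto simp: nth_append not_less[symmetric])

lemma delta_commute: "delta x y = delta y x"
  by (simp add: delta_def eq_commute[of "x ! _"])

section \<open>Pairs of leaves grouped by level\<close>

definition cube_pairs :: "nat \<Rightarrow> (nat list \<times> nat list) set" where
  "cube_pairs d = {(x, y). x \<in> cube d \<and> y \<in> cube d \<and> x < y}"

definition level_pairs :: "nat \<Rightarrow> nat \<Rightarrow> (nat list \<times> nat list) set" where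
  "level_pairs d l = {(x, y) \<in> cube_pairs d. delta x y = l}"

lemma cube_pairs_decompose:
  assumes "(x, y) \<in> cube_pairs d"
  obtains s a b where "x = s @ 0 # a" "y = s @ 1 # b" "length s < d"
    "s \<in> cube (length s)" "a \<in> cube (d - Suc (length s))" "b \<in> cube (d - Suc (length s))"
proof -
  have xy: "length x = d" "length y = d" "set x \<subseteq> {0, 1}" "set y \<subseteq> {0, 1}" "x < y"
    using assms by (auto simp: cube_pairs_def cube_def)
  obtain s c a c' b where s: "c \<noteq> c'" "x = s @ [c] @ a" "y = s @ [c'] @ b"
    using same_length_different[of x y] xy less_imp_neq[OF xy(5)] by metis
  have "c < c'" using xy(5) s by (simp add: append_less_iff)
  moreover have "c \<in> {0, 1}" "c' \<in> {0, 1}" using xy(3,4) s by auto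
  ultimately have "c = 0" "c' = 1" by auto
  then show ?thesis using that[of s a b] s xy by (auto simp: cube_def)
qed

text \<open>Levels count from 1 and depths from 0: the pairs of level \<open>Suc l\<close> split at
  a node of depth \<open>l\<close>. In product form, a sum over a level becomes an average over that
  node and two independent leaves below its children.\<close>

lemma bij_betw_level_pairs:
  "bij_betw (\<lambda>(s, a, b). (s @ 0 # a, s @ 1 # b)) (cube l \<times> cube k \<times> cube k) (level_pairs (Suc (l + k)) (Suc l))"
proof (rule bij_betwI')
  fix z assume "z \<in> level_pairs (Suc (l + k)) (Suc l)"
  then obtain x y where z: "z = (x, y)" "(x, y) \<in> cube_pairs (Suc (l + k))" "delta x y = Suc l"
    by (auto simp: level_pairs_def)
  from z(2) obtain s a b where s: "x = s @ 0 # a" "y = s @ 1 # b"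
    "s \<in> cube (length s)" "a \<in> cube (Suc (l + k) - Suc (length s))" "b \<in> cube (Suc (l + k) - Suc (length s))"
    by (rule cube_pairs_decompose)
  have "length s = l" using z(3) s by (simp add: delta_append)
  then show "\<exists>w\<in>cube l \<times> cube k \<times> cube k. z = (\<lambda>(s, a, b). (s @ 0 # a, s @ 1 # b)) w"
    using s z by force
next
  fix z w assume "z \<in> cube l \<times> cube k \<times> cube k" "w \<in> cube l \<times> cube k \<times> cube k"
  then show "((case z of (s, a, b) \<Rightarrow> (s @ 0 # a, s @ 1 # b)) = (case w of (s, a, b) \<Rightarrow> (s @ 0 # a, s @ 1 # b))) = (z = w)"
    by (cases z; cases w) (simp add: cube_def, blast)
next
  fix z assume z: "z \<in> cube l \<times> cube k \<times> cube k"
  obtain s a b where sab: "z = (s, a, b)" by (cases z)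
  have "delta (s @ 0 # a) (s @ 1 # b) = Suc l" using z delta_append[of 0 1 s a b] by (simp add: sab cube_def)
  then show "(case z of (s, a, b) \<Rightarrow> (s @ 0 # a, s @ 1 # b)) \<in> level_pairs (Suc (l + k)) (Suc l)"
    using z by (simp add: sab cube_def level_pairs_def cube_pairs_def append_less_iff)
qed

lemma finite_cube_pairs: "finite (cube_pairs d)"
  by (rule finite_subset[of _ "cube d \<times> cube d"]) (auto simp: cube_pairs_def finite_cube)

lemma finite_level_pairs: "finite (level_pairs d l)"
  by (rule finite_subset[OF _ finite_cube_pairs[of d]]) (auto simp: level_pairs_def)

lemma card_cube_pairs_le: "real (card (cube_pairs d)) \<le> 4 ^ d"
proof -
  have "card (cube_pairs d) \<le> card (cube d \<times> cube d)"
    by (intro card_mono) (auto simp: cube_pairs_def finite_cube)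
  also have "\<dots> = 4 ^ d" by (simp add: card_cartesian_product card_cube flip: power_mult_distrib)
  finally show ?thesis by (metis of_nat_le_iff of_nat_numeral of_nat_power)
qed

lemma sum_cube_pairs: "(\<Sum>z\<in>cube_pairs d. f z) = (\<Sum>l<d. \<Sum>z\<in>level_pairs d (Suc l). f z)"
proof -
  have "cube_pairs d = (\<Union>l<d. level_pairs d (Suc l))"
  proof (intro set_eqI iffI)
    fix z assume z: "z \<in> cube_pairs d"
    then obtain x y where xy: "z = (x, y)" "(x, y) \<in> cube_pairs d" by (cases z) auto
    from xy(2) obtain s a b where s: "x = s @ 0 # a" "y = s @ 1 # b" "length s < d"
      by (rule cube_pairs_decompose)
    then have "z \<in> level_pairs d (Suc (length s))"
      using z xy delta_append[of 0 1 s a b] by (simp add: level_pairs_def)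
    then show "z \<in> (\<Union>l<d. level_pairs d (Suc l))" using s(3) by blast
  qed (auto simp: level_pairs_def)
  moreover have "(\<Sum>z\<in>(\<Union>l<d. level_pairs d (Suc l)). f z) = (\<Sum>l<d. \<Sum>z\<in>level_pairs d (Suc l). f z)"
    by (intro sum.UNION_disjoint) (auto simp: finite_level_pairs, auto simp: level_pairs_def)
  ultimately show ?thesis by simp
qed

definition edge_prob :: "nat \<Rightarrow> nat list \<Rightarrow> nat list \<Rightarrow> real" where
  "edge_prob d x y = 2 powr (real (delta x y) - real d)"

lemma edge_prob_level: "(x, y) \<in> level_pairs (Suc (l + k)) (Suc l) \<Longrightarrow> edge_prob (Suc (l + k)) x y = 1 / 2 ^ k"
  by (simp add: edge_prob_def level_pairs_def powr_minus powr_realpow divide_inverse)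

text \<open>There are \<open>2 ^ l * 4 ^ k\<close> pairs, each of weight \<open>1 / 2 ^ k\<close>.
  The total \<open>2 ^ (l + k)\<close> depends only on the dimension, not on the level.\<close>

lemma sum_level_pairs:
  "(\<Sum>(x, y)\<in>level_pairs (Suc (l + k)) (Suc l). edge_prob (Suc (l + k)) x y * f x y)
    = 2 ^ (l + k) * avg (cube l) (\<lambda>s. avg (cube k) (\<lambda>a. avg (cube k) (\<lambda>b. f (s @ 0 # a) (s @ 1 # b))))"
proof -
  have "(\<Sum>(x, y)\<in>level_pairs (Suc (l + k)) (Suc l). edge_prob (Suc (l + k)) x y * f x y)
    = (\<Sum>(x, y)\<in>level_pairs (Suc (l + k)) (Suc l). f x y / 2 ^ k)"
    by (intro sum.cong) (auto simp: edge_prob_level)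
  also have "\<dots> = (\<Sum>(s, a, b)\<in>cube l \<times> cube k \<times> cube k. f (s @ 0 # a) (s @ 1 # b) / 2 ^ k)"
    by (subst sum.reindex_bij_betw[OF bij_betw_level_pairs, symmetric]) (simp add: case_prod_unfold)
  also have "\<dots> = (\<Sum>s\<in>cube l. \<Sum>a\<in>cube k. \<Sum>b\<in>cube k. f (s @ 0 # a) (s @ 1 # b)) / 2 ^ k"
    by (simp add: sum.cartesian_product case_prod_unfold sum_divide_distrib)
  also have "\<dots> = 2 ^ (l + k) * avg (cube l) (\<lambda>s. avg (cube k) (\<lambda>a. avg (cube k) (\<lambda>b. f (s @ 0 # a) (s @ 1 # b))))"
    by (simp only: avg_avg) (simp add: avg_def card_cube power_add flip: sum_divide_distrib)
  finally show ?thesis .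
qed

lemma sum_edge_prob_level:
  assumes "1 \<le> l" "l \<le> d"
  shows "(\<Sum>(x, y)\<in>level_pairs d l. edge_prob d x y) = 2 ^ (d - 1)"
proof -
  obtain l' where l: "l = Suc l'" using assms by (cases l) auto
  obtain k where d: "d = Suc (l' + k)" using assms l by (metis Suc_le_D add_Suc le_Suc_ex)
  show ?thesis
    using sum_level_pairs[of l' k "\<lambda>_ _. 1"] by (simp add: l d avg_const finite_cube cube_nonempty)
qed

lemma delta_bounds:
  assumes "x \<in> cube d" "y \<in> cube d" "x \<noteq> y"
  shows "1 \<le> delta x y" "delta x y \<le> d"
proof -
  have "1 \<le> delta x y \<and> delta x y \<le> d" if "(x, y) \<in> cube_pairs d" for x y
    using that by (rule cube_pairs_decompose) (simp add: delta_append)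
  moreover have "(x, y) \<in> cube_pairs d \<or> (y, x) \<in> cube_pairs d"
    using assms by (auto simp: cube_pairs_def)
  ultimately show "1 \<le> delta x y" "delta x y \<le> d" by (metis delta_commute)+
qed

lemma edge_prob_bounds:
  assumes "x \<in> cube d" "y \<in> cube d" "x \<noteq> y"
  shows "1 / 2 ^ d \<le> edge_prob d x y" "edge_prob d x y \<le> 1" "0 < edge_prob d x y"
proof -
  have "2 powr (- real d) \<le> edge_prob d x y" "edge_prob d x y \<le> 2 powr 0"
    using delta_bounds[OF assms] unfolding edge_prob_def by (intro powr_mono; simp)+
  then show "1 / 2 ^ d \<le> edge_prob d x y" "edge_prob d x y \<le> 1"
    by (auto simp: powr_minus powr_realpow divide_inverse)
  show "0 < edge_prob d x y" by (simp add: edge_prob_def)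
qed

section \<open>Counting edges inside and between blocks\<close>

abbreviation joined :: "'a set set \<Rightarrow> 'a \<Rightarrow> 'a \<Rightarrow> bool" where
  "joined T \<equiv> \<lambda>a b. {a, b} \<in> T"

lemma pcount_commute: "pcount (joined T) P Q = pcount (joined T) Q P"
  unfolding pcount_def by (subst sum.swap) (simp add: insert_commute)

lemma pcount_nonneg: "0 \<le> pcount h P Q"
  by (simp add: pcount_def sum_nonneg)

lemma pcount_le: "pcount h P Q \<le> real (card P) * real (card Q)"
proof -
  have "pcount h P Q \<le> (\<Sum>a\<in>P. \<Sum>b\<in>Q. 1)" unfolding pcount_def by (intro sum_mono) simp
  then show ?thesis by simp
qed

lemma pcount_Un_left: "finite P \<Longrightarrow> finite P' \<Longrightarrow> P \<inter> P' = {} \<Longrightarrow> pcount h (P \<union> P') Q = pcount h P Q + pcount h P' Q"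
  by (simp add: pcount_def sum.union_disjoint)

lemma pcount_Un_right: "finite Q \<Longrightarrow> finite Q' \<Longrightarrow> Q \<inter> Q' = {} \<Longrightarrow> pcount h P (Q \<union> Q') = pcount h P Q + pcount h P Q'"
  unfolding pcount_def by (subst sum.distrib[symmetric]) (intro sum.cong refl sum.union_disjoint)

lemma pcount_mono: "(\<And>a b. h a b \<Longrightarrow> h' a b) \<Longrightarrow> pcount h P Q \<le> pcount h' P Q"
  unfolding pcount_def by (intro sum_mono) (auto simp: of_bool_def)

lemma edges_betweenI: "{p, q} \<in> edges G \<Longrightarrow> p \<in> P \<Longrightarrow> q \<in> Q \<Longrightarrow> {p, q} \<in> edges_between G P Q"
  by (auto simp: edges_between_def)

lemma card_edges_between:
  assumes "finite P" "finite Q" "P \<inter> Q = {}"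
  shows "real (card (edges_between G P Q)) = pcount (joined (edges G)) P Q"
proof -
  let ?Z = "{z \<in> P \<times> Q. {fst z, snd z} \<in> edges G}"
  have "edges_between G P Q = (\<lambda>z. {fst z, snd z}) ` ?Z"
    unfolding edges_between_def by (rule set_eqI) (simp add: image_iff, blast)
  moreover have "inj_on (\<lambda>z. {fst z, snd z}) ?Z"
    using assms(3) by (auto simp: inj_on_def doubleton_eq_iff)
  ultimately have "card (edges_between G P Q) = card ?Z" by (simp add: card_image)
  moreover have "pcount (joined (edges G)) P Q = (\<Sum>z\<in>P \<times> Q. of_bool ({fst z, snd z} \<in> edges G))"
    by (simp only: pcount_def sum.cartesian_product case_prod_unfold)
  moreover have "\<dots> = real (card ?Z)"
    using assms by (simp add: Int_def)
  ultimately show ?thesis by simp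
qed

lemma finite_block: "finite (block m x)" and card_block: "card (block m x) = m"
  by (simp_all add: block_def card_cartesian_product)

lemma block_disjoint: "x \<noteq> y \<Longrightarrow> block m x \<inter> block m y = {}"
  by (auto simp: block_def)

text \<open>Edges inside a block belong to no level, and condition (ii) says nothing about them;
  they are controlled only through the gap between the total count and the level counts.\<close>

definition inner_edges :: "nat \<Rightarrow> (nat list \<times> nat) set set \<Rightarrow> (nat list \<times> nat) set set" where
  "inner_edges m T = {e \<in> T. \<exists>x. e \<subseteq> block m x}"

lemma card_le_inner_plus_pairs:
  assumes "ordered_graph G" "verts G = cube d \<times> {1..m}" "T \<subseteq> edges G"
  shows "real (card T) \<le> real (card (inner_edges m T)) + (\<Sum>(x, y)\<in>cube_pairs d. pcount (joined T) (block m x) (block m y))"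
proof -
  let ?U = "\<Union>(x, y)\<in>cube_pairs d. edges_between ({}, T) (block m x) (block m y)"
  have finT: "finite T" using assms ordered_graph_finite_edges finite_subset by blast
  have finB: "finite (edges_between ({}, T) P Q)" for P Q
    by (rule finite_subset[OF _ finT]) (auto simp: edges_between_def edges_def)
  have "T \<subseteq> inner_edges m T \<union> ?U"
  proof
    fix e assume e: "e \<in> T"
    have "e \<subseteq> cube d \<times> {1..m}" "card e = 2" using assms e by (auto simp: ordered_graph_def)
    then obtain x i y j where xy: "e = {(x, i), (y, j)}" "x \<in> cube d" "y \<in> cube d" "i \<in> {1..m}" "j \<in> {1..m}"
      by (auto simp: card_2_iff)
    consider "x = y" | "x < y" | "y < x" by fastforce
    then show "e \<in> inner_edges m T \<union> ?U"
    proof cases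
      case 1
      then have "e \<in> inner_edges m T" using xy e by (auto simp: inner_edges_def block_def)
      then show ?thesis ..
    next
      case 2
      then have "(x, y) \<in> cube_pairs d" "e \<in> edges_between ({}, T) (block m x) (block m y)"
        using xy e by (auto simp: cube_pairs_def edges_def block_def intro!: edges_betweenI)
      then show ?thesis by blast
    next
      case 3
      have e': "e = {(y, j), (x, i)}" using xy by auto
      have "e \<in> edges_between ({}, T) (block m y) (block m x)"
        unfolding e' by (rule edges_betweenI) (use e xy(2-) in \<open>simp_all add: e' edges_def block_def\<close>)
      moreover have "(y, x) \<in> cube_pairs d" using 3 xy by (simp add: cube_pairs_def)
      ultimately show ?thesis by blast
    qed
  qed
  then have "card T \<le> card (inner_edges m T \<union> ?U)"
    by (intro card_mono finite_UnI finite_UN_I) (auto simp: finite_cube_pairs finB inner_edges_def finT)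
  also have "\<dots> \<le> card (inner_edges m T) + card ?U" by (rule card_Un_le)
  also have "card ?U \<le> (\<Sum>(x, y)\<in>cube_pairs d. card (edges_between ({}, T) (block m x) (block m y)))"
    using card_UN_le[OF finite_cube_pairs, where A = "\<lambda>(x, y). edges_between ({}, T) (block m x) (block m y)"]
    by (simp add: case_prod_unfold)
  finally have "real (card T) \<le> real (card (inner_edges m T)) + (\<Sum>(x, y)\<in>cube_pairs d. real (card (edges_between ({}, T) (block m x) (block m y))))"
    by (simp add: case_prod_unfold flip: of_nat_sum of_nat_add)
  also have "(\<Sum>(x, y)\<in>cube_pairs d. real (card (edges_between ({}, T) (block m x) (block m y))))
    = (\<Sum>(x, y)\<in>cube_pairs d. pcount (joined T) (block m x) (block m y))"
  proof (intro sum.cong refl, clarify)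
    fix x y assume "(x, y) \<in> cube_pairs d"
    then have "x \<noteq> y" by (auto simp: cube_pairs_def)
    then show "real (card (edges_between ({}, T) (block m x) (block m y))) = pcount (joined T) (block m x) (block m y)"
      using card_edges_between[OF finite_block finite_block block_disjoint, of x y "({}, T)" m]
      by (simp add: edges_def)
  qed
  finally show ?thesis by simp
qed

lemma card_level_edges_le:
  assumes "ordered_graph G" "verts G = cube d \<times> {1..m}"
  shows "real (card (level_edges G l)) \<le> (\<Sum>(x, y)\<in>level_pairs d l. pcount (joined (edges G)) (block m x) (block m y))"
proof -
  let ?U = "\<Union>(x, y)\<in>level_pairs d l. edges_between G (block m x) (block m y)"
  have finB: "finite (edges_between G P Q)" for P Q
    by (rule finite_subset[OF _ ordered_graph_finite_edges[OF assms(1)]]) (auto simp: edges_between_def)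
  have "level_edges G l \<subseteq> ?U"
  proof
    fix e assume e: "e \<in> level_edges G l"
    then obtain x i y j where xy: "e = {(x, i), (y, j)}" "x \<noteq> y" "delta x y = l" "e \<in> edges G"
      by (auto simp: level_edges_def)
    have V: "x \<in> cube d" "y \<in> cube d" "i \<in> {1..m}" "j \<in> {1..m}"
      using assms xy by (auto simp: ordered_graph_def)
    consider "x < y" | "y < x" using xy by fastforce
    then show "e \<in> ?U"
    proof cases
      case 1
      then have "(x, y) \<in> level_pairs d l" "e \<in> edges_between G (block m x) (block m y)"
        using xy V by (auto simp: level_pairs_def cube_pairs_def block_def intro!: edges_betweenI)
      then show ?thesis by blast
    next
      case 2
      have e': "e = {(y, j), (x, i)}" using xy by auto
      have "e \<in> edges_between G (block m y) (block m x)"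
        unfolding e' by (rule edges_betweenI) (use xy(4) V in \<open>simp_all add: e' block_def\<close>)
      moreover have "(y, x) \<in> level_pairs d l"
        using 2 xy V by (simp add: level_pairs_def cube_pairs_def delta_commute)
      ultimately show ?thesis by blast
    qed
  qed
  then have "card (level_edges G l) \<le> card ?U"
    by (intro card_mono finite_UN_I) (auto simp: finite_level_pairs finB)
  also have "card ?U \<le> (\<Sum>(x, y)\<in>level_pairs d l. card (edges_between G (block m x) (block m y)))"
    using card_UN_le[OF finite_level_pairs, where A = "\<lambda>(x, y). edges_between G (block m x) (block m y)"]
    by (simp add: case_prod_unfold)
  finally have "real (card (level_edges G l)) \<le> (\<Sum>(x, y)\<in>level_pairs d l. real (card (edges_between G (block m x) (block m y))))"
    by (simp add: case_prod_unfold flip: of_nat_sum)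
  also have "\<dots> = (\<Sum>(x, y)\<in>level_pairs d l. pcount (joined (edges G)) (block m x) (block m y))"
  proof (intro sum.cong refl, clarify)
    fix x y assume "(x, y) \<in> level_pairs d l"
    then have "x \<noteq> y" by (auto simp: level_pairs_def cube_pairs_def)
    then show "real (card (edges_between G (block m x) (block m y))) = pcount (joined (edges G)) (block m x) (block m y)"
      by (intro card_edges_between finite_block block_disjoint)
  qed
  finally show ?thesis .
qed

lemma card_inner_plus_levels_le:
  assumes "ordered_graph G"
  shows "card (inner_edges m (edges G)) + (\<Sum>l\<in>L. card (level_edges G l)) \<le> card (edges G)"
proof (cases "finite L")
  case True
  have fin: "finite (edges G)" by (rule ordered_graph_finite_edges[OF assms])
  then have finl: "finite (level_edges G l)" for l by (simp add: level_edges_def)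
  have disj: "level_edges G l \<inter> level_edges G l' = {}" if "l \<noteq> l'" for l l'
    using that by (auto simp: level_edges_def doubleton_eq_iff delta_commute)
  have "inner_edges m (edges G) \<inter> (\<Union>l\<in>L. level_edges G l) = {}"
    by (auto simp: inner_edges_def level_edges_def block_def)
  then have "card (inner_edges m (edges G)) + card (\<Union>l\<in>L. level_edges G l)
    = card (inner_edges m (edges G) \<union> (\<Union>l\<in>L. level_edges G l))"
    using fin finl True by (intro card_Un_disjoint[symmetric]) (auto simp: inner_edges_def)
  also have "\<dots> \<le> card (edges G)" by (intro card_mono fin) (auto simp: inner_edges_def level_edges_def)
  finally show ?thesis using True finl disj by (subst card_UN_disjoint[symmetric]) auto
next
  case False
  then show ?thesis using ordered_graph_finite_edges[OF assms] by (auto simp: inner_edges_def intro: card_mono)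
qed

text \<open>The form in which (i) and (ii) are used later. All errors are absolute, on the scale
  \<open>m ^ 2\<close>, so the estimate makes sense for arbitrarily small subsets of the
  blocks.\<close>

definition good_host :: "nat \<Rightarrow> nat \<Rightarrow> real \<Rightarrow> (nat list \<times> nat) ograph \<Rightarrow> bool" where
  "good_host d m \<eta> G \<longleftrightarrow> ordered_graph G \<and> verts G = cube d \<times> {1..m}
    \<and> (\<forall>x\<in>cube d. \<forall>y\<in>cube d. x \<noteq> y \<longrightarrow> (\<forall>P Q. P \<subseteq> block m x \<longrightarrow> Q \<subseteq> block m y \<longrightarrow>
         \<bar>pcount (joined (edges G)) P Q - edge_prob d x y * real (card P) * real (card Q)\<bar> \<le> \<eta> * real m ^ 2))
    \<and> real (card (inner_edges m (edges G))) \<le> \<eta> * real m ^ 2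
    \<and> \<bar>real (card (edges G)) - real d * 2 ^ (d - 1) * real m ^ 2\<bar> \<le> \<eta> * real m ^ 2"

lemma powr_two_thirds_le:
  assumes "\<epsilon> > 0" "(1 / \<epsilon>) ^ 3 \<le> real m"
  shows "real m powr (2/3) \<le> \<epsilon> * real m"
proof -
  have "(1 / \<epsilon>) ^ 3 > 0" using assms by simp
  then have m: "real m > 0" using assms by linarith
  have "1 / \<epsilon> = ((1 / \<epsilon>) ^ 3) powr (1/3)"
    using assms by (simp add: powr_powr flip: powr_numeral)
  also have "\<dots> \<le> real m powr (1/3)" using assms by (intro powr_mono2) auto
  finally have "1 \<le> \<epsilon> * real m powr (1/3)" using assms by (simp add: field_simps)
  then have "real m powr (2/3) * 1 \<le> real m powr (2/3) * (\<epsilon> * real m powr (1/3))"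
    by (intro mult_left_mono) auto
  also have "\<dots> = \<epsilon> * real m"
    using m powr_add[of "real m" "2/3" "1/3"] by (simp add: algebra_simps)
  finally show ?thesis by simp
qed

text \<open>Condition (ii) bounds edge counts only from above. The lower bound comes from (i): a
  level has nearly its full number of edges while no pair can much exceed its share, so every single
  pair is nearly full. Subtracting the upper bounds for complements then passes to subsets. The
  factor \<open>4 ^ d\<close> bounds the number of pairs over which errors accumulate.\<close>

lemma good_hostI:
  assumes G: "ordered_graph G" "verts G = cube d \<times> {1..m}" and d: "d \<ge> 1" and \<epsilon>: "\<epsilon> > 0"
    and m: "real m powr (2/3) \<le> \<epsilon> * real m"
    and lev: "\<And>l. l \<in> {1..d} \<Longrightarrow> (1 - \<epsilon>) * 2 ^ (d - 1) * real m ^ 2 \<le> real (card (level_edges G l))"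
    and tot: "(1 - \<epsilon>) * real d * 2 ^ (d - 1) * real m ^ 2 \<le> real (card (edges G))"
      "real (card (edges G)) \<le> (1 + \<epsilon>) * real d * 2 ^ (d - 1) * real m ^ 2"
    and up: "\<And>x y P Q. x \<in> cube d \<Longrightarrow> y \<in> cube d \<Longrightarrow> x \<noteq> y \<Longrightarrow> P \<subseteq> block m x \<Longrightarrow> Q \<subseteq> block m y
       \<Longrightarrow> real (card P) \<ge> real m powr (2/3) \<Longrightarrow> real (card Q) \<ge> real m powr (2/3)
       \<Longrightarrow> real (card (edges_between G P Q))
             \<le> (1 + \<epsilon>) * 2 powr (real (delta x y) - real d) * real (card P) * real (card Q)"
  shows "good_host d m (4 * 4 ^ d * \<epsilon>) G"
proof -
  let ?c = "pcount (joined (edges G))"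
  define K :: real where "K = 4 ^ d"
  have K: "K \<ge> 1" "K > 0" by (auto simp: K_def)
  have m2: "0 \<le> \<epsilon> * real m ^ 2" using \<epsilon> by simp
  have cardB: "real (card P) \<le> real m" if "P \<subseteq> block m x" for P x
    using card_mono[OF finite_block that] by (simp add: card_block)
  have finB: "finite P" if "P \<subseteq> block m x" for P x using that finite_block by (rule finite_subset)
  have upper: "?c P Q \<le> edge_prob d x y * real (card P) * real (card Q) + \<epsilon> * real m ^ 2"
    if xy: "x \<in> cube d" "y \<in> cube d" "x \<noteq> y" and PQ: "P \<subseteq> block m x" "Q \<subseteq> block m y" for x y P Q
  proof (cases "real (card P) \<ge> real m powr (2/3) \<and> real (card Q) \<ge> real m powr (2/3)")
    case True
    have "?c P Q = real (card (edges_between G P Q))"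
      using card_edges_between[OF finB[OF PQ(1)] finB[OF PQ(2)], of G] block_disjoint[OF xy(3), of m] PQ by fastforce
    also have "\<dots> \<le> (1 + \<epsilon>) * edge_prob d x y * real (card P) * real (card Q)"
      unfolding edge_prob_def using True by (intro up xy PQ) auto
    also have "\<dots> = edge_prob d x y * real (card P) * real (card Q) + \<epsilon> * (edge_prob d x y * (real (card P) * real (card Q)))"
      by (simp add: algebra_simps)
    also have "edge_prob d x y * (real (card P) * real (card Q)) \<le> 1 * (real m * real m)"
      using edge_prob_bounds[OF xy] cardB[OF PQ(1)] cardB[OF PQ(2)] by (intro mult_mono) auto
    finally show ?thesis using \<epsilon> by (simp add: power2_eq_square)
  next
    case False
    \<comment> \<open>Condition (ii) is silent when a set is smaller than
      \<open>m powr (2/3)\<close>, but that set then has at most \<open>\<epsilon> * m\<close>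
      elements and the trivial bound suffices.\<close>
    have "real (card P) * real (card Q) \<le> (\<epsilon> * real m) * real m"
    proof (cases "real (card P) \<le> real m powr (2/3)")
      case True
      then show ?thesis using m cardB[OF PQ(2)] \<epsilon> by (intro mult_mono) auto
    next
      case False
      then have "real (card Q) \<le> \<epsilon> * real m" using \<open>\<not> (_ \<and> _)\<close> m by linarith
      then have "real (card P) * real (card Q) \<le> real m * (\<epsilon> * real m)"
        using cardB[OF PQ(1)] by (intro mult_mono) auto
      then show ?thesis by (simp add: mult.commute)
    qed
    moreover have "0 \<le> edge_prob d x y * real (card P) * real (card Q)"
      using edge_prob_bounds[OF xy] by simp
    ultimately show ?thesis using pcount_le[of "joined (edges G)" P Q] by (simp add: power2_eq_square)
  qed
  have full: "edge_prob d x y * real m ^ 2 - 2 * K * \<epsilon> * real m ^ 2 \<le> ?c (block m x) (block m y)"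
    if xy: "(x, y) \<in> cube_pairs d" for x y
  proof -
    define l where "l = delta x y"
    have xy': "x \<in> cube d" "y \<in> cube d" "x \<noteq> y" using xy by (auto simp: cube_pairs_def)
    have l: "l \<in> {1..d}" using delta_bounds[OF xy'] by (simp add: l_def)
    have mem: "(x, y) \<in> level_pairs d l" using xy by (simp add: level_pairs_def l_def)
    let ?A = "level_pairs d l - {(x, y)}"
    have "(1 - \<epsilon>) * 2 ^ (d - 1) * real m ^ 2 \<le> (\<Sum>(x, y)\<in>level_pairs d l. ?c (block m x) (block m y))"
      using lev[OF l] card_level_edges_le[OF G] by (rule order_trans)
    also have "\<dots> = ?c (block m x) (block m y) + (\<Sum>(x, y)\<in>?A. ?c (block m x) (block m y))"
      using sum.remove[OF finite_level_pairs mem, of "\<lambda>(x, y). ?c (block m x) (block m y)"] by simp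
    also have "(\<Sum>(x, y)\<in>?A. ?c (block m x) (block m y)) \<le> (\<Sum>(x, y)\<in>?A. edge_prob d x y * real m ^ 2 + \<epsilon> * real m ^ 2)"
    proof (rule sum_mono)
      fix z assume "z \<in> ?A"
      then show "(case z of (x, y) \<Rightarrow> ?c (block m x) (block m y)) \<le> (case z of (x, y) \<Rightarrow> edge_prob d x y * real m ^ 2 + \<epsilon> * real m ^ 2)"
        using upper[of "fst z" "snd z" "block m (fst z)" "block m (snd z)"]
          less_imp_neq[of "fst z" "snd z"]
        by (auto simp: level_pairs_def cube_pairs_def card_block power2_eq_square mult.assoc)
    qed
    also have "\<dots> = (\<Sum>(x, y)\<in>?A. edge_prob d x y) * real m ^ 2 + real (card ?A) * (\<epsilon> * real m ^ 2)"
      by (simp add: sum.distrib sum_distrib_right case_prod_unfold)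
    \<comment> \<open>The level has total weight exactly \<open>2 ^ (d - 1)\<close>, the main term
      of (i), so precisely \<open>edge_prob d x y\<close> is left for the pair itself.\<close>
    also have "(\<Sum>(x, y)\<in>?A. edge_prob d x y) = 2 ^ (d - 1) - edge_prob d x y"
      using sum.remove[OF finite_level_pairs mem, of "\<lambda>(x, y). edge_prob d x y"] sum_edge_prob_level[of l d] l by simp
    also have "real (card ?A) * (\<epsilon> * real m ^ 2) \<le> K * (\<epsilon> * real m ^ 2)"
    proof (rule mult_right_mono[OF _ m2])
      have "card ?A \<le> card (cube_pairs d)"
        by (intro card_mono finite_cube_pairs) (auto simp: level_pairs_def)
      then show "real (card ?A) \<le> K" using card_cube_pairs_le[of d] by (simp add: K_def)
    qed
    finally have "(1 - \<epsilon>) * 2 ^ (d - 1) * real m ^ 2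
      \<le> ?c (block m x) (block m y) + ((2 ^ (d - 1) - edge_prob d x y) * real m ^ 2 + K * (\<epsilon> * real m ^ 2))" by simp
    moreover have "2 ^ (d - 1) * (\<epsilon> * real m ^ 2) \<le> K * (\<epsilon> * real m ^ 2)"
    proof (rule mult_right_mono[OF _ m2])
      have "(2::real) ^ (d - 1) \<le> 2 ^ d" by (intro power_increasing) auto
      also have "\<dots> \<le> 4 ^ d" by (intro power_mono) auto
      finally show "(2::real) ^ (d - 1) \<le> K" by (simp add: K_def)
    qed
    ultimately show ?thesis by (simp add: algebra_simps)
  qed
  have full': "edge_prob d x y * real m ^ 2 - 2 * K * \<epsilon> * real m ^ 2 \<le> ?c (block m x) (block m y)"
    if "x \<in> cube d" "y \<in> cube d" "x \<noteq> y" for x y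
  proof (cases "x < y")
    case True
    then show ?thesis using that by (intro full) (simp add: cube_pairs_def)
  next
    case False
    then have "(y, x) \<in> cube_pairs d" using that by (simp add: cube_pairs_def)
    then show ?thesis
      using full[of y x] by (simp add: pcount_commute[of _ "block m x"] edge_prob_def delta_commute[of x])
  qed
  have lower: "edge_prob d x y * real (card P) * real (card Q) - (2 * K + 2) * \<epsilon> * real m ^ 2 \<le> ?c P Q"
    if xy: "x \<in> cube d" "y \<in> cube d" "x \<noteq> y" and PQ: "P \<subseteq> block m x" "Q \<subseteq> block m y" for x y P Q
  proof -
    \<comment> \<open>The block pair splits into \<open>P\<close> with \<open>Q\<close>,
      \<open>P\<close> with the complement of \<open>Q\<close>, and the complement of
      \<open>P\<close> with the whole block. Bounding the last two from above costs
      \<open>2 * \<epsilon>\<close> beyond the \<open>2 * K * \<epsilon>\<close> of the whole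
      pair.\<close>
    let ?P = "block m x - P" and ?Q = "block m y - Q" and ?e = "edge_prob d x y"
    have "P \<union> ?P = block m x" "Q \<union> ?Q = block m y" using PQ by auto
    then have "?c (block m x) (block m y) = ?c P (block m y) + ?c ?P (block m y)"
      "?c P (block m y) = ?c P Q + ?c P ?Q"
      using pcount_Un_left[of P ?P "joined (edges G)" "block m y"] pcount_Un_right[of Q ?Q "joined (edges G)" P]
        finB[OF PQ(1)] finB[OF PQ(2)] finite_block by (simp_all add: Diff_disjoint)
    moreover have "?c ?P (block m y) \<le> ?e * (real m - real (card P)) * real m + \<epsilon> * real m ^ 2"
      using upper[OF xy, of ?P "block m y"] card_Diff_subset[OF finB[OF PQ(1)] PQ(1)] card_mono[OF finite_block PQ(1)]
      by (auto simp: card_block of_nat_diff)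
    moreover have "?c P ?Q \<le> ?e * real (card P) * (real m - real (card Q)) + \<epsilon> * real m ^ 2"
      using upper[OF xy, of P ?Q] PQ card_Diff_subset[OF finB[OF PQ(2)] PQ(2)] card_mono[OF finite_block PQ(2)]
      by (auto simp: card_block of_nat_diff)
    ultimately show ?thesis
      using full'[OF xy] by (simp add: algebra_simps power2_eq_square)
  qed
  have "\<bar>?c P Q - edge_prob d x y * real (card P) * real (card Q)\<bar> \<le> 4 * 4 ^ d * \<epsilon> * real m ^ 2"
    if "x \<in> cube d" "y \<in> cube d" "x \<noteq> y" "P \<subseteq> block m x" "Q \<subseteq> block m y" for x y P Q
  proof -
    have "(2 * K + 2) * (\<epsilon> * real m ^ 2) \<le> (4 * K) * (\<epsilon> * real m ^ 2)" "1 * (\<epsilon> * real m ^ 2) \<le> (4 * K) * (\<epsilon> * real m ^ 2)"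
      using K by (intro mult_right_mono m2; simp)+
    then show ?thesis using upper[OF that] lower[OF that] by (simp add: abs_le_iff K_def algebra_simps)
  qed
  moreover have "real (card (inner_edges m (edges G))) \<le> 4 * 4 ^ d * \<epsilon> * real m ^ 2"
    and "\<bar>real (card (edges G)) - real d * 2 ^ (d - 1) * real m ^ 2\<bar> \<le> 4 * 4 ^ d * \<epsilon> * real m ^ 2"
  proof -
    define N :: real where "N = real d * 2 ^ (d - 1)"
    have "N \<le> 2 ^ d * 2 ^ d" unfolding N_def
      by (intro mult_mono) (auto intro: less_imp_le of_nat_less_two_power power_increasing)
    also have "\<dots> = K" by (simp add: K_def flip: power_mult_distrib)
    finally have N: "N * (\<epsilon> * real m ^ 2) \<le> K * (\<epsilon> * real m ^ 2)" by (intro mult_right_mono m2)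
    have "(\<Sum>l\<in>{1..d}. (1 - \<epsilon>) * 2 ^ (d - 1) * real m ^ 2) \<le> (\<Sum>l\<in>{1..d}. real (card (level_edges G l)))"
      by (intro sum_mono lev)
    then have "(1 - \<epsilon>) * N * real m ^ 2 \<le> (\<Sum>l\<in>{1..d}. real (card (level_edges G l)))"
      by (simp add: N_def algebra_simps)
    moreover have "real (card (inner_edges m (edges G))) + (\<Sum>l\<in>{1..d}. real (card (level_edges G l))) \<le> real (card (edges G))"
      using card_inner_plus_levels_le[OF G(1), of m "{1..d}"] by (simp flip: of_nat_sum of_nat_add)
    moreover have "real (card (edges G)) \<le> (1 + \<epsilon>) * N * real m ^ 2" using tot(2) by (simp add: N_def mult.assoc)
    \<comment> \<open>The upper bound on the total exceeds the sum of the lower bounds on the levels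
      by \<open>2 * N * \<epsilon> * m ^ 2\<close>, and all inner edges must fit into this
      gap.\<close>
    ultimately have "real (card (inner_edges m (edges G))) \<le> 2 * (N * (\<epsilon> * real m ^ 2))"
      by (simp add: algebra_simps)
    moreover have "0 \<le> K * (\<epsilon> * real m ^ 2)" using K m2 by simp
    ultimately show "real (card (inner_edges m (edges G))) \<le> 4 * 4 ^ d * \<epsilon> * real m ^ 2"
      using N by (simp add: K_def)
    have "\<bar>real (card (edges G)) - N * real m ^ 2\<bar> \<le> N * (\<epsilon> * real m ^ 2)"
      using tot by (simp add: N_def abs_le_iff algebra_simps)
    then show "\<bar>real (card (edges G)) - real d * 2 ^ (d - 1) * real m ^ 2\<bar> \<le> 4 * 4 ^ d * \<epsilon> * real m ^ 2"
      using N \<open>0 \<le> K * (\<epsilon> * real m ^ 2)\<close> by (simp add: K_def N_def)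
  qed
  ultimately show ?thesis using G by (simp add: good_host_def)
qed

section \<open>The limit over the block size\<close>

lemma sum_shift_le:
  fixes f :: "nat \<Rightarrow> nat \<Rightarrow> real"
  assumes "\<And>i a. 0 \<le> f i a"
  shows "(\<Sum>k\<in>{s..m}. \<Sum>a<s. f (k - a) a) \<le> (\<Sum>i\<in>{1..m}. \<Sum>a<s. f i a)"
proof -
  have "(\<Sum>k\<in>{s..m}. f (k - a) a) \<le> (\<Sum>i\<in>{1..m}. f i a)" if "a < s" for a
  proof -
    have "inj_on (\<lambda>k. k - a) {s..m}" using that by (auto simp: inj_on_def)
    then have "(\<Sum>k\<in>{s..m}. f (k - a) a) = (\<Sum>i\<in>(\<lambda>k. k - a) ` {s..m}. f i a)"
      by (simp add: sum.reindex)
    also have "\<dots> \<le> (\<Sum>i\<in>{1..m}. f i a)"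
      using that assms by (intro sum_mono2) auto
    finally show ?thesis .
  qed
  then have "(\<Sum>a<s. \<Sum>k\<in>{s..m}. f (k - a) a) \<le> (\<Sum>a<s. \<Sum>i\<in>{1..m}. f i a)"
    by (intro sum_mono) auto
  then show ?thesis by (subst (1 2) sum.swap)
qed

text \<open>A target \<open>(k, l)\<close> is hit whenever \<open>i + a = k\<close> and
  \<open>j + b = l\<close>, and so collects the sum of \<open>A\<close> over an \<open>s\<close> by
  \<open>s\<close> window. For \<open>k\<close> and \<open>l\<close> between \<open>s\<close> and
  \<open>m\<close> the window lies inside \<open>{1..m}\<close>; all other targets are dropped,
  which nonnegativity permits.\<close>

lemma shift_sum_lower:
  fixes A g :: "nat \<Rightarrow> nat \<Rightarrow> real"
  assumes A: "\<And>i j. 0 \<le> A i j" and g: "\<And>k l. 0 \<le> g k l"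
    and low: "\<And>k l. k \<in> {s..m} \<Longrightarrow> l \<in> {s..m} \<Longrightarrow> B \<le> (\<Sum>a<s. \<Sum>b<s. A (k - a) (l - b))"
  shows "B * (\<Sum>k\<in>{s..m}. \<Sum>l\<in>{s..m}. g k l)
    \<le> (\<Sum>i\<in>{1..m}. \<Sum>j\<in>{1..m}. A i j * (\<Sum>a<s. \<Sum>b<s. g (i + a) (j + b)))"
proof -
  have "B * (\<Sum>k\<in>{s..m}. \<Sum>l\<in>{s..m}. g k l)
    \<le> (\<Sum>k\<in>{s..m}. \<Sum>l\<in>{s..m}. (\<Sum>a<s. \<Sum>b<s. A (k - a) (l - b)) * g k l)"
    unfolding sum_distrib_left by (intro sum_mono mult_right_mono low g)
  also have "\<dots> = (\<Sum>k\<in>{s..m}. \<Sum>l\<in>{s..m}. \<Sum>a<s. \<Sum>b<s. A (k - a) (l - b) * g k l)"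
    by (simp add: sum_distrib_right)
  also have "\<dots> = (\<Sum>k\<in>{s..m}. \<Sum>a<s. \<Sum>l\<in>{s..m}. \<Sum>b<s. A (k - a) (l - b) * g k l)"
    by (intro sum.cong refl sum.swap)
  also have "\<dots> = (\<Sum>k\<in>{s..m}. \<Sum>a<s. \<Sum>l\<in>{s..m}. \<Sum>b<s. A (k - a) (l - b) * g (k - a + a) (l - b + b))"
    by (intro sum.cong refl) auto
  also have "\<dots> \<le> (\<Sum>k\<in>{s..m}. \<Sum>a<s. \<Sum>j\<in>{1..m}. \<Sum>b<s. A (k - a) j * g (k - a + a) (j + b))"
    by (intro sum_mono sum_shift_le mult_nonneg_nonneg A g)
  also have "\<dots> \<le> (\<Sum>i\<in>{1..m}. \<Sum>a<s. \<Sum>j\<in>{1..m}. \<Sum>b<s. A i j * g (i + a) (j + b))"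
    by (rule sum_shift_le) (intro sum_nonneg mult_nonneg_nonneg A g)
  also have "\<dots> = (\<Sum>i\<in>{1..m}. \<Sum>j\<in>{1..m}. \<Sum>a<s. \<Sum>b<s. A i j * g (i + a) (j + b))"
    by (intro sum.cong refl sum.swap)
  finally show ?thesis by (simp add: sum_distrib_left)
qed

lemma good_host_regular:
  assumes "good_host d m \<eta> G" "x \<in> cube d" "y \<in> cube d" "x \<noteq> y" "P \<subseteq> block m x" "Q \<subseteq> block m y"
  shows "\<bar>pcount (joined (edges G)) P Q - edge_prob d x y * real (card P) * real (card Q)\<bar> \<le> \<eta> * real m ^ 2"
  using assms by (simp add: good_host_def)

text \<open>Half-open, so that consecutive cells tile a block, whose vertices start at 1. Cells of
  index at most \<open>m + s - 1\<close> fit into a block of size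
  \<open>(m + s) * q\<close>.\<close>

definition cell :: "nat \<Rightarrow> nat list \<Rightarrow> nat \<Rightarrow> (nat list \<times> nat) set" where
  "cell q x k = {x} \<times> {k * q<..Suc k * q}"

lemma finite_cell: "finite (cell q x k)" and card_cell: "card (cell q x k) = q"
  by (simp_all add: cell_def card_cartesian_product)

lemma cell_nonempty: "q > 0 \<Longrightarrow> cell q x k \<noteq> {}"
  using card_cell[of q x k] by (metis card.empty less_irrefl)

lemma cell_subset_block: "Suc k * q \<le> m \<Longrightarrow> cell q x k \<subseteq> block m x"
  by (auto simp: cell_def block_def)

lemma sum_cells:
  assumes "s \<le> Suc m"
  shows "(\<Sum>k\<in>{s..m}. \<Sum>a\<in>cell q x k. f a) = (\<Sum>a\<in>{x} \<times> {s * q<..Suc m * q}. f a)"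
  using assms
proof (induction m)
  case 0
  then show ?case by (cases s) (auto simp: cell_def)
next
  case (Suc m)
  show ?case
  proof (cases "s = Suc (Suc m)")
    case False
    then have s: "s \<le> Suc m" using Suc.prems by simp
    have "{x} \<times> {s * q<..Suc (Suc m) * q} = ({x} \<times> {s * q<..Suc m * q}) \<union> cell q x (Suc m)"
      using s mult_le_mono1[OF s, of q] unfolding cell_def by auto
    moreover have "({x} \<times> {s * q<..Suc m * q}) \<inter> cell q x (Suc m) = {}"
      by (auto simp: cell_def)
    ultimately have "(\<Sum>a\<in>{x} \<times> {s * q<..Suc (Suc m) * q}. f a)
      = (\<Sum>a\<in>{x} \<times> {s * q<..Suc m * q}. f a) + (\<Sum>a\<in>cell q x (Suc m). f a)"
      by (simp add: sum.union_disjoint finite_cell)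
    then show ?thesis using Suc.IH[OF s] s by simp
  qed simp
qed

lemma pcount_cells:
  assumes "s \<le> Suc m"
  shows "(\<Sum>k\<in>{s..m}. \<Sum>l\<in>{s..m}. pcount h (cell q x k) (cell q y l))
    = pcount h ({x} \<times> {s * q<..Suc m * q}) ({y} \<times> {s * q<..Suc m * q})"
proof -
  have "(\<Sum>k\<in>{s..m}. \<Sum>l\<in>{s..m}. pcount h (cell q x k) (cell q y l))
    = (\<Sum>k\<in>{s..m}. \<Sum>a\<in>cell q x k. \<Sum>l\<in>{s..m}. \<Sum>b\<in>cell q y l. of_bool (h a b))"
    unfolding pcount_def by (intro sum.cong refl sum.swap)
  then show ?thesis by (simp only: sum_cells[OF assms] pcount_def)
qed

lemma pcount_block_le:
  assumes "P \<subseteq> block m x" "Q \<subseteq> block m y" "card P = c" "card Q = c"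
  shows "pcount h (block m x) (block m y) \<le> pcount h P Q + 2 * real m * (real m - real c)"
proof -
  let ?P = "block m x - P" and ?Q = "block m y - Q"
  have fin: "finite P" "finite Q" using assms finite_block finite_subset by blast+
  have U: "P \<union> ?P = block m x" "Q \<union> ?Q = block m y" using assms by auto
  have "pcount h (block m x) (block m y) = pcount h P (block m y) + pcount h ?P (block m y)"
    "pcount h P (block m y) = pcount h P Q + pcount h P ?Q"
    using pcount_Un_left[of P ?P h "block m y"] pcount_Un_right[of Q ?Q h P] fin finite_block U
    by (simp_all add: Diff_disjoint)
  moreover have cm: "c \<le> m" "card ?P = m - c" "card ?Q = m - c"
    using assms card_mono[OF finite_block assms(1)] by (auto simp: card_block card_Diff_subset fin)
  have "pcount h ?P (block m y) \<le> (real m - real c) * real m"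
    using pcount_le[of h ?P "block m y"] cm by (simp add: card_block of_nat_diff)
  moreover have "pcount h P ?Q \<le> real c * (real m - real c)"
    using pcount_le[of h P ?Q] cm assms by (simp add: of_nat_diff)
  moreover have "real c * (real m - real c) \<le> real m * (real m - real c)"
    using cm by (intro mult_right_mono) auto
  ultimately show ?thesis by (simp add: algebra_simps)
qed

lemma sum_outer_edge_pairs:
  assumes G: "ordered_graph G" "verts G = cube d \<times> {1..m}"
  shows "(\<Sum>e\<in>edge_pairs (edges G - inner_edges m (edges G)). f (fst e) (snd e))
    = (\<Sum>(x, y)\<in>cube_pairs d. \<Sum>i\<in>{1..m}. \<Sum>j\<in>{1..m}. of_bool ({(x, i), (y, j)} \<in> edges G) * (f (x, i) (y, j) :: real))"
proof -
  let ?A = "cube_pairs d \<times> {1..m} \<times> {1..m}"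
  let ?Z = "{z \<in> ?A. {(fst (fst z), fst (snd z)), (snd (fst z), snd (snd z))} \<in> edges G}"
  let ?h = "\<lambda>z. ((fst (fst z), fst (snd z)), (snd (fst z), snd (snd z)))"
  let ?E = "edge_pairs (edges G - inner_edges m (edges G))"
  have "bij_betw ?h ?Z ?E"
  proof (rule bij_betwI')
    show "(?h z = ?h w) = (z = w)" for z w :: "(nat list \<times> nat list) \<times> nat \<times> nat"
      by (cases z; cases w) auto
    show "?h z \<in> ?E" if "z \<in> ?Z" for z
      using that by (auto simp: edge_pairs_def inner_edges_def cube_pairs_def block_def)
    show "\<exists>z\<in>?Z. e = ?h z" if "e \<in> ?E" for e
    proof -
      obtain x i y j where e: "e = ((x, i), (y, j))" by (metis surj_pair)
      have *: "(x, i) < (y, j)" "{(x, i), (y, j)} \<in> edges G" "{(x, i), (y, j)} \<notin> inner_edges m (edges G)"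
        using that by (auto simp: edge_pairs_def e)
      have V: "x \<in> cube d" "y \<in> cube d" "i \<in> {1..m}" "j \<in> {1..m}"
        using *(2) G by (auto simp: ordered_graph_def)
      have "x \<noteq> y" using *(2,3) V by (auto simp: inner_edges_def block_def)
      then have "x < y" using *(1) by auto
      then have "((x, y), (i, j)) \<in> ?Z" using V * by (simp add: cube_pairs_def)
      then show ?thesis using e by force
    qed
  qed
  then have "(\<Sum>e\<in>?E. f (fst e) (snd e)) = (\<Sum>z\<in>?Z. f (fst (?h z)) (snd (?h z)))"
    by (rule sum.reindex_bij_betw[symmetric])
  also have "\<dots> = (\<Sum>z\<in>?A. of_bool ({(fst (fst z), fst (snd z)), (snd (fst z), snd (snd z))} \<in> edges G)
      * f (fst (fst z), fst (snd z)) (snd (fst z), snd (snd z)))"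
    by (rule sum.mono_neutral_cong_left) (auto simp: finite_cube_pairs)
  also have "\<dots> = (\<Sum>(x, y)\<in>cube_pairs d. \<Sum>i\<in>{1..m}. \<Sum>j\<in>{1..m}. of_bool ({(x, i), (y, j)} \<in> edges G) * f (x, i) (y, j))"
    by (simp only: sum.cartesian_product case_prod_unfold fst_conv snd_conv)
  finally show ?thesis .
qed

text \<open>An \<open>F\<close>-free subgraph of the smaller graph is one of the larger. Edge
  numbers are compared because the ratios need not be monotone. This allows edges inside blocks to
  be deleted before placing.\<close>

lemma rho_mult_subgraph_mono:
  assumes "ordered_graph G" "verts F \<noteq> {}" "E' \<subseteq> edges G"
  shows "rho F (verts G, E') * real (card E') \<le> rho F G * real (card (edges G))"
proof (cases "E' = {}")
  case True
  then show ?thesis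
    using rho_bounds(1)[OF ordered_graph_finite_edges[OF assms(1)] assms(2)] by simp
next
  case False
  have fin: "finite (edges G)" using ordered_graph_finite_edges assms by blast
  then have finE: "finite E'" using assms finite_subset by blast
  have finE': "finite (edges (verts G, E'))" using finE by (simp add: edges_def)
  obtain H where H: "subgraph H (verts G, E')" "\<not> contains H F"
    "rho F (verts G, E') = real (card (edges H)) / real (card (edges (verts G, E')))"
    using rho_attained[OF finE' assms(2)] .
  have "subgraph H G" using H(1) assms(3) by (auto simp: subgraph_def verts_def edges_def)
  then have "real (card (edges H)) \<le> rho F G * real (card (edges G))"
    using H fin by (intro card_edges_le_rho)
  then show ?thesis using H(3) False finE by (simp add: edges_def)
qed

text \<open>All vertices of a block share one shift, which keeps their order; different blocks have
  independent shifts, which spread an edge over an \<open>s\<close> by \<open>s\<close> array of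
  cell pairs. Averaging \<open>placement_bound\<close> over the shifts bounds the middle cells; the
  other two terms pay for edges inside blocks and for vertices outside the middle cells.
  \<open>\<theta>\<close> bounds the relative error of \<open>G\<close> on windows of length
  \<open>s\<close>, where the density is at least \<open>1 / 2 ^ d\<close>.\<close>

lemma rho_host_le_rho_smaller:
  fixes F :: "'c::linorder ograph"
  assumes F: "verts F \<noteq> {}"
    and G: "good_host d m \<zeta> G" and G': "good_host d m' \<eta> G'"
    and s: "1 \<le> s" "s \<le> m" and q: "q = m' div (m + s)" "q \<ge> 1" and "0 \<le> \<eta>"
    and \<eta>: "2 * real (card (edges G)) ^ 2 * (\<eta> * real m' ^ 2 / real q ^ 2) \<le> (1 / 2 ^ d) ^ card (edges G)"
    and \<zeta>: "\<zeta> * 2 ^ d * real m ^ 2 / real s ^ 2 \<le> \<theta>" "\<theta> < 1"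
  shows "rho F G' * real (card (edges G')) \<le> \<eta> * real m' ^ 2
    + (rho F G * real (card (edges G)) + 1) / (1 - \<theta>) * real q ^ 2
    + 2 * 4 ^ d * real m' * (real m' - real (Suc m - s) * real q)"
proof -
  have Gg: "ordered_graph G" "verts G = cube d \<times> {1..m}" using G by (auto simp: good_host_def)
  have G'g: "ordered_graph G'" "verts G' = cube d \<times> {1..m'}" using G' by (auto simp: good_host_def)
  have finG: "finite (edges G)" "finite (edges G')" using Gg G'g by (simp_all add: ordered_graph_finite_edges)
  \<comment> \<open>Vertices of one block of \<open>G\<close> go to one block of \<open>G'\<close>,
    inside which no regularity is known; hence edges within blocks are removed from
    \<open>G\<close>.\<close>
  define E0 where "E0 = edges G - inner_edges m (edges G)"
  define G0 where "G0 = (verts G, E0)"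
  have G0: "ordered_graph G0" "edges G0 = E0" "verts G0 = cube d \<times> {1..m}"
    using Gg by (auto simp: ordered_graph_def G0_def E0_def verts_def edges_def)
  \<comment> \<open>The 1 is the error term of \<open>placement_bound\<close>, negligible against an
    edge number of order \<open>m ^ 2\<close>.\<close>
  define rhs where "rhs = rho F G * real (card (edges G)) + 1"
  have qpos: "real q > 0" using q by simp
  have Kq: "(m + s) * q \<le> m'" using q(1) by simp
  obtain H where H: "subgraph H G'" "\<not> contains H F"
    "rho F G' = real (card (edges H)) / real (card (edges G'))"
    using rho_attained[OF finG(2) F] .
  define g where "g x k y l = pcount (joined (edges H)) (cell q x k) (cell q y l) / real q ^ 2" for x k y l
  have g0: "0 \<le> g x k y l" for x k y l by (simp add: g_def pcount_nonneg)
  define C where "C = PiE (cube d) (\<lambda>_. {..<s})"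
  have finC: "finite C" "C \<noteq> {}"
    unfolding C_def using finite_PiE_nonempty[of "cube d" "\<lambda>_. {..<s}"] finite_cube s by (auto simp: lessThan_empty_iff)
  let ?f = "\<lambda>c u v. g (fst u) (snd u + c (fst u)) (fst v) (snd v + c (fst v)) / edge_prob d (fst u) (fst v)"

  have place: "(\<Sum>e\<in>edge_pairs E0. ?f c (fst e) (snd e)) \<le> rhs" if c: "c \<in> C" for c
  proof -
    define S where "S u = cell q (fst u) (snd u + c (fst u))" for u :: "nat list \<times> nat"
    have Sb: "S u \<subseteq> block m' (fst u)" if "u \<in> verts G0" for u
    proof -
      have "c (fst u) < s" "snd u \<le> m" using that c by (auto simp: C_def PiE_iff G0)
      then have "Suc (snd u + c (fst u)) * q \<le> (m + s) * q" by (intro mult_le_mono1) simp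
      then show ?thesis unfolding S_def using Kq by (intro cell_subset_block) linarith
    qed
    have "(\<Sum>e\<in>edge_pairs (edges G0). pcount (joined (edges H)) (S (fst e)) (S (snd e))
      / (edge_prob d (fst (fst e)) (fst (snd e)) * (real (card (S (fst e))) * real (card (S (snd e)))))) \<le> rho F G0 * real (card (edges G0)) + 1"
    \<comment> \<open>Cells inherit regularity from blocks, but the same absolute error now has to
      be measured against \<open>q ^ 2\<close>.\<close>
    proof (rule placement_bound[where T = "edges G'" and p = "\<lambda>e. edge_prob d (fst (fst e)) (fst (snd e))" and r = "1 / 2 ^ d" and \<eta> = "\<eta> * real m' ^ 2 / real q ^ 2"])
      show "ordered_graph G0" "verts F \<noteq> {}" by fact+
      show "\<And>e. e \<in> edges H \<Longrightarrow> e \<subseteq> verts H" "\<not> contains H F" "edges H \<subseteq> edges G'"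
        using H by (auto simp: subgraph_def)
      show "finite (S v) \<and> S v \<noteq> {}" for v using q by (auto simp: S_def finite_cell cell_nonempty)
      show "a < b" if "u \<in> verts G0" "v \<in> verts G0" "u < v" "a \<in> S u" "b \<in> S v" for u v a b
      proof (cases "fst u < fst v")
        case True
        then show ?thesis using that by (auto simp: S_def cell_def less_prod_def)
      next
        case False
        then have uv: "fst u = fst v" "snd u < snd v" using that(3) by (auto simp: less_prod_def)
        have "snd a \<le> Suc (snd u + c (fst u)) * q" using that by (auto simp: S_def cell_def)
        also have "\<dots> \<le> (snd v + c (fst v)) * q" using uv by (intro mult_le_mono1) simp
        also have "\<dots> < snd b" using that by (auto simp: S_def cell_def)
        finally show ?thesis using that uv by (auto simp: S_def cell_def less_prod_def)
      qed
      show "(0::real) < 1 / 2 ^ d" by simp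
      show "0 \<le> \<eta> * real m' ^ 2 / real q ^ 2" using \<open>0 \<le> \<eta>\<close> by simp
      have c0: "card (edges G0) \<le> card (edges G)" unfolding G0(2) by (intro card_mono finG) (auto simp: E0_def)
      have "2 * real (card (edges G0)) ^ 2 * (\<eta> * real m' ^ 2 / real q ^ 2) \<le> 2 * real (card (edges G)) ^ 2 * (\<eta> * real m' ^ 2 / real q ^ 2)"
        using c0 \<open>0 \<le> \<eta>\<close> by (intro mult_right_mono mult_left_mono power_mono) auto
      also have "\<dots> \<le> (1 / 2 ^ d) ^ card (edges G)" by (rule \<eta>)
      also have "\<dots> \<le> (1 / 2 ^ d) ^ card (edges G0)" using c0 by (intro power_decreasing) auto
      finally show "2 * real (card (edges G0)) ^ 2 * (\<eta> * real m' ^ 2 / real q ^ 2) \<le> 1 * (1 / 2 ^ d) ^ card (edges G0)" by simp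
      fix e assume e: "e \<in> edge_pairs (edges G0)"
      obtain x i y j where xy: "e = ((x, i), (y, j))" by (metis surj_pair)
      have *: "{(x, i), (y, j)} \<in> edges G" "{(x, i), (y, j)} \<notin> inner_edges m (edges G)"
        using e by (auto simp: edge_pairs_def xy G0 E0_def)
      have V: "x \<in> cube d" "y \<in> cube d" "i \<in> {1..m}" "j \<in> {1..m}"
        using *(1) Gg by (auto simp: ordered_graph_def)
      have neq: "x \<noteq> y" using * V by (auto simp: inner_edges_def block_def)
      have "regular_pair (joined (edges G')) (edge_prob d x y) (\<eta> * real m' ^ 2 / real q ^ 2) (S (x, i)) (S (y, j))"
        unfolding regular_pair_def
      proof (intro allI impI)
        fix P Q assume PQ: "P \<subseteq> S (x, i)" "Q \<subseteq> S (y, j)"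
        have "S (x, i) \<subseteq> block m' x" "S (y, j) \<subseteq> block m' y"
          using Sb[of "(x, i)"] Sb[of "(y, j)"] V by (auto simp: G0)
        then have "P \<subseteq> block m' x" "Q \<subseteq> block m' y" using PQ by auto
        then have "\<bar>pcount (joined (edges G')) P Q - edge_prob d x y * real (card P) * real (card Q)\<bar> \<le> \<eta> * real m' ^ 2"
          by (intro good_host_regular[OF G' V(1,2) neq])
        then show "\<bar>pcount (joined (edges G')) P Q - edge_prob d x y * real (card P) * real (card Q)\<bar>
          \<le> \<eta> * real m' ^ 2 / real q ^ 2 * real (card (S (x, i))) * real (card (S (y, j)))"
          using qpos by (simp add: S_def card_cell power2_eq_square)
      qed
      then show "1 / 2 ^ d \<le> edge_prob d (fst (fst e)) (fst (snd e)) \<and> edge_prob d (fst (fst e)) (fst (snd e)) \<le> 1 \<and>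
        regular_pair (joined (edges G')) (edge_prob d (fst (fst e)) (fst (snd e))) (\<eta> * real m' ^ 2 / real q ^ 2) (S (fst e)) (S (snd e))"
        using edge_prob_bounds[OF V(1,2) neq] by (simp add: xy)
    qed
    also have "rho F G0 * real (card (edges G0)) + 1 \<le> rhs"
      using rho_mult_subgraph_mono[OF Gg(1) F, of E0] by (simp add: rhs_def G0_def edges_def E0_def)
    finally show ?thesis
      by (simp add: G0(2) S_def card_cell g_def power2_eq_square mult.commute mult.left_commute)
  qed

  \<comment> \<open>The union of the cells \<open>s\<close> to \<open>m\<close>, which are exactly
    those that every shift below \<open>s\<close> reaches from some vertex index in
    \<open>{1..m}\<close>.\<close>
  define U where "U x = {x} \<times> {s * q<..Suc m * q}" for x :: "nat list"
  have Ub: "U x \<subseteq> block m' x" for x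
  proof -
    have "Suc m * q \<le> (m + s) * q" using s by (intro mult_le_mono1) simp
    then show ?thesis using Kq by (auto simp: U_def block_def)
  qed
  have cardU: "card (U x) = (Suc m - s) * q" for x
    by (simp add: U_def card_cartesian_product diff_mult_distrib)

  have pair: "(1 - \<theta>) * (pcount (joined (edges H)) (U x) (U y) / real q ^ 2)
    \<le> (\<Sum>i\<in>{1..m}. \<Sum>j\<in>{1..m}. of_bool ({(x, i), (y, j)} \<in> edges G) * avg C (\<lambda>c. ?f c (x, i) (y, j)))"
    if xy: "(x, y) \<in> cube_pairs d" for x y
  proof -
    have V: "x \<in> cube d" "y \<in> cube d" "x \<noteq> y" using xy by (auto simp: cube_pairs_def)
    let ?p = "edge_prob d x y"
    let ?A = "\<lambda>i j. of_bool ({(x, i), (y, j)} \<in> edges G) :: real"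
    note pb = edge_prob_bounds[OF V]
    have sp: "real s > 0" using s by simp
    have avgC: "avg C (\<lambda>c. ?f c (x, i) (y, j)) = (\<Sum>a<s. \<Sum>b<s. g x (i + a) y (j + b)) / (?p * real s ^ 2)" for i j
    proof -
      have "avg C (\<lambda>c. ?f c (x, i) (y, j)) = avg {..<s} (\<lambda>a. avg {..<s} (\<lambda>b. g x (i + a) y (j + b) / ?p))"
        unfolding C_def using avg_PiE_pair[of "cube d" "\<lambda>_. {..<s}" x y "\<lambda>a b. g x (i + a) y (j + b) / ?p"]
          finite_cube V s by (simp add: lessThan_empty_iff)
      then show ?thesis by (simp add: avg_avg power2_eq_square flip: sum_divide_distrib)
    qed
    have "(?p * real s ^ 2 * (1 - \<theta>)) * (\<Sum>k\<in>{s..m}. \<Sum>l\<in>{s..m}. g x k y l)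
      \<le> (\<Sum>i\<in>{1..m}. \<Sum>j\<in>{1..m}. ?A i j * (\<Sum>a<s. \<Sum>b<s. g x (i + a) y (j + b)))"
    proof (rule shift_sum_lower)
      fix k l assume kl: "k \<in> {s..m}" "l \<in> {s..m}"
      \<comment> \<open>The window of vertices of \<open>G\<close> that some shift below
        \<open>s\<close> carries to cell \<open>k\<close>; regularity of \<open>G\<close> is applied
        to two such windows.\<close>
      let ?W = "\<lambda>x k. (\<lambda>a. (x, k - a)) ` {..<s}"
      have inj: "inj_on (\<lambda>a. (z :: nat list, n - a)) {..<s}" if "n \<in> {s..m}" for z n
        using that by (auto simp: inj_on_def)
      have Wb: "?W z n \<subseteq> block m z" if "n \<in> {s..m}" for z n using that by (auto simp: block_def)
      have "\<bar>pcount (joined (edges G)) (?W x k) (?W y l) - ?p * real (card (?W x k)) * real (card (?W y l))\<bar> \<le> \<zeta> * real m ^ 2"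
        by (intro good_host_regular[OF G V] Wb kl)
      then have "?p * real s ^ 2 - \<zeta> * real m ^ 2 \<le> pcount (joined (edges G)) (?W x k) (?W y l)"
        using inj kl by (simp add: card_image power2_eq_square abs_le_iff)
      also have "\<dots> = (\<Sum>a<s. \<Sum>b<s. ?A (k - a) (l - b))"
        unfolding pcount_def using inj kl by (simp only: sum.reindex comp_def)
      finally have "?p * real s ^ 2 - \<zeta> * real m ^ 2 \<le> (\<Sum>a<s. \<Sum>b<s. ?A (k - a) (l - b))" .
      moreover have "\<zeta> * real m ^ 2 \<le> ?p * real s ^ 2 * \<theta>"
      proof -
        have "\<zeta> * real m ^ 2 \<le> (1 / 2 ^ d) * (real s ^ 2 * \<theta>)" using \<zeta>(1) sp by (simp add: field_simps)
        also have "\<dots> \<le> ?p * (real s ^ 2 * \<theta>)"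
        proof (rule mult_right_mono[OF pb(1)])
          \<comment> \<open>Nonnegativity of \<open>\<theta>\<close> is extracted from the
            regularity of \<open>G\<close> on empty sets, which forces
            \<open>\<zeta> * m ^ 2\<close> to be nonnegative.\<close>
          have "0 \<le> \<bar>pcount (joined (edges G)) {} {} - ?p * real (card ({} :: (nat list \<times> nat) set)) * real (card ({} :: (nat list \<times> nat) set))\<bar>" by simp
          also have "\<dots> \<le> \<zeta> * real m ^ 2" by (intro good_host_regular[OF G V]) auto
          finally have "0 \<le> \<zeta> * real m ^ 2 * (2 ^ d / real s ^ 2)" by simp
          then have "0 \<le> \<theta>" using \<zeta>(1) by (simp add: field_simps)
          then show "0 \<le> real s ^ 2 * \<theta>" by simp
        qed
        finally show ?thesis by (simp add: mult.assoc)
      qed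
      ultimately show "?p * real s ^ 2 * (1 - \<theta>) \<le> (\<Sum>a<s. \<Sum>b<s. ?A (k - a) (l - b))"
        by (simp add: algebra_simps)
    qed (auto simp: g0)
    then have "(1 - \<theta>) * (\<Sum>k\<in>{s..m}. \<Sum>l\<in>{s..m}. g x k y l)
      \<le> (\<Sum>i\<in>{1..m}. \<Sum>j\<in>{1..m}. ?A i j * (\<Sum>a<s. \<Sum>b<s. g x (i + a) y (j + b))) / (?p * real s ^ 2)"
      using pb sp by (simp add: pos_le_divide_eq mult_ac)
    moreover have "(\<Sum>k\<in>{s..m}. \<Sum>l\<in>{s..m}. g x k y l) = pcount (joined (edges H)) (U x) (U y) / real q ^ 2"
      using pcount_cells[of s m "joined (edges H)" q x y] s by (simp add: g_def U_def flip: sum_divide_distrib)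
    ultimately show ?thesis by (simp only: avgC times_divide_eq_right sum_divide_distrib[symmetric])
  qed

  have "(1 - \<theta>) * ((\<Sum>(x, y)\<in>cube_pairs d. pcount (joined (edges H)) (U x) (U y)) / real q ^ 2)
    = (\<Sum>(x, y)\<in>cube_pairs d. (1 - \<theta>) * (pcount (joined (edges H)) (U x) (U y) / real q ^ 2))"
    by (simp add: sum_distrib_left sum_divide_distrib case_prod_unfold)
  also have "\<dots> \<le> (\<Sum>(x, y)\<in>cube_pairs d. \<Sum>i\<in>{1..m}. \<Sum>j\<in>{1..m}. of_bool ({(x, i), (y, j)} \<in> edges G) * avg C (\<lambda>c. ?f c (x, i) (y, j)))"
    by (intro sum_mono) (use pair in auto)
  also have "\<dots> = (\<Sum>e\<in>edge_pairs E0. avg C (\<lambda>c. ?f c (fst e) (snd e)))"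
    unfolding E0_def by (rule sum_outer_edge_pairs[OF Gg, symmetric])
  also have "\<dots> = avg C (\<lambda>c. \<Sum>e\<in>edge_pairs E0. ?f c (fst e) (snd e))"
    by (rule avg_sum[symmetric])
  also have "\<dots> \<le> avg C (\<lambda>c. rhs)" by (intro avg_mono place)
  also have "\<dots> = rhs" by (rule avg_const[OF finC])
  finally have sumU: "(\<Sum>(x, y)\<in>cube_pairs d. pcount (joined (edges H)) (U x) (U y)) \<le> rhs / (1 - \<theta>) * real q ^ 2"
    using \<zeta>(2) qpos by (simp add: field_simps)

  let ?loss = "2 * real m' * (real m' - real ((Suc m - s) * q))"
  have loss: "0 \<le> ?loss"
    using card_mono[OF finite_block Ub, of "[]"] by (simp add: cardU card_block flip: of_nat_mult)
  have sub: "edges H \<subseteq> edges G'" using H by (simp add: subgraph_def)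
  have "real (card (edges H)) \<le> real (card (inner_edges m' (edges H)))
    + (\<Sum>(x, y)\<in>cube_pairs d. pcount (joined (edges H)) (block m' x) (block m' y))"
    using card_le_inner_plus_pairs[OF G'g sub] .
  also have "real (card (inner_edges m' (edges H))) \<le> \<eta> * real m' ^ 2"
  proof -
    have "card (inner_edges m' (edges H)) \<le> card (inner_edges m' (edges G'))"
      using sub finG by (intro card_mono) (auto simp: inner_edges_def)
    then show ?thesis using G' by (simp add: good_host_def)
  qed
  also have "(\<Sum>(x, y)\<in>cube_pairs d. pcount (joined (edges H)) (block m' x) (block m' y))
    \<le> (\<Sum>(x, y)\<in>cube_pairs d. pcount (joined (edges H)) (U x) (U y) + ?loss)"
    using pcount_block_le[OF Ub Ub cardU cardU] by (intro sum_mono) auto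
  also have "\<dots> = (\<Sum>(x, y)\<in>cube_pairs d. pcount (joined (edges H)) (U x) (U y)) + real (card (cube_pairs d)) * ?loss"
    by (simp add: sum.distrib case_prod_unfold)
  also have "real (card (cube_pairs d)) * ?loss \<le> 4 ^ d * ?loss"
    using loss by (intro mult_right_mono card_cube_pairs_le)
  finally have "real (card (edges H)) \<le> \<eta> * real m' ^ 2 + (rhs / (1 - \<theta>) * real q ^ 2 + 4 ^ d * ?loss)"
    using sumU by linarith
  moreover have "rho F G' * real (card (edges G')) = real (card (edges H))"
    using H(3) sub finG(2) by (cases "edges G' = {}") auto
  moreover have "4 ^ d * ?loss = 2 * 4 ^ d * real m' * (real m' - real (Suc m - s) * real q)"
    by (simp only: of_nat_mult mult_ac)
  ultimately show ?thesis unfolding rhs_def by linarith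
qed

text \<open>Origin of the 9: \<open>1 / (1 - \<theta>) \<le> 1 + 2 * \<theta>\<close> costs
  \<open>2 * \<theta> * N\<close> on the main term, the remaining errors sum to at most
  \<open>7 * \<theta>\<close>, and \<open>N \<ge> 1\<close>.\<close>

lemma rho_diff_le:
  fixes N r r' \<theta> :: real
  assumes "N \<ge> 1" "0 \<le> r" "r \<le> 1" "r' \<le> 1" "0 < \<theta>" "\<theta> \<le> 1/2"
    and le: "r' * (N - \<theta>) \<le> 2 * \<theta> + (r * N + 2 * \<theta>) / (1 - \<theta>)"
  shows "r' \<le> r + 9 * \<theta>"
proof -
  have "1 / (1 - \<theta>) \<le> 1 + 2 * \<theta>"
  proof -
    have "\<theta> * \<theta> \<le> \<theta> * (1/2)" using assms by (intro mult_left_mono) auto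
    then have "1 \<le> (1 + 2 * \<theta>) * (1 - \<theta>)" by (simp add: algebra_simps)
    then show ?thesis using assms by (simp add: pos_divide_le_eq)
  qed
  then have "(r * N + 2 * \<theta>) * (1 / (1 - \<theta>)) \<le> (r * N + 2 * \<theta>) * (1 + 2 * \<theta>)"
    using assms by (intro mult_left_mono) auto
  moreover have "r * N * (2 * \<theta>) \<le> 1 * N * (2 * \<theta>)"
    using assms by (intro mult_right_mono) auto
  moreover have "\<theta> * \<theta> \<le> \<theta> * (1/2)" using assms by (intro mult_left_mono) auto
  moreover have "r' * \<theta> \<le> 1 * \<theta>" using assms by (intro mult_right_mono) auto
  moreover have "1 * \<theta> \<le> N * \<theta>" using assms by (intro mult_right_mono) auto
  moreover have "r' * N - r' * \<theta> \<le> 2 * \<theta> + (r * N + 2 * \<theta>) * (1 / (1 - \<theta>))"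
    using le by (simp add: right_diff_distrib)
  moreover have "(r * N + 2 * \<theta>) * (1 + 2 * \<theta>) = r * N + r * N * (2 * \<theta>) + 2 * \<theta> + 4 * (\<theta> * \<theta>)"
    by (simp add: algebra_simps)
  ultimately have "r' * N \<le> r * N + 9 * (N * \<theta>)" by linarith
  then have "r' * N \<le> (r + 9 * \<theta>) * N" by (simp add: algebra_simps)
  then show ?thesis using assms by simp
qed

text \<open>The order of choices matters: \<open>\<zeta>\<close> and the window fraction
  \<open>\<sigma>\<close> depend only on \<open>\<epsilon>\<close> and \<open>d\<close>, whereas
  \<open>\<eta>\<close> is chosen after \<open>m\<close>, because all edges of \<open>R m\<close>
  between blocks are placed at once and \<open>\<eta>\<close> has to beat
  \<open>(1 / 2 ^ d) ^ n\<close>.\<close>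

lemma rho_host_asymptotically_decreasing:
  fixes F :: "'c::linorder ograph"
  assumes F: "verts F \<noteq> {}" and d: "d \<ge> 1"
    and good: "\<And>\<eta>. \<eta> > 0 \<Longrightarrow> \<exists>M. \<forall>m\<ge>M. good_host d m \<eta> (R m)" and \<epsilon>: "\<epsilon> > 0"
  shows "\<exists>M. \<forall>m\<ge>M. \<exists>M'. \<forall>m'\<ge>M'. rho F (R m') \<le> rho F (R m) + \<epsilon>"
proof -
  define N :: real where "N = real d * 2 ^ (d - 1)"
  have N: "N \<ge> 1"
  proof -
    have "1 * 1 \<le> real d * 2 ^ (d - 1)" using d by (intro mult_mono) auto
    then show ?thesis by (simp add: N_def)
  qed
  define \<theta> where "\<theta> = min (1/2) (\<epsilon> / 9)"
  have \<theta>: "\<theta> > 0" "\<theta> \<le> 1/2" "9 * \<theta> \<le> \<epsilon>" using \<epsilon> by (auto simp: \<theta>_def)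
  \<comment> \<open>Windows have length about \<open>\<sigma> * m\<close>. Each block then loses at
    most \<open>5 * \<sigma> * m'\<close> vertices, and
    \<open>2 * 4 ^ d * 5 * \<sigma> = \<theta>\<close>.\<close>
  define \<sigma> where "\<sigma> = \<theta> / (10 * 4 ^ d)"
  have "1 * 1 \<le> (10 :: real) * 4 ^ d" by (intro mult_mono) auto
  then have \<sigma>: "\<sigma> > 0" "\<sigma> \<le> \<theta>" using \<theta> by (auto simp: \<sigma>_def divide_le_eq mult_le_cancel_left1)
  \<comment> \<open>With \<open>s \<ge> \<sigma> * m\<close> this makes the relative window error
    \<open>\<zeta> * 2 ^ d * m ^ 2 / s ^ 2\<close> at most \<open>\<theta>\<close>.\<close>
  define \<zeta> where "\<zeta> = \<theta> * \<sigma> ^ 2 / 2 ^ d"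
  have \<zeta>: "\<zeta> > 0" "\<zeta> \<le> \<theta>"
  proof -
    show "\<zeta> > 0" using \<theta> \<sigma> by (simp add: \<zeta>_def)
    have "\<sigma> ^ 2 \<le> 1" using \<sigma> \<theta> by (intro power_le_one) auto
    also have "(1::real) \<le> 2 ^ d" by simp
    finally have "\<theta> * \<sigma> ^ 2 \<le> \<theta> * 2 ^ d" using \<theta> by (intro mult_left_mono) auto
    then show "\<zeta> \<le> \<theta>" by (simp add: \<zeta>_def divide_le_eq)
  qed
  obtain M1 where M1: "\<And>m. m \<ge> M1 \<Longrightarrow> good_host d m \<zeta> (R m)" using good[OF \<zeta>(1)] by blast
  define M where "M = Max {M1, nat \<lceil>1 / \<sigma>\<rceil>, nat \<lceil>1 / \<theta>\<rceil>, 1}"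
  have "\<exists>M'. \<forall>m'\<ge>M'. rho F (R m') \<le> rho F (R m) + \<epsilon>" if m: "m \<ge> M" for m
  proof -
    have G: "good_host d m \<zeta> (R m)" using m by (intro M1) (simp add: M_def)
    have m1: "1 / \<sigma> \<le> real m" "1 / \<theta> \<le> real m" "1 \<le> m" using m unfolding M_def by (simp_all; linarith)+
    define s where "s = nat \<lceil>\<sigma> * real m\<rceil>"
    have s: "\<sigma> * real m \<le> real s" "real s \<le> 2 * (\<sigma> * real m)" "1 \<le> s" "s \<le> m"
    proof -
      have 1: "1 \<le> \<sigma> * real m" using m1(1) \<sigma> by (simp add: field_simps)
      show "\<sigma> * real m \<le> real s" unfolding s_def by (rule real_nat_ceiling_ge)
      have "real s \<le> \<sigma> * real m + 1" using 1 by (simp add: s_def)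
      then show s2: "real s \<le> 2 * (\<sigma> * real m)" using 1 by linarith
      show "1 \<le> s" using 1 by (simp add: s_def) linarith
      have "\<sigma> * real m \<le> 1/2 * real m" using \<sigma> \<theta> by (intro mult_right_mono) auto
      then show "s \<le> m" using s2 by linarith
    qed
    define n where "n = card (edges (R m))"
    define K where "K = m + s"
    have K: "K \<ge> 1" "m \<le> K" using m1 by (auto simp: K_def)
    \<comment> \<open>Below, \<open>m' ^ 2 / q ^ 2 \<le> 4 * K ^ 2\<close>; the factor
      \<open>8 * K ^ 2\<close> absorbs this together with the 2 in the hypothesis of
      \<open>placement_bound\<close>. The added 1 keeps the denominator positive when
      \<open>n\<close> is 0.\<close>
    define \<eta> where "\<eta> = min \<theta> ((1 / 2 ^ d) ^ n / (8 * (real n ^ 2 + 1) * real K ^ 2))"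
    have n1: "real n ^ 2 + 1 > 0" by (simp add: add_nonneg_pos)
    have \<eta>: "\<eta> > 0" "\<eta> \<le> \<theta>" using \<theta> K n1 by (auto simp: \<eta>_def)
    obtain M2 where M2: "\<And>m'. m' \<ge> M2 \<Longrightarrow> good_host d m' \<eta> (R m')" using good[OF \<eta>(1)] by blast
    \<comment> \<open>The bound \<open>K / \<sigma>\<close> keeps the remainder of \<open>m'\<close>
      modulo \<open>K\<close>, which no cell covers, below \<open>\<sigma> * m'\<close>.\<close>
    define M' where "M' = Max {M2, nat \<lceil>real K / \<sigma>\<rceil>, K}"
    have "rho F (R m') \<le> rho F (R m) + \<epsilon>" if m': "m' \<ge> M'" for m'
    proof -
      have G': "good_host d m' \<eta> (R m')" using m' by (intro M2) (simp add: M'_def)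
      have "real K / \<sigma> \<le> real m'" and m'K: "m' \<ge> K" using m' unfolding M'_def by (simp_all; linarith)+
      then have m'1: "real K \<le> \<sigma> * real m'" using \<sigma> by (simp add: field_simps)
      define q where "q = m' div K"
      have q: "q \<ge> 1" using m'K K by (simp add: q_def div_greater_zero_iff Suc_le_eq)
      have "q * K \<le> m'" by (simp add: q_def)
      then have qK: "real q * real K \<le> real m'" by (metis of_nat_le_iff of_nat_mult)
      have "m' < q * K + K" using K mod_less_divisor[of K m'] div_mult_mod_eq[of m' K] unfolding q_def by linarith
      then have qK2: "real m' \<le> real q * real K + real K" by (metis less_imp_le of_nat_add of_nat_le_iff of_nat_mult)
      have "real K * 1 \<le> real K * real q" using q by (intro mult_left_mono) auto
      then have "real m' \<le> 2 * real K * real q" using qK2 by (simp add: algebra_simps)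
      then have "real m' ^ 2 \<le> (2 * real K * real q) ^ 2" by (intro power_mono) auto
      then have m'q: "real m' ^ 2 / real q ^ 2 \<le> 4 * real K ^ 2" using q by (simp add: field_simps power2_eq_square)
      have cond: "2 * real n ^ 2 * (\<eta> * real m' ^ 2 / real q ^ 2) \<le> (1 / 2 ^ d) ^ n"
      proof -
        have "\<eta> * (real m' ^ 2 / real q ^ 2) \<le> (1 / 2 ^ d) ^ n / (8 * (real n ^ 2 + 1) * real K ^ 2) * (4 * real K ^ 2)"
          using m'q \<eta> by (intro mult_mono) (auto simp: \<eta>_def n1 less_imp_le)
        also have "\<dots> = (1 / 2 ^ d) ^ n / (2 * (real n ^ 2 + 1))"
        proof -
          have "c / (8 * x * y) * (4 * y) = c / (2 * x)" if "x > 0" "y > 0" for c x y :: real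
            using that by (simp add: field_simps)
          from this[OF n1, of "real K ^ 2" "(1 / 2 ^ d) ^ n"] show ?thesis using K by simp
        qed
        finally have "2 * real n ^ 2 * (\<eta> * (real m' ^ 2 / real q ^ 2)) \<le> 2 * real n ^ 2 * ((1 / 2 ^ d) ^ n / (2 * (real n ^ 2 + 1)))"
          by (intro mult_left_mono) auto
        also have "\<dots> = (real n ^ 2 / (real n ^ 2 + 1)) * (1 / 2 ^ d) ^ n"
        proof -
          have "2 * x * (c / (2 * z)) = x / z * c" for c x z :: real by simp
          then show ?thesis .
        qed
        also have "\<dots> \<le> 1 * (1 / 2 ^ d) ^ n" using n1 by (intro mult_right_mono) (auto simp: divide_le_eq)
        finally show ?thesis by simp
      qed
      have \<zeta>s: "\<zeta> * 2 ^ d * real m ^ 2 / real s ^ 2 \<le> \<theta>"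
      proof -
        have "(\<sigma> * real m) ^ 2 \<le> real s ^ 2" using s \<sigma> by (intro power_mono) auto
        then have "\<theta> * (\<sigma> * real m) ^ 2 \<le> \<theta> * real s ^ 2" using \<theta> by (intro mult_left_mono) auto
        moreover have "\<zeta> * 2 ^ d * real m ^ 2 = \<theta> * (\<sigma> * real m) ^ 2" by (simp add: \<zeta>_def power_mult_distrib)
        ultimately show ?thesis using s by (simp add: divide_le_eq)
      qed
      define r where "r = rho F (R m)"
      define r' where "r' = rho F (R m')"
      have fin: "finite (edges (R m))" "finite (edges (R m'))"
        using G G' by (simp_all add: good_host_def ordered_graph_finite_edges)
      have r: "0 \<le> r" "r \<le> 1" "0 \<le> r'" "r' \<le> 1"
        unfolding r_def r'_def using rho_bounds[OF fin(1) F] rho_bounds[OF fin(2) F] by auto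
      have main: "r' * real (card (edges (R m'))) \<le> \<eta> * real m' ^ 2 + (r * real n + 1) / (1 - \<theta>) * real q ^ 2
          + 2 * 4 ^ d * real m' * (real m' - real (Suc m - s) * real q)"
        unfolding r_def r'_def n_def
        by (rule rho_host_le_rho_smaller[OF F G G' s(3,4)])
           (use q cond \<eta> \<zeta>s \<theta> in \<open>auto simp: q_def K_def n_def\<close>)
      have m'0: "real m' > 0" using m'K K by simp
      have t1: "\<eta> * real m' ^ 2 \<le> \<theta> * real m' ^ 2" using \<eta> by (intro mult_right_mono) auto
      have qm: "real q * real m \<le> real m'"
      proof -
        have "real q * real m \<le> real q * real K" using K by (intro mult_left_mono) auto
        then show ?thesis using qK by linarith
      qed
      have t2: "(r * real n + 1) / (1 - \<theta>) * real q ^ 2 \<le> (r * N + 2 * \<theta>) / (1 - \<theta>) * real m' ^ 2"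
      proof -
        have "real n \<le> (N + \<theta>) * real m ^ 2"
        proof -
          have "\<zeta> * real m ^ 2 \<le> \<theta> * real m ^ 2" using \<zeta> by (intro mult_right_mono) auto
          then show ?thesis using G by (simp add: good_host_def n_def N_def algebra_simps abs_le_iff)
        qed
        then have "r * real n \<le> r * ((N + \<theta>) * real m ^ 2)" using r by (intro mult_left_mono) auto
        also have "\<dots> \<le> (r * N + \<theta>) * real m ^ 2"
        proof -
          have "r * \<theta> \<le> 1 * \<theta>" using r \<theta> by (intro mult_right_mono) auto
          then have "(r * N + r * \<theta>) * real m ^ 2 \<le> (r * N + \<theta>) * real m ^ 2" by (intro mult_right_mono) auto
          then show ?thesis by (simp add: algebra_simps)
        qed
        finally have rn: "r * real n \<le> (r * N + \<theta>) * real m ^ 2" .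
        have "1 \<le> \<theta> * real m" using m1(2) \<theta> by (simp add: field_simps)
        also have "\<dots> \<le> \<theta> * real m ^ 2" using m1(3) \<theta> by (simp add: power2_eq_square)
        finally have "r * real n + 1 \<le> (r * N + 2 * \<theta>) * real m ^ 2" using rn by (simp add: algebra_simps)
        then have "(r * real n + 1) * real q ^ 2 \<le> (r * N + 2 * \<theta>) * real m ^ 2 * real q ^ 2"
          by (intro mult_right_mono) auto
        also have "\<dots> = (r * N + 2 * \<theta>) * (real q * real m) ^ 2" by (simp add: power_mult_distrib)
        also have "\<dots> \<le> (r * N + 2 * \<theta>) * real m' ^ 2"
          using qm r N \<theta> by (intro mult_left_mono power_mono) auto
        finally show ?thesis using \<theta> by (simp add: divide_right_mono)
      qed
      have t3: "2 * 4 ^ d * real m' * (real m' - real (Suc m - s) * real q) \<le> \<theta> * real m' ^ 2"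
      proof -
        have "(real K - 2 * real s) * real q \<le> real (Suc m - s) * real q"
          using s by (intro mult_right_mono) (auto simp: K_def of_nat_diff)
        then have "real m' - real (Suc m - s) * real q \<le> real K + 2 * real s * real q"
          using qK2 by (simp add: algebra_simps)
        also have "2 * real s * real q \<le> 2 * (2 * (\<sigma> * real m)) * real q"
          using s by (intro mult_right_mono) auto
        also have "\<dots> = 4 * \<sigma> * (real q * real m)" by simp
        also have "\<dots> \<le> 4 * \<sigma> * real m'" using qm \<sigma> by (intro mult_left_mono) auto
        finally have "real m' - real (Suc m - s) * real q \<le> 5 * \<sigma> * real m'" using m'1 by simp
        then have "2 * 4 ^ d * real m' * (real m' - real (Suc m - s) * real q) \<le> 2 * 4 ^ d * real m' * (5 * \<sigma> * real m')"
          by (intro mult_left_mono) auto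
        also have "\<dots> = \<theta> * real m' ^ 2" by (simp add: \<sigma>_def power2_eq_square)
        finally show ?thesis .
      qed
      have "(N - \<theta>) * real m' ^ 2 \<le> real (card (edges (R m')))"
      proof -
        have "N * real m' ^ 2 - \<eta> * real m' ^ 2 \<le> real (card (edges (R m')))"
          using G' by (simp add: good_host_def N_def abs_le_iff algebra_simps)
        then show ?thesis using t1 by (simp add: algebra_simps)
      qed
      then have "r' * ((N - \<theta>) * real m' ^ 2) \<le> r' * real (card (edges (R m')))"
        using r by (intro mult_left_mono) auto
      also have "\<dots> \<le> \<theta> * real m' ^ 2 + (r * N + 2 * \<theta>) / (1 - \<theta>) * real m' ^ 2 + \<theta> * real m' ^ 2"
        using main t1 t2 t3 by linarith
      finally have "(r' * (N - \<theta>)) * real m' ^ 2 \<le> (2 * \<theta> + (r * N + 2 * \<theta>) / (1 - \<theta>)) * real m' ^ 2"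
        by (simp only: distrib_right mult.assoc mult_2)
      then have "r' * (N - \<theta>) \<le> 2 * \<theta> + (r * N + 2 * \<theta>) / (1 - \<theta>)"
        using m'0 by (simp only: mult_le_cancel_right zero_less_power)
      then have "r' \<le> r + 9 * \<theta>" by (rule rho_diff_le[OF N r(1,2,4) \<theta>(1,2)])
      then show ?thesis using \<theta> by (simp add: r_def r'_def)
    qed
    then show ?thesis by blast
  qed
  then show ?thesis by blast
qed

text \<open>The limit is the limsup, written as the infimum of the eventual upper bounds. Every late
  term plus \<open>\<epsilon>\<close> is itself an eventual upper bound, so late terms cannot fall
  more than \<open>\<epsilon>\<close> below that infimum.\<close>

lemma convergent_if_asymptotically_decreasing:
  fixes r :: "nat \<Rightarrow> real"
  assumes nn: "\<And>m. 0 \<le> r m"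
    and dec: "\<And>\<epsilon>. \<epsilon> > 0 \<Longrightarrow> \<exists>M. \<forall>m\<ge>M. \<exists>M'. \<forall>m'\<ge>M'. r m' \<le> r m + \<epsilon>"
  shows "convergent r"
proof -
  define B where "B = {b. \<exists>M. \<forall>m\<ge>M. r m \<le> b}"
  have B0: "0 \<le> b" if b: "b \<in> B" for b
  proof -
    obtain M where "\<forall>m\<ge>M. r m \<le> b" using b unfolding B_def by blast
    then have "r M \<le> b" by simp
    then show ?thesis using nn[of M] by linarith
  qed
  have bdd: "bdd_below B" using B0 by (auto simp: bdd_below_def)
  obtain m where "\<exists>M'. \<forall>m'\<ge>M'. r m' \<le> r m + 1" using dec[of 1] by (meson order_refl zero_less_one)
  then have ne: "B \<noteq> {}" unfolding B_def by blast
  have "r \<longlonglongrightarrow> Inf B"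
  proof (rule LIMSEQ_I)
    fix e :: real assume e: "e > 0"
    then have "Inf B < Inf B + e / 2" by simp
    then obtain b where b: "b \<in> B" "b < Inf B + e / 2" using cInf_lessD[OF ne] by blast
    then obtain M1 where M1: "\<And>m. m \<ge> M1 \<Longrightarrow> r m \<le> b" by (auto simp: B_def)
    obtain M2 where M2: "\<And>m. m \<ge> M2 \<Longrightarrow> \<exists>M'. \<forall>m'\<ge>M'. r m' \<le> r m + e / 2" using dec[of "e / 2"] e by auto
    have "norm (r m - Inf B) < e" if m: "m \<ge> max M1 M2" for m
    proof -
      have "r m + e / 2 \<in> B" using M2[of m] m by (auto simp: B_def)
      then have "Inf B \<le> r m + e / 2" by (intro cInf_lower bdd)
      moreover have "r m < Inf B + e / 2" using M1[of m] m b by auto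
      ultimately show ?thesis using e by (simp add: abs_less_iff)
    qed
    then show "\<exists>no. \<forall>m\<ge>no. norm (r m - Inf B) < e" by blast
  qed
  then show ?thesis by (auto simp: convergent_def)
qed

section \<open>Random caterpillars in the binary tree\<close>

lemma avg_cube_append: "avg (cube (j + k)) f = avg (cube j) (\<lambda>a. avg (cube k) (\<lambda>b. f (a @ b)))"
proof -
  have "avg (cube (j + k)) f = avg ((\<lambda>(a, b). a @ b) ` (cube j \<times> cube k)) f"
    using bij_betw_cube_append[of j k] by (simp add: bij_betw_def)
  also have "\<dots> = avg (cube j \<times> cube k) (\<lambda>z. f ((\<lambda>(a, b). a @ b) z))"
    using bij_betw_cube_append[of j k] by (intro avg_reindex) (simp add: bij_betw_def)
  finally show ?thesis by (simp add: avg_times)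
qed

lemma avg_cube_1: "avg (cube (Suc 0)) f = (f [0] + f [1]) / 2"
  by (simp add: avg_def cube_1)

lemma avg_cube_Cons: "avg (cube (Suc k)) f = (avg (cube k) (\<lambda>y. f (0 # y)) + avg (cube k) (\<lambda>y. f (1 # y))) / 2"
  using avg_cube_append[of "Suc 0" k f] by (simp add: avg_cube_1)

lemma avg_cube_snoc: "avg (cube (Suc k)) f = avg (cube k) (\<lambda>y. (f (y @ [0]) + f (y @ [1])) / 2)"
  using avg_cube_append[of k "Suc 0" f] by (simp add: avg_cube_1)

lemma avg_cube_take: "avg (cube (k + l)) (\<lambda>a. f (take k a)) = avg (cube k) f"
proof -
  have "avg (cube (k + l)) (\<lambda>a. f (take k a)) = avg (cube k) (\<lambda>a. avg (cube l) (\<lambda>b. f (take k (a @ b))))"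
    by (rule avg_cube_append)
  also have "\<dots> = avg (cube k) (\<lambda>a. avg (cube l) (\<lambda>b. f a))"
    by (intro avg_cong) (simp add: cube_def)
  finally show ?thesis by (simp add: avg_const finite_cube cube_nonempty)
qed

lemmas avg_cube_bounds = avg_bounds[OF finite_cube cube_nonempty]

lemma square_avg_le: 
  assumes "finite A" "A \<noteq> {}"
  shows "(avg A f)\<^sup>2 \<le> avg A (\<lambda>a. (f a)\<^sup>2)"
proof -
  let ?\<mu> = "avg A f"
  have "0 \<le> avg A (\<lambda>a. (f a - ?\<mu>)\<^sup>2)" using avg_mono[of A "\<lambda>_. 0" "\<lambda>a. (f a - ?\<mu>)\<^sup>2"] by (simp add: avg_def)
  also have "avg A (\<lambda>a. (f a - ?\<mu>)\<^sup>2) = avg A (\<lambda>a. (f a)\<^sup>2 + (?\<mu>\<^sup>2 - (2 * ?\<mu>) * f a))"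
    by (intro avg_cong) (simp add: power2_eq_square algebra_simps)
  also have "\<dots> = avg A (\<lambda>a. (f a)\<^sup>2) - ?\<mu>\<^sup>2"
    using assms by (simp add: avg_add avg_diff avg_cmult avg_const power2_eq_square)
  finally show ?thesis by simp
qed

text \<open>The two ranges of summation differ by \<open>r\<close> terms at either end, and the
  terms lie in the unit interval.\<close>

lemma avg_shift:
  fixes \<phi> :: "nat \<Rightarrow> real"
  assumes "\<And>a. 0 \<le> \<phi> a" "\<And>a. \<phi> a \<le> 1"
  shows "\<bar>avg {..<D} (\<lambda>a. \<phi> (a + r)) - avg {..<D} \<phi>\<bar> \<le> real r / real D"
proof -
  have "\<bar>(\<Sum>a<D. \<phi> (a + r)) - (\<Sum>a<D. \<phi> a)\<bar> \<le> real r"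
  proof (induction r)
    case (Suc r)
    have "(\<Sum>a<D. \<phi> (a + Suc r)) + \<phi> r = (\<Sum>a<Suc D. \<phi> (a + r))"
      by (simp only: sum.lessThan_Suc_shift) simp
    then have "(\<Sum>a<D. \<phi> (a + Suc r)) = (\<Sum>a<D. \<phi> (a + r)) + \<phi> (D + r) - \<phi> r" by simp
    then show ?case using Suc assms[of "D + r"] assms[of r] by simp
  qed simp
  then have "\<bar>(\<Sum>a<D. \<phi> (a + r)) - (\<Sum>a<D. \<phi> a)\<bar> / real D \<le> real r / real D"
    by (intro divide_right_mono) auto
  then show ?thesis by (simp add: avg_def flip: diff_divide_distrib)
qed

text \<open>The mean square of \<open>f\<close> over level \<open>a\<close> grows with \<open>a\<close> by at most 1 in total, and its increments
  control the squared differences of the two child values.\<close>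

lemma forced_bit_bias:
  fixes f :: "nat list \<Rightarrow> real"
  assumes f: "\<And>p. 0 \<le> f p" "\<And>p. f p \<le> 1"
    and near: "\<And>p. \<bar>(f (p @ [0]) + f (p @ [1])) / 2 - f p\<bar> \<le> \<eta>"
    and D: "D \<ge> 1" and b: "b \<in> {0, 1}"
  shows "\<bar>avg {..<D} (\<lambda>a. avg (cube a) (\<lambda>p. f (p @ [b]))) - avg {..<D} (\<lambda>a. avg (cube a) f)\<bar>
    \<le> \<eta> + sqrt (1 / real D + 2 * \<eta>)"
proof -
  define \<Delta> where "\<Delta> p = (f (p @ [1]) - f (p @ [0])) / 2" for p
  have D': "finite {..<D}" "{..<D} \<noteq> {}" using D by (auto simp: lessThan_empty_iff)
  \<comment> \<open>The variance of the two child values is their mean square minus the square of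
    their mean \<open>m\<close>. Exchanging \<open>m\<close> for \<open>f p\<close> costs
    \<open>2 * \<eta>\<close>, since both lie in the unit interval.\<close>
  have sq: "(\<Delta> p)\<^sup>2 \<le> ((f (p @ [0]))\<^sup>2 + (f (p @ [1]))\<^sup>2) / 2 - (f p)\<^sup>2 + 2 * \<eta>" for p
  proof -
    define m where "m = (f (p @ [0]) + f (p @ [1])) / 2"
    have m: "0 \<le> m" "m \<le> 1" "\<bar>m - f p\<bar> \<le> \<eta>"
      unfolding m_def using f[of "p @ [0]"] f[of "p @ [1]"] near[of p] by (auto simp: field_simps)
    have "(\<Delta> p)\<^sup>2 = ((f (p @ [0]))\<^sup>2 + (f (p @ [1]))\<^sup>2) / 2 - m\<^sup>2"
      by (simp add: \<Delta>_def m_def power2_eq_square field_simps)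
    moreover have "(f p)\<^sup>2 - m\<^sup>2 \<le> 2 * \<eta>"
    proof -
      have "(f p)\<^sup>2 - m\<^sup>2 = (f p - m) * (f p + m)" by (simp add: power2_eq_square algebra_simps)
      also have "\<dots> \<le> \<bar>f p - m\<bar> * (f p + m)"
        using f[of p] m by (intro mult_right_mono) auto
      also have "\<dots> \<le> \<eta> * 2"
        using f[of p] m by (intro mult_mono) auto
      finally show ?thesis by simp
    qed
    ultimately show ?thesis by linarith
  qed
  let ?en = "\<lambda>a. avg (cube a) (\<lambda>p. (f p)\<^sup>2)"
  have lev: "avg (cube a) (\<lambda>p. (\<Delta> p)\<^sup>2) \<le> ?en (Suc a) - ?en a + 2 * \<eta>" for a
  proof -
    have "avg (cube a) (\<lambda>p. (\<Delta> p)\<^sup>2) \<le> avg (cube a) (\<lambda>p. ((f (p @ [0]))\<^sup>2 + (f (p @ [1]))\<^sup>2) / 2 - (f p)\<^sup>2 + 2 * \<eta>)"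
      by (intro avg_mono sq)
    then show ?thesis by (simp add: avg_add avg_diff avg_const finite_cube cube_nonempty avg_cube_snoc)
  qed
  have "(\<Sum>a<D. avg (cube a) (\<lambda>p. (\<Delta> p)\<^sup>2)) \<le> (\<Sum>a<D. ?en (Suc a) - ?en a + 2 * \<eta>)" by (intro sum_mono lev)
  also have "\<dots> = ?en D - ?en 0 + real D * (2 * \<eta>)" using sum_lessThan_telescope[of ?en D] by (simp add: sum.distrib)
  also have "\<dots> \<le> 1 + real D * (2 * \<eta>)"
  proof -
    have "0 \<le> (f p)\<^sup>2 \<and> (f p)\<^sup>2 \<le> 1" for p using f[of p] by (simp add: power_le_one)
    then have "?en D \<le> 1" "0 \<le> ?en 0"
      using avg_cube_bounds[of D 0 "\<lambda>p. (f p)\<^sup>2" 1] avg_cube_bounds[of 0 0 "\<lambda>p. (f p)\<^sup>2" 1] by auto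
    then show ?thesis by simp
  qed
  finally have "avg {..<D} (\<lambda>a. avg (cube a) (\<lambda>p. (\<Delta> p)\<^sup>2)) \<le> 1 / real D + 2 * \<eta>"
    using D by (simp add: avg_def[of "{..<D}"] field_simps)
  \<comment> \<open>Cauchy-Schwarz, once over the levels and once within each level, passes from the
    energy to the mean of \<open>\<bar>\<Delta> p\<bar>\<close>.\<close>
  moreover have "(avg {..<D} (\<lambda>a. avg (cube a) (\<lambda>p. \<bar>\<Delta> p\<bar>)))\<^sup>2 \<le> avg {..<D} (\<lambda>a. (avg (cube a) (\<lambda>p. \<bar>\<Delta> p\<bar>))\<^sup>2)"
    by (rule square_avg_le[OF D'])
  moreover have "avg {..<D} (\<lambda>a. (avg (cube a) (\<lambda>p. \<bar>\<Delta> p\<bar>))\<^sup>2) \<le> avg {..<D} (\<lambda>a. avg (cube a) (\<lambda>p. (\<Delta> p)\<^sup>2))"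
    using square_avg_le[OF finite_cube cube_nonempty, of _ "\<lambda>p. \<bar>\<Delta> p\<bar>"] by (intro avg_mono) simp
  ultimately have "avg {..<D} (\<lambda>a. avg (cube a) (\<lambda>p. \<bar>\<Delta> p\<bar>)) \<le> sqrt (1 / real D + 2 * \<eta>)"
    by (intro real_le_rsqrt) linarith
  moreover have "\<bar>f (p @ [b]) - f p\<bar> \<le> \<eta> + \<bar>\<Delta> p\<bar>" for p
  proof -
    have "f (p @ [0]) - f p = ((f (p @ [0]) + f (p @ [1])) / 2 - f p) - \<Delta> p"
      "f (p @ [1]) - f p = ((f (p @ [0]) + f (p @ [1])) / 2 - f p) + \<Delta> p"
      unfolding \<Delta>_def by (simp_all only: add_divide_distrib diff_divide_distrib)
    then have "\<bar>f (p @ [0]) - f p\<bar> \<le> \<eta> + \<bar>\<Delta> p\<bar>" "\<bar>f (p @ [1]) - f p\<bar> \<le> \<eta> + \<bar>\<Delta> p\<bar>"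
      using near[of p] by linarith+
    then show ?thesis using b by auto
  qed
  then have "avg {..<D} (\<lambda>a. avg (cube a) (\<lambda>p. \<bar>f (p @ [b]) - f p\<bar>)) \<le> avg {..<D} (\<lambda>a. avg (cube a) (\<lambda>p. \<eta> + \<bar>\<Delta> p\<bar>))"
    by (intro avg_mono)
  moreover have "avg {..<D} (\<lambda>a. avg (cube a) (\<lambda>p. \<eta> + \<bar>\<Delta> p\<bar>)) = \<eta> + avg {..<D} (\<lambda>a. avg (cube a) (\<lambda>p. \<bar>\<Delta> p\<bar>))"
    by (simp add: avg_add avg_const finite_cube cube_nonempty D')
  moreover have "\<bar>avg {..<D} (\<lambda>a. avg (cube a) (\<lambda>p. f (p @ [b]) - f p))\<bar> \<le> avg {..<D} (\<lambda>a. avg (cube a) (\<lambda>p. \<bar>f (p @ [b]) - f p\<bar>))"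
    by (rule order_trans[OF avg_abs_le avg_mono[OF avg_abs_le]])
  ultimately show ?thesis by (simp add: avg_diff)
qed

section \<open>Walks with forced bits: martingales from a fixed start, arbitrary functions on
  average\<close>

definition harmonic :: "(nat list \<Rightarrow> real) \<Rightarrow> bool" where
  "harmonic f \<longleftrightarrow> (\<forall>p. f p = (f (p @ [0]) + f (p @ [1])) / 2)"

lemma harmonic_avg:
  assumes "harmonic f" shows "avg (cube r) (\<lambda>y. f (s @ y)) = f s"
proof (induction r)
  case 0
  show ?case by (simp add: cube_0 avg_def)
next
  case (Suc r)
  have "avg (cube (Suc r)) (\<lambda>y. f (s @ y)) = avg (cube r) (\<lambda>y. (f ((s @ y) @ [0]) + f ((s @ y) @ [1])) / 2)"
    by (simp add: avg_cube_snoc)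
  also have "\<dots> = avg (cube r) (\<lambda>y. f (s @ y))"
    by (intro avg_cong assms[unfolded harmonic_def, rule_format, symmetric])
  finally show ?case using Suc by simp
qed

text \<open>The length is random because a single level may carry all the variation of a bounded
  martingale between siblings; averaged over \<open>S\<close> levels this variation is at most
  \<open>1 / sqrt S\<close>.\<close>

definition walk :: "nat \<Rightarrow> (nat list \<Rightarrow> real) \<Rightarrow> nat list \<Rightarrow> real" where
  "walk S f s = avg {..<S} (\<lambda>r. avg (cube r) (\<lambda>y. f (s @ y)))"

text \<open>An operator on functions of the end point: \<open>(step S ^^ j) f s\<close> is the
  expectation of \<open>f\<close> after \<open>j\<close> rounds, each a walk followed by a right
  turn, started at \<open>s\<close>.\<close>

definition step :: "nat \<Rightarrow> (nat list \<Rightarrow> real) \<Rightarrow> nat list \<Rightarrow> real" where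
  "step S f = walk S (\<lambda>t. f (t @ [1]))"

lemma step_apply: "step S f s = walk S (\<lambda>t. f (t @ [1])) s"
  by (simp add: step_def)

definition unit_bounded :: "(nat list \<Rightarrow> real) \<Rightarrow> bool" where
  "unit_bounded f \<longleftrightarrow> (\<forall>s. 0 \<le> f s \<and> f s \<le> 1)"

context
  fixes S :: nat
  assumes S: "S \<ge> 1"
begin

lemma finite_steps: "finite {..<S}" "{..<S} \<noteq> {}"
  using S by (auto simp: lessThan_empty_iff)

lemma walk_const: "walk S (\<lambda>_. c) s = c"
  by (simp add: walk_def avg_const finite_cube cube_nonempty finite_steps)

lemma walk_abs_diff_le:
  assumes "\<And>t. \<bar>f t - g t\<bar> \<le> c" shows "\<bar>walk S f s - walk S g s\<bar> \<le> c"
  unfolding walk_def by (intro avg_abs_diff_le finite_steps finite_cube cube_nonempty assms)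

lemma unit_bounded_walk: "unit_bounded f \<Longrightarrow> unit_bounded (walk S f)"
proof -
  assume f: "unit_bounded f"
  have "0 \<le> avg (cube r) (\<lambda>y. f (s @ y)) \<and> avg (cube r) (\<lambda>y. f (s @ y)) \<le> 1" for r s
    using f avg_cube_bounds[of r 0 "\<lambda>y. f (s @ y)" 1] by (simp add: unit_bounded_def)
  then show ?thesis
    unfolding unit_bounded_def walk_def
    using avg_bounds[OF finite_steps, of 0 "\<lambda>r. avg (cube r) (\<lambda>y. f (_ @ y))" 1] by simp
qed

lemma unit_bounded_step: "unit_bounded f \<Longrightarrow> unit_bounded (step S f)"
  unfolding step_def by (rule unit_bounded_walk) (simp add: unit_bounded_def)

lemma unit_bounded_step_pow: "unit_bounded f \<Longrightarrow> unit_bounded ((step S ^^ j) f)"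
  by (induction j) (auto intro: unit_bounded_step)

lemma walk_forced_bit:
  assumes f: "harmonic f" "unit_bounded f" and b: "b \<in> {0, 1}"
  shows "\<bar>walk S (\<lambda>t. f (t @ [b])) s - f s\<bar> \<le> 1 / sqrt (real S)"
proof -
  have "\<bar>avg {..<S} (\<lambda>a. avg (cube a) (\<lambda>p. (\<lambda>p. f (s @ p)) (p @ [b]))) - avg {..<S} (\<lambda>a. avg (cube a) (\<lambda>p. f (s @ p)))\<bar>
    \<le> 0 + sqrt (1 / real S + 2 * 0)"
  proof (rule forced_bit_bias[OF _ _ _ S b])
    show "\<bar>(f (s @ p @ [0]) + f (s @ p @ [1])) / 2 - f (s @ p)\<bar> \<le> 0" for p
    proof -
      have "f (s @ p) = (f ((s @ p) @ [0]) + f ((s @ p) @ [1])) / 2" using f(1) unfolding harmonic_def by blast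
      then show ?thesis by simp
    qed
  qed (use f in \<open>auto simp: unit_bounded_def\<close>)
  then show ?thesis
    by (simp add: walk_def harmonic_avg[OF f(1)] avg_const finite_steps real_sqrt_divide)
qed

text \<open>Each of the \<open>j\<close> right turns and the final left turn costs
  \<open>1 / sqrt S\<close>; walks are averages, so they do not amplify an error that holds at every
  node.\<close>

lemma step_pow_harmonic:
  assumes f: "harmonic f" "unit_bounded f"
  shows "\<bar>(step S ^^ j) (walk S (\<lambda>t. f (t @ [0]))) s - f s\<bar> \<le> (real j + 1) / sqrt (real S)"
proof (induction j arbitrary: s)
  case 0
  show ?case using walk_forced_bit[OF f, of 0 s] by simp
next
  case (Suc j)
  let ?g = "(step S ^^ j) (walk S (\<lambda>t. f (t @ [0])))"
  have "\<bar>walk S (\<lambda>t. ?g (t @ [1])) s - walk S (\<lambda>t. f (t @ [1])) s\<bar> \<le> (real j + 1) / sqrt (real S)"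
    by (intro walk_abs_diff_le Suc.IH)
  moreover have "\<bar>walk S (\<lambda>t. f (t @ [1])) s - f s\<bar> \<le> 1 / sqrt (real S)"
    by (rule walk_forced_bit[OF f]) simp
  moreover have "(real (Suc j) + 1) / sqrt (real S) = (real j + 1) / sqrt (real S) + 1 / sqrt (real S)"
    by (simp add: add_divide_distrib)
  moreover have "(step S ^^ Suc j) (walk S (\<lambda>t. f (t @ [0]))) s = walk S (\<lambda>t. ?g (t @ [1])) s"
    by (simp add: step_def)
  ultimately show ?case by linarith
qed

text \<open>Averaging over the two children lengthens the walk by one bit, which a uniform length
  below \<open>S\<close> barely notices. This makes \<open>forced_bit_bias\<close> applicable to
  functions that are far from harmonic.\<close>

lemma walk_almost_harmonic:
  assumes "unit_bounded f"
  shows "\<bar>(walk S f (p @ [0]) + walk S f (p @ [1])) / 2 - walk S f p\<bar> \<le> 1 / real S"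
proof -
  let ?\<phi> = "\<lambda>r. avg (cube r) (\<lambda>y. f (p @ y))"
  have "(walk S f (p @ [0]) + walk S f (p @ [1])) / 2 = avg {..<S} (\<lambda>r. ?\<phi> (r + 1))"
    by (simp add: walk_def avg_cube_Cons avg_def[of "{..<S}"] sum.distrib add_divide_distrib sum_divide_distrib mult.commute)
  moreover have "\<bar>avg {..<S} (\<lambda>r. ?\<phi> (r + 1)) - avg {..<S} ?\<phi>\<bar> \<le> real 1 / real S"
    using assms by (intro avg_shift avg_cube_bounds) (auto simp: unit_bounded_def)
  ultimately show ?thesis by (simp add: walk_def)
qed

context
  fixes D :: nat
  assumes D: "D \<ge> 1"
begin

abbreviation level_avg :: "(nat list \<Rightarrow> real) \<Rightarrow> real" where
  "level_avg f \<equiv> avg {..<D} (\<lambda>a. avg (cube a) f)"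

lemma finite_levels: "finite {..<D}" "{..<D} \<noteq> {}"
  using D by (auto simp: lessThan_empty_iff)

lemma level_avg_walk:
  assumes f: "unit_bounded f"
  shows "\<bar>level_avg (walk S f) - level_avg f\<bar> \<le> real S / real D"
proof -
  have "level_avg (walk S f) = avg {..<S} (\<lambda>r. avg {..<D} (\<lambda>a. avg (cube (a + r)) f))"
  proof -
    have "level_avg (walk S f) = avg {..<D} (\<lambda>a. avg {..<S} (\<lambda>r. avg (cube a) (\<lambda>p. avg (cube r) (\<lambda>y. f (p @ y)))))"
      unfolding walk_def by (intro avg_cong avg_swap)
    also have "\<dots> = avg {..<S} (\<lambda>r. avg {..<D} (\<lambda>a. avg (cube (a + r)) f))"
      by (subst avg_swap) (simp add: avg_cube_append)
    finally show ?thesis .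
  qed
  moreover have "\<bar>avg {..<S} (\<lambda>r. avg {..<D} (\<lambda>a. avg (cube (a + r)) f)) - avg {..<S} (\<lambda>r. level_avg f)\<bar> \<le> real S / real D"
  proof (rule avg_abs_diff_le[OF finite_steps])
    fix r assume "r \<in> {..<S}"
    have "\<bar>avg {..<D} (\<lambda>a. avg (cube (a + r)) f) - level_avg f\<bar> \<le> real r / real D"
      using f by (intro avg_shift avg_cube_bounds) (auto simp: unit_bounded_def)
    also have "\<dots> \<le> real S / real D" using \<open>r \<in> _\<close> by (intro divide_right_mono) auto
    finally show "\<bar>avg {..<D} (\<lambda>a. avg (cube (a + r)) f) - level_avg f\<bar> \<le> real S / real D" .
  qed
  ultimately show ?thesis by (simp add: avg_const finite_steps)
qed

text \<open>As \<open>f\<close> is arbitrary, the turn is estimated only on average over the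
  starting node, through the near-harmonicity of \<open>walk S f\<close>. The walk before the turn
  merely shifts the level and costs \<open>S / D\<close>.\<close>

lemma level_avg_step:
  assumes f: "unit_bounded f"
  shows "\<bar>level_avg (step S (walk S f)) - level_avg (walk S f)\<bar> \<le> real S / real D + 1 / real S + sqrt (1 / real D + 2 / real S)"
proof -
  have uw: "unit_bounded (walk S f)" by (rule unit_bounded_walk[OF f])
  then have "unit_bounded (\<lambda>t. walk S f (t @ [1]))" by (simp add: unit_bounded_def)
  then have "\<bar>level_avg (step S (walk S f)) - level_avg (\<lambda>t. walk S f (t @ [1]))\<bar> \<le> real S / real D"
    unfolding step_def by (rule level_avg_walk)
  moreover have "\<bar>level_avg (\<lambda>t. walk S f (t @ [1])) - level_avg (walk S f)\<bar> \<le> 1 / real S + sqrt (1 / real D + 2 * (1 / real S))"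
    using uw by (intro forced_bit_bias D walk_almost_harmonic f) (auto simp: unit_bounded_def)
  ultimately show ?thesis by simp
qed

lemma level_avg_step_pow:
  assumes f: "unit_bounded f"
  shows "\<bar>level_avg ((step S ^^ j) (walk S f)) - level_avg f\<bar>
    \<le> real S / real D + real j * (real S / real D + 1 / real S + sqrt (1 / real D + 2 / real S))"
proof (induction j)
  case 0
  show ?case using level_avg_walk[OF f] by simp
next
  case (Suc j)
  \<comment> \<open>\<open>level_avg_step\<close> requires a function of the form
    \<open>walk S f'\<close>. Every iterate has this form, since \<open>step\<close> is itself a
    walk applied to another function.\<close>
  obtain f' where f': "unit_bounded f'" "(step S ^^ j) (walk S f) = walk S f'"
  proof (cases j)
    case 0
    then show ?thesis using that[of f] f by simp
  next
    case (Suc i)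
    have "unit_bounded ((step S ^^ i) (walk S f))" by (intro unit_bounded_step_pow unit_bounded_walk f)
    then show ?thesis using that[of "\<lambda>t. (step S ^^ i) (walk S f) (t @ [1])"] Suc
      by (simp add: unit_bounded_def step_def)
  qed
  have "\<bar>level_avg ((step S ^^ Suc j) (walk S f)) - level_avg ((step S ^^ j) (walk S f))\<bar>
    \<le> real S / real D + 1 / real S + sqrt (1 / real D + 2 / real S)"
    using level_avg_step[OF f'(1)] by (simp add: f'(2))
  moreover have "real (Suc j) * X = real j * X + X" for X by (simp add: algebra_simps)
  ultimately show ?case using Suc by (smt (verit))
qed

end

end

text \<open>The law of the branching nodes of a caterpillar, kept as nested averages: expectations
  of functions of one or two nodes then collapse to powers of \<open>step\<close>.\<close>

fun chain_avg :: "nat \<Rightarrow> nat \<Rightarrow> nat list \<Rightarrow> (nat list list \<Rightarrow> real) \<Rightarrow> real" where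
  "chain_avg S 0 s g = g []"
| "chain_avg S (Suc k) s g = walk S (\<lambda>t. chain_avg S k (t @ [1]) (\<lambda>l. g (t # l))) s"

text \<open>The support of the average \<open>chain_avg\<close>.\<close>

fun is_chain :: "nat \<Rightarrow> nat list \<Rightarrow> nat list list \<Rightarrow> bool" where
  "is_chain S s [] \<longleftrightarrow> True"
| "is_chain S s (t # l) \<longleftrightarrow> (\<exists>y. length y < S \<and> t = s @ y \<and> set y \<subseteq> {0, 1}) \<and> is_chain S (t @ [1]) l"

lemma is_chain_nth:
  assumes "is_chain S s l" "v < length l" "set s \<subseteq> {0, 1}"
  shows "length (l ! v) < length s + Suc v * S" "set (l ! v) \<subseteq> {0, 1}" "\<exists>z. l ! v = s @ z"
proof -
  have "length (l ! v) < length s + Suc v * S \<and> set (l ! v) \<subseteq> {0, 1} \<and> (\<exists>z. l ! v = s @ z)"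
    using assms
  proof (induction l arbitrary: s v)
    case (Cons t l)
    then obtain y where y: "length y < S" "t = s @ y" "set y \<subseteq> {0, 1}" by auto
    show ?case
    proof (cases v)
      case 0
      then show ?thesis using y Cons.prems by auto
    next
      case (Suc v')
      have "length (l ! v') < length (t @ [1]) + Suc v' * S \<and> set (l ! v') \<subseteq> {0, 1} \<and> (\<exists>z. l ! v' = (t @ [1]) @ z)"
        using Cons.prems y Suc by (intro Cons.IH) auto
      then show ?thesis using y Suc by auto
    qed
  qed simp
  then show "length (l ! v) < length s + Suc v * S" "set (l ! v) \<subseteq> {0, 1}" "\<exists>z. l ! v = s @ z" by auto
qed

text \<open>Each walk resumes at a right child, and bits once fixed are never changed. Leaves hung
  to the left of the nodes therefore appear in increasing order.\<close>

lemma is_chain_branch: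
  assumes "is_chain S s l" "u < v" "v < length l" "set s \<subseteq> {0, 1}"
  shows "\<exists>z. l ! v = l ! u @ 1 # z"
  using assms
proof (induction l arbitrary: s u v)
  case (Cons t l)
  have t: "set (t @ [1]) \<subseteq> {0, 1}" using Cons.prems by auto
  obtain v' where v: "v = Suc v'" using Cons.prems by (cases v) auto
  show ?case
  proof (cases u)
    case 0
    have "\<exists>z. l ! v' = (t @ [1]) @ z" using Cons.prems t v by (intro is_chain_nth) auto
    then show ?thesis using 0 v by simp
  next
    case (Suc u')
    have "\<exists>z. l ! v' = l ! u' @ 1 # z" using Cons.prems t v Suc by (intro Cons.IH[of "t @ [1]"]) auto
    then show ?thesis using Suc v by simp
  qed
qed simp

context
  fixes S :: nat
  assumes S: "S \<ge> 1"
begin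

lemma chain_avg_const: "chain_avg S k s (\<lambda>_. c) = c"
  by (induction k arbitrary: s) (simp_all add: walk_const[OF S])

lemma chain_avg_sum: "chain_avg S k s (\<lambda>l. \<Sum>e\<in>E. g e l) = (\<Sum>e\<in>E. chain_avg S k s (g e))"
  by (induction k arbitrary: s g) (simp_all add: walk_def avg_sum)

lemma chain_avg_nth: "v < k \<Longrightarrow> chain_avg S k s (\<lambda>l. h (l ! v)) = (step S ^^ v) (walk S h) s"
proof (induction v arbitrary: k s)
  case 0
  then show ?case by (cases k) (simp_all add: chain_avg_const)
next
  case (Suc v)
  then obtain k' where k: "k = Suc k'" "v < k'" by (cases k) auto
  show ?case using Suc.IH[OF k(2)] by (simp add: k step_def)
qed

text \<open>Nodes after number \<open>v\<close> average out, while those before \<open>u\<close> and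
  those between \<open>u\<close> and \<open>v\<close> contribute plain powers of
  \<open>step\<close>. The inner power starts at the right child of \<open>t\<close>, the position
  of node \<open>u\<close>.\<close>

lemma chain_avg_nth_nth:
  "u < v \<Longrightarrow> v < k \<Longrightarrow> chain_avg S k s (\<lambda>l. h (l ! u) (l ! v))
    = (step S ^^ u) (walk S (\<lambda>t. (step S ^^ (v - Suc u)) (walk S (h t)) (t @ [1]))) s"
proof (induction u arbitrary: v k s)
  case 0
  then obtain v' k' where k: "k = Suc k'" "v = Suc v'" "v' < k'" by (cases k; cases v) auto
  show ?case using chain_avg_nth[OF k(3)] by (simp add: k)
next
  case (Suc u)
  then obtain v' k' where k: "k = Suc k'" "v = Suc v'" "u < v'" "v' < k'" by (cases k; cases v) auto
  show ?case using Suc.IH[OF k(3,4)] by (simp add: k step_def)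
qed

lemma exists_chain_ge_avg:
  "c \<le> chain_avg S k s g \<Longrightarrow> \<exists>l. is_chain S s l \<and> length l = k \<and> c \<le> g l"
proof (induction k arbitrary: s g)
  case 0
  then show ?case by (intro exI[of _ "[]"]) simp
next
  case (Suc k)
  let ?f = "\<lambda>t. chain_avg S k (t @ [1]) (\<lambda>l. g (t # l))"
  have "c \<le> avg {..<S} (\<lambda>r. avg (cube r) (\<lambda>y. ?f (s @ y)))" using Suc.prems by (simp add: walk_def)
  then obtain r where r: "r < S" "c \<le> avg (cube r) (\<lambda>y. ?f (s @ y))"
    using exists_ge_avg[OF finite_steps[OF S]] by blast
  then obtain y where y: "y \<in> cube r" "c \<le> ?f (s @ y)"
    using exists_ge_avg[OF finite_cube cube_nonempty] by blast
  obtain l where l: "is_chain S ((s @ y) @ [1]) l" "length l = k" "c \<le> g ((s @ y) # l)"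
    using Suc.IH[OF y(2)] by blast
  have "is_chain S s ((s @ y) # l)" using l y r by (auto simp: cube_def)
  then show ?case using l by (intro exI[of _ "(s @ y) # l"]) simp
qed

end

text \<open>Appending \<open>d\<close> random bits and truncating makes the average harmonic on the whole infinite tree, also below
  depth \<open>d\<close>.\<close>

definition leaf_avg :: "nat \<Rightarrow> (nat list \<Rightarrow> real) \<Rightarrow> nat list \<Rightarrow> real" where
  "leaf_avg d f t = avg (cube d) (\<lambda>b. f (take d (t @ b)))"

lemma harmonic_leaf_avg: "harmonic (leaf_avg d f)"
  unfolding harmonic_def
proof
  fix t
  have "(leaf_avg d f (t @ [0]) + leaf_avg d f (t @ [1])) / 2 = avg (cube (Suc d)) (\<lambda>b. f (take d (t @ b)))"
    by (simp add: leaf_avg_def avg_cube_Cons)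
  also have "\<dots> = avg (cube d) (\<lambda>b. (f (take d (t @ b @ [0])) + f (take d (t @ b @ [1]))) / 2)"
    by (rule avg_cube_snoc)
  also have "\<dots> = avg (cube d) (\<lambda>b. f (take d (t @ b)))"
    by (intro avg_cong) (simp add: cube_def)
  finally show "leaf_avg d f t = (leaf_avg d f (t @ [0]) + leaf_avg d f (t @ [1])) / 2"
    by (simp add: leaf_avg_def)
qed

lemma unit_bounded_leaf_avg: "unit_bounded f \<Longrightarrow> unit_bounded (leaf_avg d f)"
  using avg_cube_bounds[of d 0 "\<lambda>b. f (take d (_ @ b))" 1] by (simp add: unit_bounded_def leaf_avg_def)

lemma take_branch: "take (Suc (length s + k)) (s @ c # a) = s @ c # take k a"
  by simp

lemma leaf_avg_branch:
  assumes "d = Suc (length s + k)"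
  shows "leaf_avg d f (s @ [c]) = avg (cube k) (\<lambda>a. f (s @ c # a))"
proof -
  have "leaf_avg d f (s @ [c]) = avg (cube (k + Suc (length s))) (\<lambda>a. f (s @ c # take k a))"
    by (simp add: leaf_avg_def assms add.commute)
  then show ?thesis using avg_cube_take[of k "Suc (length s)" "\<lambda>a. f (s @ c # a)"] by simp
qed

text \<open>The leaf below \<open>t\<close> is averaged outermost, so that harmonicity in
  \<open>t\<close> is immediate; \<open>t\<close> is the argument that still moves after the first
  vertex has split off.\<close>

definition subtree_avg :: "nat \<Rightarrow> (nat list \<Rightarrow> nat list \<Rightarrow> real) \<Rightarrow> nat list \<Rightarrow> nat list \<Rightarrow> real" where
  "subtree_avg d w s t = leaf_avg d (\<lambda>y. leaf_avg d (\<lambda>x. w x y) s) t"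

text \<open>Identifies the target of the caterpillar: the weighted mean of \<open>w\<close> over a
  level is what an unbiased branching node of depth \<open>l\<close> sees.\<close>

lemma sum_level_subtree_avg:
  assumes "l < d"
  shows "(\<Sum>(x, y)\<in>level_pairs d (Suc l). edge_prob d x y * w x y)
    = 2 ^ (d - 1) * avg (cube l) (\<lambda>s. subtree_avg d w (s @ [0]) (s @ [1]))"
proof -
  obtain k where d: "d = Suc (l + k)" using assms less_iff_Suc_add by auto
  have "avg (cube k) (\<lambda>a. avg (cube k) (\<lambda>b. w (s @ 0 # a) (s @ 1 # b))) = subtree_avg d w (s @ [0]) (s @ [1])"
    if "s \<in> cube l" for s
  proof -
    have s: "d = Suc (length s + k)" using that d by (simp add: cube_def)
    show ?thesis
      unfolding subtree_avg_def leaf_avg_branch[OF s] by (rule avg_swap)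
  qed
  then have "avg (cube l) (\<lambda>s. avg (cube k) (\<lambda>a. avg (cube k) (\<lambda>b. w (s @ 0 # a) (s @ 1 # b))))
    = avg (cube l) (\<lambda>s. subtree_avg d w (s @ [0]) (s @ [1]))" by (rule avg_cong)
  then show ?thesis using sum_level_pairs[of l k w] by (simp add: d)
qed

text \<open>For an edge \<open>(u, v)\<close> the leaf of \<open>u\<close> is exactly uniform below
  the left child of node \<open>u\<close>. The error \<open>n / sqrt S\<close> is the bias of the
  leaf of \<open>v\<close> inside the right subtree of that node; the other errors are the bias of
  node \<open>u\<close> itself. Since the average over all choices reaches the bound, some choice
  does.\<close>

lemma exists_increasing_leaves:
  fixes w :: "nat list \<Rightarrow> nat list \<Rightarrow> real"
  assumes w: "\<And>x y. 0 \<le> w x y" "\<And>x y. w x y \<le> 1"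
    and S: "S \<ge> 1" and D: "D \<ge> 1" and d: "D + n * S \<le> d"
    and E: "\<And>e. e \<in> E \<Longrightarrow> fst e < snd e \<and> snd e < n"
  shows "\<exists>x. (\<forall>v<n. x v \<in> cube d) \<and> (\<forall>u v. u < v \<longrightarrow> v < n \<longrightarrow> x u < x v)
    \<and> real (card E) * (avg {..<D} (\<lambda>a. avg (cube a) (\<lambda>s. subtree_avg d w (s @ [0]) (s @ [1])))
        - (real S / real D + real n * (real S / real D + 1 / real S + sqrt (1 / real D + 2 / real S)) + real n / sqrt (real S)))
      \<le> (\<Sum>e\<in>E. w (x (fst e)) (x (snd e)))"
proof -
  let ?W = "\<lambda>s. subtree_avg d w (s @ [0]) (s @ [1])"
  let ?X = "real S / real D + 1 / real S + sqrt (1 / real D + 2 / real S)"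
  let ?J = "\<lambda>f. avg {..<D} (\<lambda>a. avg (cube a) f)"
  define h where "h t t' = subtree_avg d w (t @ [0]) (t' @ [0])" for t t'
  define c where "c = ?J ?W - (real S / real D + real n * ?X + real n / sqrt (real S))"
  have finE: "finite E" by (rule finite_subset[of _ "{..<n} \<times> {..<n}"]) (use E in force)+
  have harm: "harmonic (subtree_avg d w s)" for s
    unfolding subtree_avg_def using harmonic_leaf_avg by (simp add: eta_contract_eq)
  have ub: "unit_bounded (subtree_avg d w s)" for s
  proof -
    have "unit_bounded (leaf_avg d (\<lambda>x. w x y))" for y using w by (intro unit_bounded_leaf_avg) (simp add: unit_bounded_def)
    then have "unit_bounded (\<lambda>y. leaf_avg d (\<lambda>x. w x y) s)" by (simp add: unit_bounded_def)
    then show ?thesis unfolding subtree_avg_def by (rule unit_bounded_leaf_avg)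
  qed
  then have ubW: "unit_bounded ?W" by (simp add: unit_bounded_def)
  have edge: "c \<le> ?J (\<lambda>s. chain_avg S n s (\<lambda>l. h (l ! fst e) (l ! snd e)))" if eE: "e \<in> E" for e
  proof -
    obtain u v where e: "e = (u, v)" "u < v" "v < n" using E[OF eE] by (cases e) auto
    let ?g = "\<lambda>t. (step S ^^ (v - Suc u)) (walk S (h t)) (t @ [1])"
    \<comment> \<open>With node \<open>u\<close> at \<open>t\<close>, the rest of the way to
      \<open>v\<close> consists of right turns and one left turn, applied to a function harmonic in
      its second argument.\<close>
    have ptw: "\<bar>?g t - ?W t\<bar> \<le> real n / sqrt (real S)" for t
    proof -
      have "\<bar>?g t - ?W t\<bar> \<le> (real (v - Suc u) + 1) / sqrt (real S)"
        using step_pow_harmonic[OF S harm ub, of "v - Suc u" "t @ [0]" "t @ [1]"] by (simp add: h_def[abs_def])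
      also have "\<dots> \<le> real n / sqrt (real S)" using e S by (intro divide_right_mono) auto
      finally show ?thesis .
    qed
    have iter: "\<bar>(step S ^^ j) (walk S ?g) s - (step S ^^ j) (walk S ?W) s\<bar> \<le> real n / sqrt (real S)" for j s
    proof (induction j arbitrary: s)
      case 0
      have "\<bar>walk S ?g s - walk S ?W s\<bar> \<le> real n / sqrt (real S)" by (rule walk_abs_diff_le[OF S ptw])
      then show ?case by simp
    next
      case (Suc j)
      have "\<bar>walk S (\<lambda>t. (step S ^^ j) (walk S ?g) (t @ [1])) s - walk S (\<lambda>t. (step S ^^ j) (walk S ?W) (t @ [1])) s\<bar>
        \<le> real n / sqrt (real S)" by (intro walk_abs_diff_le[OF S] Suc.IH)
      then show ?case by (simp only: funpow.simps comp_apply step_apply[of S "(step S ^^ j) f" for f])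
    qed
    have "?J ((step S ^^ u) (walk S ?W)) - real n / sqrt (real S) \<le> ?J ((step S ^^ u) (walk S ?g))"
    proof -
      have "\<bar>?J ((step S ^^ u) (walk S ?g)) - ?J ((step S ^^ u) (walk S ?W))\<bar> \<le> real n / sqrt (real S)"
        by (intro avg_abs_diff_le finite_levels[OF S D] finite_cube cube_nonempty iter)
      then show ?thesis by linarith
    qed
    moreover have "?J ?W - (real S / real D + real u * ?X) \<le> ?J ((step S ^^ u) (walk S ?W))"
      using level_avg_step_pow[OF S D ubW, of u] by linarith
    moreover have "real u * ?X \<le> real n * ?X" using e by (intro mult_right_mono add_nonneg_nonneg) auto
    ultimately have "c \<le> ?J ((step S ^^ u) (walk S ?g))" unfolding c_def by linarith
    then show ?thesis using chain_avg_nth_nth[OF S e(2,3), of _ h] by (simp add: e(1))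
  qed
  have "real (card E) * c = (\<Sum>e\<in>E. c)" by simp
  also have "\<dots> \<le> (\<Sum>e\<in>E. ?J (\<lambda>s. chain_avg S n s (\<lambda>l. h (l ! fst e) (l ! snd e))))" by (intro sum_mono edge)
  also have "\<dots> = ?J (\<lambda>s. chain_avg S n s (\<lambda>l. \<Sum>e\<in>E. h (l ! fst e) (l ! snd e)))"
    by (simp add: chain_avg_sum[OF S] avg_sum)
  finally obtain a where a: "a < D" "real (card E) * c \<le> avg (cube a) (\<lambda>s. chain_avg S n s (\<lambda>l. \<Sum>e\<in>E. h (l ! fst e) (l ! snd e)))"
    using exists_ge_avg[OF finite_levels[OF S D]] by blast
  then obtain s where s: "s \<in> cube a" "real (card E) * c \<le> chain_avg S n s (\<lambda>l. \<Sum>e\<in>E. h (l ! fst e) (l ! snd e))"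
    using exists_ge_avg[OF finite_cube cube_nonempty] by blast
  then obtain l where l: "is_chain S s l" "length l = n" "real (card E) * c \<le> (\<Sum>e\<in>E. h (l ! fst e) (l ! snd e))"
    using exists_chain_ge_avg[OF S] by blast
  have s01: "set s \<subseteq> {0, 1}" and lens: "length s = a" using s by (auto simp: cube_def)
  let ?\<Phi> = "PiE {..<n} (\<lambda>_. cube d)"
  \<comment> \<open>Branching nodes have varying depth; appending \<open>d\<close> random bits and
    truncating yields a uniform leaf below the left child whenever the node is shallower than
    \<open>d\<close>.\<close>
  let ?x = "\<lambda>\<phi> v. take d (l ! v @ 0 # \<phi> v)"
  have fin\<Phi>: "finite ?\<Phi>" "?\<Phi> \<noteq> {}"
    using finite_PiE_nonempty[of "{..<n}" "\<lambda>_. cube d"] by (simp_all add: finite_cube cube_nonempty)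
  have "(\<Sum>e\<in>E. h (l ! fst e) (l ! snd e)) = (\<Sum>e\<in>E. avg ?\<Phi> (\<lambda>\<phi>. w (?x \<phi> (fst e)) (?x \<phi> (snd e))))"
  proof (rule sum.cong[OF refl])
    fix e assume "e \<in> E"
    then have uv: "fst e < n" "snd e < n" "fst e \<noteq> snd e" using E[of e] by auto
    have "avg ?\<Phi> (\<lambda>\<phi>. w (?x \<phi> (fst e)) (?x \<phi> (snd e)))
      = avg (cube d) (\<lambda>a. avg (cube d) (\<lambda>b. w (take d (l ! fst e @ 0 # a)) (take d (l ! snd e @ 0 # b))))"
      by (rule avg_PiE_pair) (use uv in \<open>simp_all add: finite_cube cube_nonempty\<close>)
    also have "\<dots> = h (l ! fst e) (l ! snd e)"
      unfolding h_def subtree_avg_def leaf_avg_def by (subst avg_swap) simp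
    finally show "h (l ! fst e) (l ! snd e) = avg ?\<Phi> (\<lambda>\<phi>. w (?x \<phi> (fst e)) (?x \<phi> (snd e)))" by simp
  qed
  also have "\<dots> = avg ?\<Phi> (\<lambda>\<phi>. \<Sum>e\<in>E. w (?x \<phi> (fst e)) (?x \<phi> (snd e)))" by (rule avg_sum[symmetric])
  finally obtain \<phi> where \<phi>: "\<phi> \<in> ?\<Phi>" "real (card E) * c \<le> (\<Sum>e\<in>E. w (?x \<phi> (fst e)) (?x \<phi> (snd e)))"
    using exists_ge_avg[OF fin\<Phi>, of "real (card E) * c"] l(3) by fastforce
  \<comment> \<open>A walk has at most \<open>S - 1\<close> bits, and the right turn after it takes
    the last of its \<open>S\<close> reserved levels. Hence \<open>D + n * S \<le> d\<close> leaves
    room for one more bit below every node.\<close>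
  have len: "length (l ! v) < d" if "v < n" for v
  proof -
    have "length (l ! v) < a + Suc v * S" using is_chain_nth(1)[OF l(1) _ s01, of v] that l(2) lens by simp
    also have "a + Suc v * S \<le> D + n * S" using a(1) that by (intro add_mono mult_le_mono1) auto
    finally show ?thesis using d by simp
  qed
  show ?thesis
  proof (intro exI[of _ "?x \<phi>"] conjI allI impI)
    fix v assume v: "v < n"
    have "set (l ! v) \<subseteq> {0, 1}" using is_chain_nth(2)[OF l(1) _ s01] v l(2) by simp
    moreover have "\<phi> v \<in> cube d" using \<phi>(1) v by auto
    ultimately have "set (l ! v @ 0 # \<phi> v) \<subseteq> {0, 1}" "length (l ! v @ 0 # \<phi> v) \<ge> d" by (auto simp: cube_def)
    then show "?x \<phi> v \<in> cube d" unfolding cube_def using set_take_subset[of d "l ! v @ 0 # \<phi> v"] by auto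
  next
    fix u v assume uv: "u < v" "v < n"
    obtain z where z: "l ! v = l ! u @ 1 # z" using is_chain_branch[OF l(1) uv(1) _ s01] uv l(2) by auto
    \<comment> \<open>The two strings first differ right after \<open>l ! u\<close>, which is
      shorter than \<open>d\<close>, so truncation keeps the deciding bit.\<close>
    obtain k where k: "d = Suc (length (l ! u) + k)" using len[of u] uv less_iff_Suc_add by (metis less_trans)
    show "?x \<phi> u < ?x \<phi> v"
      unfolding z k append_assoc append_Cons take_branch append_less_iff by simp
  next
    show "real (card E) * (?J ?W - (real S / real D + real n * ?X + real n / sqrt (real S)))
      \<le> (\<Sum>e\<in>E. w (?x \<phi> (fst e)) (?x \<phi> (snd e)))"
      using \<phi>(2) unfolding c_def .
  qed
qed

section \<open>The limit over the dimension\<close>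

text \<open>The threshold \<open>d0\<close> depends only on \<open>n\<close> and
  \<open>\<epsilon>\<close>. Uniformity in \<open>w\<close> is essential, since \<open>w\<close>
  will come from an extremal subgraph that changes with \<open>m\<close>.\<close>

lemma exists_increasing_leaves_asymptotic:
  fixes \<epsilon> :: real and n :: nat
  assumes \<epsilon>: "\<epsilon> > 0"
  shows "\<exists>d0. \<forall>d\<ge>d0. \<forall>w :: nat list \<Rightarrow> nat list \<Rightarrow> real. \<forall>E. (\<forall>x y. 0 \<le> w x y \<and> w x y \<le> 1) \<longrightarrow>
    (\<forall>e\<in>E. fst e < snd e \<and> snd e < n) \<longrightarrow>
    (\<exists>x. (\<forall>v<n. x v \<in> cube d) \<and> (\<forall>u v. u < v \<longrightarrow> v < n \<longrightarrow> x u < x v)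
      \<and> real (card E) * ((\<Sum>(x, y)\<in>cube_pairs d. edge_prob d x y * w x y) / (real d * 2 ^ (d - 1)) - \<epsilon>)
        \<le> (\<Sum>e\<in>E. w (x (fst e)) (x (snd e))))"
proof -
  \<comment> \<open>With \<open>t = 1 / sqrt S\<close> every error is a multiple of
    \<open>t\<close>: the caterpillar contributes \<open>t + 4 * n * t + n * t\<close>, and the
    levels beyond \<open>D\<close> another \<open>n * t\<close>.\<close>
  define C where "C = 6 * real n + 1"
  define S where "S = nat \<lceil>(C / \<epsilon>)\<^sup>2\<rceil> + 1"
  have S: "S \<ge> 1" by (simp add: S_def)
  have "(C / \<epsilon>)\<^sup>2 \<le> real S" unfolding S_def of_nat_add using real_nat_ceiling_ge[of "(C / \<epsilon>)\<^sup>2"] by linarith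
  then have "C / \<epsilon> \<le> sqrt (real S)" by (rule real_le_rsqrt)
  define t where "t = 1 / sqrt (real S)"
  have sS: "sqrt (real S) \<ge> 1" using S by simp
  have t: "t \<ge> 0" "C * t \<le> \<epsilon>"
    using \<open>C / \<epsilon> \<le> sqrt (real S)\<close> sS \<epsilon> by (auto simp: t_def field_simps)
  have St: "1 / real S \<le> t"
  proof -
    have "1 / real S = t * t" using S by (simp add: t_def)
    also have "\<dots> \<le> t * 1" using sS t by (intro mult_left_mono) (auto simp: t_def divide_le_eq)
    finally show ?thesis by simp
  qed
  show ?thesis
  proof (intro exI[of _ "S * S + n * S"] allI impI)
    fix d and w :: "nat list \<Rightarrow> nat list \<Rightarrow> real" and E :: "(nat \<times> nat) set"
    assume d: "S * S + n * S \<le> d" and w: "\<forall>x y. 0 \<le> w x y \<and> w x y \<le> 1"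
      and E: "\<forall>e\<in>E. fst e < snd e \<and> snd e < n"
    \<comment> \<open>The last \<open>n * S\<close> levels are reserved for the chain, and
      \<open>D \<ge> S * S\<close> gives \<open>S / D \<le> 1 / S\<close>.\<close>
    define D where "D = d - n * S"
    have DS: "S * S \<le> D" and dD: "D + n * S = d" using d by (auto simp: D_def)
    have D1: "D \<ge> 1" using DS S by (metis le_trans mult_le_mono nat_mult_1)
    have dpos: "d > 0" "real D > 0" "real d > 0" using D1 dD by auto
    let ?W = "\<lambda>s. subtree_avg d w (s @ [0]) (s @ [1])"
    let ?A = "\<lambda>l. avg (cube l) ?W"
    define \<alpha> where "\<alpha> = (\<Sum>(x, y)\<in>cube_pairs d. edge_prob d x y * w x y) / (real d * 2 ^ (d - 1))"
    define J where "J = avg {..<D} ?A"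
    have W: "0 \<le> ?W s \<and> ?W s \<le> 1" for s
    proof -
      have "unit_bounded (leaf_avg d (\<lambda>x. w x y))" for y using w by (intro unit_bounded_leaf_avg) (simp add: unit_bounded_def)
      then have "unit_bounded (\<lambda>y. leaf_avg d (\<lambda>x. w x y) s)" for s by (simp add: unit_bounded_def)
      then have "unit_bounded (subtree_avg d w s)" for s unfolding subtree_avg_def by (rule unit_bounded_leaf_avg)
      then show ?thesis by (simp add: unit_bounded_def)
    qed
    have A: "0 \<le> ?A l" "?A l \<le> 1" for l using avg_cube_bounds[of l 0 ?W 1] W by auto
    have J0: "0 \<le> J" unfolding J_def by (rule avg_bounds(1)[where h = 1]) (use A D1 in \<open>auto simp: lessThan_empty_iff\<close>)
    have SD: "real S / real D \<le> 1 / real S"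
    proof -
      have "real S * real S \<le> real D" using DS by (metis of_nat_le_iff of_nat_mult)
      then show ?thesis using dpos S by (simp add: field_simps)
    qed
    have "\<alpha> \<le> J + real n * (1 / real S)"
    proof -
      have "(\<Sum>(x, y)\<in>cube_pairs d. edge_prob d x y * w x y) = (\<Sum>l<d. 2 ^ (d - 1) * ?A l)"
        unfolding sum_cube_pairs by (intro sum.cong refl sum_level_subtree_avg) simp
      then have "\<alpha> * real d = (\<Sum>l<d. ?A l)" using dpos by (simp add: \<alpha>_def flip: sum_distrib_left)
      also have "\<dots> = (\<Sum>l<D. ?A l) + (\<Sum>l\<in>{D..<d}. ?A l)"
      proof -
        have "{..<d} = {..<D} \<union> {D..<d}" using dD by auto
        then show ?thesis by (simp only: sum.union_disjoint[of "{..<D}" "{D..<d}"] finite_lessThan finite_atLeastLessThan ivl_disj_int)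
      qed
      also have "(\<Sum>l\<in>{D..<d}. ?A l) \<le> (\<Sum>l\<in>{D..<d}. 1)" by (intro sum_mono A)
      also have "(\<Sum>l\<in>{D..<d}. 1) = real n * real S" using dD by (simp add: D_def)
      also have "(\<Sum>l<D. ?A l) = J * real D" using dpos by (simp add: J_def avg_def[of "{..<D}"])
      finally have "\<alpha> * real d \<le> J * real D + real n * real S" by simp
      also have "\<dots> \<le> J * real d + real n * (1 / real S) * real d"
      proof (intro add_mono mult_left_mono J0)
        show "real D \<le> real d" using dD by simp
        have "real S \<le> 1 / real S * real D" using SD dpos S by (simp add: field_simps)
        also have "\<dots> \<le> 1 / real S * real d" using dD by (intro mult_left_mono) auto
        finally have "real n * real S \<le> real n * (1 / real S * real d)" by (intro mult_left_mono) auto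
        then show "real n * real S \<le> real n * (1 / real S) * real d" by simp
      qed
      also have "\<dots> = (J + real n * (1 / real S)) * real d" by (simp add: distrib_right)
      finally show ?thesis using dpos by simp
    qed
    moreover have "real n * (1 / real S) \<le> real n * t" using St by (intro mult_left_mono) auto
    moreover have "real S / real D + real n * (real S / real D + 1 / real S + sqrt (1 / real D + 2 / real S)) + real n / sqrt (real S)
      \<le> t + real n * (t + t + 2 * t) + real n * t"
    proof (intro add_mono mult_left_mono)
      show "real S / real D \<le> t" "real S / real D \<le> t" "1 / real S \<le> t" using SD St by auto
      have "real 1 \<le> real S" using S by simp
      then have "1 / real D \<le> real S / real D" using dpos by (intro divide_right_mono) auto
      then have "1 / real D + 2 / real S \<le> 4 / real S" using SD S by (simp add: field_simps)
      then have "sqrt (1 / real D + 2 / real S) \<le> sqrt (4 / real S)" by (rule real_sqrt_le_mono)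
      then show "sqrt (1 / real D + 2 / real S) \<le> 2 * t" by (simp add: t_def real_sqrt_divide)
    qed (auto simp: t_def)
    moreover have "t + real n * (t + t + 2 * t) + real n * t + real n * t = C * t" by (simp add: C_def algebra_simps)
    ultimately have "\<alpha> - \<epsilon> \<le> J - (real S / real D + real n * (real S / real D + 1 / real S + sqrt (1 / real D + 2 / real S)) + real n / sqrt (real S))"
      using t by linarith
    then have le: "real (card E) * (\<alpha> - \<epsilon>) \<le> real (card E) * (J - (real S / real D + real n * (real S / real D + 1 / real S + sqrt (1 / real D + 2 / real S)) + real n / sqrt (real S)))"
      by (intro mult_left_mono) auto
    obtain x where "\<forall>v<n. x v \<in> cube d" "\<forall>u v. u < v \<longrightarrow> v < n \<longrightarrow> x u < x v"
      "real (card E) * (J - (real S / real D + real n * (real S / real D + 1 / real S + sqrt (1 / real D + 2 / real S)) + real n / sqrt (real S)))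
        \<le> (\<Sum>e\<in>E. w (x (fst e)) (x (snd e)))"
      using exists_increasing_leaves[of w S D n d E] w S D1 dD E unfolding J_def by auto
    then show "\<exists>x. (\<forall>v<n. x v \<in> cube d) \<and> (\<forall>u v. u < v \<longrightarrow> v < n \<longrightarrow> x u < x v)
      \<and> real (card E) * ((\<Sum>(x, y)\<in>cube_pairs d. edge_prob d x y * w x y) / (real d * 2 ^ (d - 1)) - \<epsilon>)
        \<le> (\<Sum>e\<in>E. w (x (fst e)) (x (snd e)))"
      using order_trans[OF le] unfolding \<alpha>_def by blast
  qed
qed

section \<open>Comparison of the hosts with the infimum\<close>

definition rank :: "'a::linorder set \<Rightarrow> 'a \<Rightarrow> nat" where
  "rank V v = card {u \<in> V. u < v}"

lemma rank_strict_mono: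
  assumes "finite V" "u \<in> V" "u < v" shows "rank V u < rank V v"
  unfolding rank_def using assms by (intro psubset_card_mono) auto

lemma rank_less_card:
  assumes "finite V" "v \<in> V" shows "rank V v < card V"
  unfolding rank_def using assms by (intro psubset_card_mono) auto

lemma inj_on_rank: "finite V \<Longrightarrow> inj_on (rank V) V"
  by (rule linorder_inj_onI) (auto dest: rank_strict_mono)

text \<open>The caterpillar chooses a block for each vertex of \<open>G\<close> such that an
  extremal subgraph of \<open>R m\<close> is, relative to \<open>edge_prob\<close>, about as dense
  on the chosen pairs as overall. \<open>placement_bound\<close>, with whole blocks as the sets of
  images, then limits that density by \<open>rho F G\<close>.\<close>

lemma rho_host_le_rho:
  fixes F :: "'c::linorder ograph" and G :: "'a::linorder ograph" and \<epsilon> :: real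
  assumes F: "verts F \<noteq> {}" and G: "ordered_graph G" "edges G \<noteq> {}" and \<epsilon>: "\<epsilon> > 0"
  shows "\<exists>d0. \<forall>d\<ge>d0. \<forall>R. 1 \<le> d \<longrightarrow> (\<forall>\<eta>>0. \<exists>M. \<forall>m\<ge>M. good_host d m \<eta> (R m)) \<longrightarrow>
    (\<exists>M. \<forall>m\<ge>M. rho F (R m) \<le> rho F G + \<epsilon>)"
proof -
  define V where "V = verts G"
  define n where "n = card V"
  define k where "k = card (edges G)"
  define \<theta> where "\<theta> = \<epsilon> / 4"
  have \<theta>: "\<theta> > 0" using \<epsilon> by (simp add: \<theta>_def)
  have finV: "finite V" and card2: "\<And>e. e \<in> edges G \<Longrightarrow> card e = 2" using G by (auto simp: V_def ordered_graph_def)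
  have finG: "finite (edges G)" by (rule ordered_graph_finite_edges[OF G(1)])
  have k: "k \<ge> 1" using G(2) finG by (simp add: k_def Suc_le_eq card_gt_0_iff)
  let ?P = "edge_pairs (edges G)"
  let ?r = "\<lambda>e. (rank V (fst e), rank V (snd e))"
  have PV: "fst e \<in> V \<and> snd e \<in> V \<and> fst e < snd e" if "e \<in> ?P" for e
    using that G(1) by (auto simp: edge_pairs_def ordered_graph_def V_def)
  have injr: "inj_on ?r ?P"
    using PV inj_on_rank[OF finV] by (auto simp: inj_on_def prod_eq_iff)
  define E where "E = ?r ` ?P"
  have cardE: "card E = k" "card ?P = k"
    using card_image[OF injr] finite_edge_pairs[OF finG card2] by (auto simp: E_def k_def)
  have EE: "\<forall>e\<in>E. fst e < snd e \<and> snd e < n"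
    unfolding E_def n_def using PV rank_strict_mono[OF finV] rank_less_card[OF finV] by auto
  have \<theta>2: "\<theta> / 2 > 0" using \<theta> by simp
  from exists_increasing_leaves_asymptotic[OF \<theta>2, of n]
  obtain d0 where d0: "\<forall>d\<ge>d0. \<forall>w :: nat list \<Rightarrow> nat list \<Rightarrow> real. \<forall>E. (\<forall>x y. 0 \<le> w x y \<and> w x y \<le> 1) \<longrightarrow>
    (\<forall>e\<in>E. fst e < snd e \<and> snd e < n) \<longrightarrow>
    (\<exists>x. (\<forall>v<n. x v \<in> cube d) \<and> (\<forall>u v. u < v \<longrightarrow> v < n \<longrightarrow> x u < x v)
      \<and> real (card E) * ((\<Sum>(x, y)\<in>cube_pairs d. edge_prob d x y * w x y) / (real d * 2 ^ (d - 1)) - \<theta> / 2)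
        \<le> (\<Sum>e\<in>E. w (x (fst e)) (x (snd e))))"
    by (rule exE)
  have "\<exists>M. \<forall>m\<ge>M. rho F (R m) \<le> rho F G + \<epsilon>"
    if d: "d \<ge> d0" "d \<ge> 1" and good: "\<forall>\<eta>>0. \<exists>M. \<forall>m\<ge>M. good_host d m \<eta> (R m)" for d and R :: "nat \<Rightarrow> (nat list \<times> nat) ograph"
  proof -
    define N :: real where "N = real d * 2 ^ (d - 1)"
    have N: "N \<ge> 1"
    proof -
      have "1 * 1 \<le> real d * 2 ^ (d - 1)" using d by (intro mult_mono) auto
      then show ?thesis by (simp add: N_def)
    qed
    \<comment> \<open>\<open>\<theta>\<close> serves the edge counts, \<open>1 / 2 ^ d\<close> keeps
      the density of \<open>R m\<close> between two blocks at most twice \<open>edge_prob\<close>,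
      and the last entry is what \<open>placement_bound\<close> demands for \<open>k\<close>
      edges.\<close>
    define \<eta> where "\<eta> = Min {\<theta>, 1 / 2 ^ d, \<theta> * (1 / 2 ^ d) ^ k / (2 * real k ^ 2)}"
    have \<eta>: "\<eta> > 0" "\<eta> \<le> \<theta>" "\<eta> \<le> 1 / 2 ^ d" "\<eta> \<le> \<theta> * (1 / 2 ^ d) ^ k / (2 * real k ^ 2)"
      using \<theta> k by (auto simp: \<eta>_def)
    obtain M where M: "\<And>m. m \<ge> M \<Longrightarrow> good_host d m \<eta> (R m)" using good \<eta>(1) by blast
    have "rho F (R m) \<le> rho F G + \<epsilon>" if m: "m \<ge> max M 1" for m
    proof -
      have H0: "good_host d m \<eta> (R m)" using M m by simp
      then have Rg: "ordered_graph (R m)" "verts (R m) = cube d \<times> {1..m}" by (auto simp: good_host_def)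
      have finR: "finite (edges (R m))" by (rule ordered_graph_finite_edges[OF Rg(1)])
      have m0: "m > 0" "real m > 0" "real m ^ 2 > 0" using m by auto
      obtain H where H: "subgraph H (R m)" "\<not> contains H F"
        "rho F (R m) = real (card (edges H)) / real (card (edges (R m)))"
        using rho_attained[OF finR F] .
      have sub: "edges H \<subseteq> edges (R m)" using H by (simp add: subgraph_def)
      let ?c = "\<lambda>x y. pcount (joined (edges H)) (block m x) (block m y)"
      \<comment> \<open>Regularity allows the density of \<open>H\<close> to exceed
        \<open>edge_prob\<close> slightly. Halving brings the ratio below 1, as the choice of leaves
        requires, and is undone below.\<close>
      define w where "w x y = (if x \<in> cube d \<and> y \<in> cube d \<and> x \<noteq> y then ?c x y / (2 * (edge_prob d x y * real m ^ 2)) else 0)" for x y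
      have w: "0 \<le> w x y \<and> w x y \<le> 1" for x y
      proof (cases "x \<in> cube d \<and> y \<in> cube d \<and> x \<noteq> y")
        case True
        then have xy: "x \<in> cube d" "y \<in> cube d" "x \<noteq> y" by auto
        let ?p = "edge_prob d x y"
        note pb = edge_prob_bounds[OF xy]
        have "?c x y \<le> pcount (joined (edges (R m))) (block m x) (block m y)" using sub by (intro pcount_mono) auto
        also have "\<dots> \<le> ?p * real m * real m + \<eta> * real m ^ 2"
          using good_host_regular[OF H0 xy order_refl order_refl] by (simp add: card_block abs_le_iff)
        also have "\<dots> = (?p + \<eta>) * real m ^ 2" by (simp add: power2_eq_square algebra_simps)
        also have "\<dots> \<le> (2 * ?p) * real m ^ 2" using pb \<eta> by (intro mult_right_mono) auto
        finally have "?c x y \<le> 2 * (?p * real m ^ 2)" by simp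
        moreover have "0 < 2 * (?p * real m ^ 2)" using pb m0 by simp
        ultimately show ?thesis using True pcount_nonneg[of "joined (edges H)" "block m x" "block m y"]
          by (simp add: w_def divide_le_eq)
      qed (auto simp: w_def)
      define \<alpha> where "\<alpha> = (\<Sum>(x, y)\<in>cube_pairs d. edge_prob d x y * w x y) / N"
      obtain x where x: "\<forall>v<n. x v \<in> cube d" "\<forall>u v. u < v \<longrightarrow> v < n \<longrightarrow> x u < x v"
        "real (card E) * (\<alpha> - \<theta> / 2) \<le> (\<Sum>e\<in>E. w (x (fst e)) (x (snd e)))"
        using d0[THEN spec, THEN mp, OF d(1), THEN spec, of w, THEN spec, of E] w EE
        unfolding \<alpha>_def N_def by blast
      define y where "y v = x (rank V v)" for v
      have yc: "y v \<in> cube d" if "v \<in> V" for v using x(1) rank_less_card[OF finV that] by (simp add: y_def n_def)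
      have ym: "y u < y v" if "u \<in> V" "v \<in> V" "u < v" for u v
        using x(2) rank_strict_mono[OF finV that(1,3)] rank_less_card[OF finV that(2)] by (simp add: y_def n_def)
      have "(\<Sum>e\<in>?P. ?c (y (fst e)) (y (snd e))
        / (edge_prob d (y (fst e)) (y (snd e)) * (real (card (block m (y (fst e)))) * real (card (block m (y (snd e)))))))
        \<le> rho F G * real (card (edges G)) + \<theta>"
      proof (rule placement_bound[where T = "edges (R m)" and r = "1 / 2 ^ d" and \<eta> = \<eta>
            and p = "\<lambda>e. edge_prob d (y (fst e)) (y (snd e))" and S = "\<lambda>v. block m (y v)"])
        show "ordered_graph G" "verts F \<noteq> {}" by fact+
        show "\<And>e. e \<in> edges H \<Longrightarrow> e \<subseteq> verts H" "\<not> contains H F" "edges H \<subseteq> edges (R m)"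
          using H by (auto simp: subgraph_def)
        show "finite (block m (y v)) \<and> block m (y v) \<noteq> {}" for v using m0 by (auto simp: block_def)
        show "a < b" if "u \<in> verts G" "v \<in> verts G" "u < v" "a \<in> block m (y u)" "b \<in> block m (y v)" for u v a b
          using ym[of u v] that by (auto simp: V_def block_def less_prod_def)
        show "(0::real) < 1 / 2 ^ d" by simp
        show "0 \<le> \<eta>" using \<eta> by simp
        show "2 * real (card (edges G)) ^ 2 * \<eta> \<le> \<theta> * (1 / 2 ^ d) ^ card (edges G)"
          using \<eta>(4) k by (simp add: k_def[symmetric] pos_le_divide_eq mult_ac)
        fix e assume e: "e \<in> ?P"
        have yy: "y (fst e) \<in> cube d" "y (snd e) \<in> cube d" "y (fst e) \<noteq> y (snd e)"
          using PV[OF e] yc ym[of "fst e" "snd e"] by auto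
        have "regular_pair (joined (edges (R m))) (edge_prob d (y (fst e)) (y (snd e))) \<eta> (block m (y (fst e))) (block m (y (snd e)))"
          unfolding regular_pair_def using good_host_regular[OF H0 yy] by (simp add: card_block power2_eq_square mult.assoc)
        then show "1 / 2 ^ d \<le> edge_prob d (y (fst e)) (y (snd e)) \<and> edge_prob d (y (fst e)) (y (snd e)) \<le> 1
          \<and> regular_pair (joined (edges (R m))) (edge_prob d (y (fst e)) (y (snd e))) \<eta> (block m (y (fst e))) (block m (y (snd e)))"
          using edge_prob_bounds[OF yy] by simp
      qed
      moreover have "?c (y (fst e)) (y (snd e))
        / (edge_prob d (y (fst e)) (y (snd e)) * (real (card (block m (y (fst e)))) * real (card (block m (y (snd e))))))
        = 2 * w (y (fst e)) (y (snd e))" if e: "e \<in> ?P" for e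
      proof -
        have "y (fst e) \<in> cube d" "y (snd e) \<in> cube d" "y (fst e) \<noteq> y (snd e)"
          using PV[OF e] yc ym[of "fst e" "snd e"] by auto
        then show ?thesis by (simp add: w_def card_block power2_eq_square)
      qed
      ultimately have "2 * (\<Sum>e\<in>?P. w (y (fst e)) (y (snd e))) \<le> rho F G * real k + \<theta>"
        by (simp add: sum_distrib_left k_def)
      moreover have "(\<Sum>e\<in>E. w (x (fst e)) (x (snd e))) = (\<Sum>e\<in>?P. w (y (fst e)) (y (snd e)))"
        unfolding E_def by (subst sum.reindex[OF injr]) (simp add: y_def)
      ultimately have "2 * (real k * (\<alpha> - \<theta> / 2)) \<le> rho F G * real k + \<theta>" using x(3) by (simp add: cardE)
      also have "\<dots> \<le> rho F G * real k + \<theta> * real k" using k \<theta> by simp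
      finally have "(2 * \<alpha>) * real k \<le> (rho F G + 2 * \<theta>) * real k" by (simp add: algebra_simps)
      then have \<alpha>: "2 * \<alpha> \<le> rho F G + 2 * \<theta>" using k by simp
      have "real (card (edges H)) \<le> real (card (inner_edges m (edges H))) + (\<Sum>(x, y)\<in>cube_pairs d. ?c x y)"
        by (rule card_le_inner_plus_pairs[OF Rg sub])
      also have "real (card (inner_edges m (edges H))) \<le> \<eta> * real m ^ 2"
      proof -
        have "card (inner_edges m (edges H)) \<le> card (inner_edges m (edges (R m)))"
          using sub finR by (intro card_mono) (auto simp: inner_edges_def)
        then show ?thesis using H0 by (simp add: good_host_def)
      qed
      also have "(\<Sum>(x, y)\<in>cube_pairs d. ?c x y) = (\<Sum>(x, y)\<in>cube_pairs d. (2 * real m ^ 2) * (edge_prob d x y * w x y))"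
      proof (intro sum.cong refl, clarify)
        fix x y assume "(x, y) \<in> cube_pairs d"
        then have xy: "x \<in> cube d" "y \<in> cube d" "x \<noteq> y" by (auto simp: cube_pairs_def)
        then show "?c x y = (2 * real m ^ 2) * (edge_prob d x y * w x y)"
          using edge_prob_bounds(3)[OF xy] m0 by (simp add: w_def)
      qed
      also have "\<dots> = (2 * real m ^ 2) * (\<alpha> * N)"
        using N by (simp add: \<alpha>_def sum_distrib_left case_prod_unfold)
      finally have cH: "real (card (edges H)) \<le> (\<eta> + 2 * \<alpha> * N) * real m ^ 2" by (simp add: algebra_simps)
      define r where "r = rho F (R m)"
      have r: "0 \<le> r" "r \<le> 1" unfolding r_def using rho_bounds[OF finR F] by auto
      have "(N - \<eta>) * real m ^ 2 \<le> real (card (edges (R m)))"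
        using H0 by (simp add: good_host_def N_def abs_le_iff algebra_simps)
      then have "r * ((N - \<eta>) * real m ^ 2) \<le> r * real (card (edges (R m)))" using r by (intro mult_left_mono)
      also have "r * real (card (edges (R m))) = real (card (edges H))"
        using H(3) sub finR by (cases "edges (R m) = {}") (auto simp: r_def)
      finally have "r * (N - \<eta>) * real m ^ 2 \<le> (\<eta> + 2 * \<alpha> * N) * real m ^ 2" using cH by (simp add: mult.assoc)
      then have "r * (N - \<eta>) \<le> \<eta> + 2 * \<alpha> * N" using m0 by (simp only: mult_le_cancel_right)
      moreover have "2 * \<alpha> * N \<le> (rho F G + 2 * \<theta>) * N" using \<alpha> N by (intro mult_right_mono) auto
      moreover have "r * \<eta> \<le> 1 * \<theta>" using r \<eta> by (intro mult_mono) auto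
      moreover have "1 * \<theta> \<le> N * \<theta>" using N \<theta> by (intro mult_right_mono) auto
      \<comment> \<open>Two \<open>\<theta>\<close> stem from choosing the leaves and from placing
        \<open>G\<close>, the other two from the edges inside blocks and from the edge number of
        \<open>R m\<close>; together they make \<open>\<epsilon>\<close>.\<close>
      ultimately have "r * N \<le> (rho F G + 4 * \<theta>) * N" using \<eta>(2) by (simp add: algebra_simps)
      then show ?thesis using N by (simp add: r_def \<theta>_def)
    qed
    then show ?thesis by blast
  qed
  then show ?thesis by blast
qed

text \<open>The infimum ranges over graphs on natural numbers while the hosts live on lists; ranks
  transport them. An extremal subgraph of the copy pulls back to \<open>G\<close>, so the copy has
  no larger density.\<close>

lemma rho_lt_le:
  fixes F :: "nat ograph" and G :: "'a::linorder ograph"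
  assumes F: "verts F \<noteq> {}" and G: "ordered_graph G" "edges G \<noteq> {}"
  shows "rho_lt F \<le> rho F G"
proof -
  define r where "r = rank (verts G)"
  have finV: "finite (verts G)" and card2: "\<And>e. e \<in> edges G \<Longrightarrow> card e = 2" and EV: "\<And>e. e \<in> edges G \<Longrightarrow> e \<subseteq> verts G"
    using G by (auto simp: ordered_graph_def)
  have finG: "finite (edges G)" by (rule ordered_graph_finite_edges[OF G(1)])
  have inj: "inj_on r (verts G)" unfolding r_def by (rule inj_on_rank[OF finV])
  define G' where "G' = (r ` verts G, (\<lambda>e. r ` e) ` edges G)"
  have G'e: "edges G' = (\<lambda>e. r ` e) ` edges G" and G'v: "verts G' = r ` verts G"
    by (simp_all add: G'_def edges_def verts_def)
  have G': "ordered_graph G'"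
    unfolding ordered_graph_def G'e G'v using finV EV card2
    by (auto simp: card_image[OF inj_on_subset[OF inj]])
  have finG': "finite (edges G')" using finG by (simp add: G'e)
  have "inj_on (\<lambda>e. r ` e) (edges G)"
    using inj EV by (meson inj_onI inj_on_image_eq_iff)
  then have cardG': "card (edges G') = card (edges G)" by (simp add: G'e card_image)
  obtain H where H: "subgraph H G'" "\<not> contains H F" "rho F G' = real (card (edges H)) / real (card (edges G'))"
    using rho_attained[OF finG' F] .
  let ?P = "{e \<in> edge_pairs (edges G). {r (fst e), r (snd e)} \<in> edges H}"
  have finP: "finite ?P" using finite_edge_pairs(1)[OF finG card2] by simp
  have "edges H \<subseteq> (\<lambda>e. {r (fst e), r (snd e)}) ` ?P"
  proof
    fix e' assume e': "e' \<in> edges H"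
    then obtain e where e: "e \<in> edges G" "e' = r ` e" using H(1) by (auto simp: subgraph_def G'e)
    then obtain z where z: "z \<in> edge_pairs (edges G)" "e = {fst z, snd z}"
      using bij_betw_edge_pairs[of "edges G", OF card2] unfolding bij_betw_def by blast
    then show "e' \<in> (\<lambda>e. {r (fst e), r (snd e)}) ` ?P" using e e' by (intro image_eqI[of _ _ z]) auto
  qed
  then have "card (edges H) \<le> card ?P" using finP by (meson card_image_le card_mono finite_imageI le_trans)
  also have "real (card ?P) \<le> rho F G * real (card (edges G))"
    by (rule pullback_card_le[OF G(1) _ H(2)])
       (use H(1) rank_strict_mono[OF finV] in \<open>auto simp: subgraph_def r_def\<close>)
  finally have "real (card (edges H)) \<le> rho F G * real (card (edges G))" by simp
  moreover have "card (edges G) > 0" using finG G(2) by (simp add: card_gt_0_iff)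
  ultimately have "rho F G' \<le> rho F G" using H(3) by (simp add: cardG' divide_le_eq)
  moreover have "rho_lt F \<le> rho F G'"
    unfolding rho_lt_def
  proof (rule cInf_lower)
    show "rho F G' \<in> {rho F G | G :: nat ograph. ordered_graph G \<and> edges G \<noteq> {}}"
    proof -
      have "edges G' \<noteq> {}" using G(2) by (simp add: G'e)
      then show ?thesis using G' by blast
    qed
    show "bdd_below {rho F G | G :: nat ograph. ordered_graph G \<and> edges G \<noteq> {}}"
      using rho_bounds(1)[OF _ F] ordered_graph_finite_edges by (intro bdd_belowI[of _ 0]) blast
  qed
  ultimately show ?thesis by linarith
qed

lemma exists_rho_less:
  fixes F :: "nat ograph"
  assumes "\<epsilon> > 0"
  obtains G :: "nat ograph" where "ordered_graph G" "edges G \<noteq> {}" "rho F G < rho_lt F + \<epsilon>"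
proof -
  let ?A = "{rho F G | G :: nat ograph. ordered_graph G \<and> edges G \<noteq> {}}"
  have "ordered_graph (({0, 1}, {{0, 1}}) :: nat ograph) \<and> edges (({0, 1}, {{0, 1}}) :: nat ograph) \<noteq> {}"
    by (auto simp: ordered_graph_def verts_def edges_def)
  then have "?A \<noteq> {}" by blast
  then obtain a where "a \<in> ?A" "a < rho_lt F + \<epsilon>"
    using cInf_lessD[of ?A "rho_lt F + \<epsilon>"] assms by (auto simp: rho_lt_def)
  then show ?thesis using that by blast
qed

theorem theorem1p1:
  fixes R :: "nat \<Rightarrow> nat \<Rightarrow> (nat list \<times> nat) ograph" and F :: "nat ograph"
  assumes R_graph: "\<And>m d. ordered_graph (R m d) \<and> verts (R m d) = cube d \<times> {1..m}"
    and R_prop: "\<And>d \<epsilon>. d \<ge> 1 \<Longrightarrow> \<epsilon> > 0 \<Longrightarrow> \<exists>M. \<forall>m\<ge>M.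
        (\<forall>l\<in>{1..d}.
            (1 - \<epsilon>) * 2 ^ (d - 1) * real m ^ 2 \<le> real (card (level_edges (R m d) l))
          \<and> real (card (level_edges (R m d) l)) \<le> (1 + \<epsilon>) * 2 ^ (d - 1) * real m ^ 2)
      \<and> (1 - \<epsilon>) * real d * 2 ^ (d - 1) * real m ^ 2 \<le> real (card (edges (R m d)))
      \<and> real (card (edges (R m d))) \<le> (1 + \<epsilon>) * real d * 2 ^ (d - 1) * real m ^ 2
      \<and> (\<forall>x\<in>cube d. \<forall>y\<in>cube d. \<forall>P Q. x \<noteq> y \<longrightarrow> P \<subseteq> block m x \<longrightarrow> Q \<subseteq> block m y
           \<longrightarrow> real (card P) \<ge> real m powr (2/3) \<longrightarrow> real (card Q) \<ge> real m powr (2/3)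
           \<longrightarrow> real (card (edges_between (R m d) P Q))
                 \<le> (1 + \<epsilon>) * 2 powr (real (delta x y) - real d) * real (card P) * real (card Q))"
    and F_graph: "ordered_graph F" and F_nonempty: "verts F \<noteq> {}"
  shows "\<exists>L. (\<forall>d\<ge>1. (\<lambda>m. rho F (R m d)) \<longlonglongrightarrow> L d) \<and> L \<longlonglongrightarrow> rho_lt F"
proof -
  have good: "\<exists>M. \<forall>m\<ge>M. good_host d m \<eta> (R m d)" if d: "d \<ge> 1" and \<eta>: "\<eta> > 0" for d \<eta>
  proof -
    \<comment> \<open>Compensates the factor \<open>4 * 4 ^ d\<close> lost in
      \<open>good_hostI\<close>.\<close>
    define \<epsilon> :: real where "\<epsilon> = \<eta> / (4 * 4 ^ d)"
    have \<epsilon>: "\<epsilon> > 0" "4 * 4 ^ d * \<epsilon> = \<eta>" using \<eta> by (auto simp: \<epsilon>_def)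
    obtain M where M: "\<And>m. m \<ge> M \<Longrightarrow>
        (\<forall>l\<in>{1..d}.
            (1 - \<epsilon>) * 2 ^ (d - 1) * real m ^ 2 \<le> real (card (level_edges (R m d) l))
          \<and> real (card (level_edges (R m d) l)) \<le> (1 + \<epsilon>) * 2 ^ (d - 1) * real m ^ 2)
      \<and> (1 - \<epsilon>) * real d * 2 ^ (d - 1) * real m ^ 2 \<le> real (card (edges (R m d)))
      \<and> real (card (edges (R m d))) \<le> (1 + \<epsilon>) * real d * 2 ^ (d - 1) * real m ^ 2
      \<and> (\<forall>x\<in>cube d. \<forall>y\<in>cube d. \<forall>P Q. x \<noteq> y \<longrightarrow> P \<subseteq> block m x \<longrightarrow> Q \<subseteq> block m y
           \<longrightarrow> real (card P) \<ge> real m powr (2/3) \<longrightarrow> real (card Q) \<ge> real m powr (2/3)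
           \<longrightarrow> real (card (edges_between (R m d) P Q))
                 \<le> (1 + \<epsilon>) * 2 powr (real (delta x y) - real d) * real (card P) * real (card Q))"
      using R_prop[OF d \<epsilon>(1)] by blast
    have "good_host d m (4 * 4 ^ d * \<epsilon>) (R m d)" if m: "m \<ge> max M (nat \<lceil>(1 / \<epsilon>) ^ 3\<rceil>)" for m
    proof (rule good_hostI[OF _ _ d \<epsilon>(1)])
      show "ordered_graph (R m d)" "verts (R m d) = cube d \<times> {1..m}" using R_graph[of m d] by auto
      have "(1 / \<epsilon>) ^ 3 \<le> real m" using m real_nat_ceiling_ge[of "(1 / \<epsilon>) ^ 3"] by simp
      then show "real m powr (2/3) \<le> \<epsilon> * real m" by (rule powr_two_thirds_le[OF \<epsilon>(1)])
    qed (use M[of m] m in \<open>simp_all\<close>)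
    then show ?thesis unfolding \<epsilon>(2) by blast
  qed
  have fin: "finite (edges (R m d))" for m d
    by (rule ordered_graph_finite_edges) (use R_graph in blast)
  define L where "L d = lim (\<lambda>m. rho F (R m d))" for d
  have L: "(\<lambda>m. rho F (R m d)) \<longlonglongrightarrow> L d" if d: "d \<ge> 1" for d
  proof -
    have "convergent (\<lambda>m. rho F (R m d))"
      by (intro convergent_if_asymptotically_decreasing rho_bounds(1) fin F_nonempty
          rho_host_asymptotically_decreasing[OF F_nonempty d good[OF d]])
    then show ?thesis by (simp add: L_def convergent_LIMSEQ_iff)
  qed
  \<comment> \<open>For large \<open>m\<close> the host has an edge and so takes part in the
    infimum.\<close>
  have lower: "rho_lt F \<le> L d" if d: "d \<ge> 1" for d
  proof (rule LIMSEQ_le_const[OF L[OF d]])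
    obtain M where M: "\<And>m. m \<ge> M \<Longrightarrow> good_host d m (1/2) (R m d)" using good[OF d, of "1/2"] by auto
    have "rho_lt F \<le> rho F (R m d)" if m: "m \<ge> max M 1" for m
    proof (rule rho_lt_le[OF F_nonempty])
      show "ordered_graph (R m d)" using R_graph by blast
      have "1 * 1 \<le> real d * 2 ^ (d - 1)" using d by (intro mult_mono) auto
      then have "1 * real m ^ 2 \<le> real d * 2 ^ (d - 1) * real m ^ 2" by (intro mult_right_mono) auto
      moreover have "\<bar>real (card (edges (R m d))) - real d * 2 ^ (d - 1) * real m ^ 2\<bar> \<le> 1/2 * real m ^ 2"
        using M[of m] m unfolding good_host_def by (metis max.boundedE)
      moreover have "real m ^ 2 > 0" using m by simp
      ultimately have "real (card (edges (R m d))) > 0" by linarith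
      then show "edges (R m d) \<noteq> {}" by auto
    qed
    then show "\<exists>N. \<forall>m\<ge>N. rho_lt F \<le> rho F (R m d)" by blast
  qed
  have "L \<longlonglongrightarrow> rho_lt F"
  proof (rule LIMSEQ_I)
    fix e :: real assume e: "e > 0"
    then have e2: "e / 2 / 2 > 0" by simp
    \<comment> \<open>A nearly optimal \<open>G\<close> is fixed first; the dimension threshold that
      suits it then bounds the inner limits for all larger \<open>d\<close>.\<close>
    obtain G :: "nat ograph" where G: "ordered_graph G" "edges G \<noteq> {}" "rho F G < rho_lt F + e / 2 / 2"
      using exists_rho_less[OF e2] .
    obtain d0 where d0: "\<And>d R. d \<ge> d0 \<Longrightarrow> 1 \<le> d \<Longrightarrow> \<forall>\<eta>>0. \<exists>M. \<forall>m\<ge>M. good_host d m \<eta> (R m) \<Longrightarrow>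
        \<exists>M. \<forall>m\<ge>M. rho F (R m) \<le> rho F G + e / 2 / 2"
      using rho_host_le_rho[OF F_nonempty G(1,2) e2] by blast
    have "norm (L d - rho_lt F) < e" if d: "d \<ge> max d0 1" for d
    proof -
      have "\<exists>M. \<forall>m\<ge>M. rho F (R m d) \<le> rho F G + e / 2 / 2"
        using d good by (intro d0) auto
      then have "L d \<le> rho F G + e / 2 / 2" using L[of d] d by (intro LIMSEQ_le_const2) auto
      then show ?thesis using lower[of d] d G(3) e by simp
    qed
    then show "\<exists>no. \<forall>d\<ge>no. norm (L d - rho_lt F) < e" by blast
  qed
  then show ?thesis using L by blast
qed

end
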